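(* Assume $\dim V=n\ge2$, $p_{ii}\neq1$ for $1\le i\le n$, and that the set $D$ of hard super-letters of $\mathfrak{B}(V)$ is finite, $D=\{[u_1],\dots,[u_s]\}$ with $u_s<u_{s-1}<\dots<u_1$. Then the set $$\Big\{[u_1]^{k_1}[u_2]^{k_2}\cdots[u_s]^{k_s}\ :\ 0\le k_i<h_{u_i}\ (1\le i\le s),\ \textstyle\sum_{i=1}^sk_i>0,\ \mu([u_1]^{k_1}\cdots[u_s]^{k_s})\text{ is connected}\Big\}$$ is a basis of $\mathfrak{L}(V)$.
   Context: $V$ is a braided vector space of diagonal type over an algebraically closed field $F$ of characteristic $0$ with basis $x_1,\dots,x_n$, braiding $C(x_i\otimes x_j)=q_{ij}x_j\otimes x_i$, Nichols algebra $\mathfrak{B}(V)$ ($\mathbb{Z}^n$-graded, $\deg x_i=e_i$); $\chi(e_i,e_j)=q_{ij}$, $p_{ij}:=q_{ij}$, $p_{uv}:=\chi(\deg u,\deg v)$. For homogeneous $x,y$, $[x,y]:=yx-p_{yx}xy$; $\mathfrak{L}(V)$ is the linear span of all iterated brackets (any bracketing) of $x_1,\dots,x_n$. With $x_1<\dots<x_n$ and the lexicographic order on words, $D$ is the set of hard super-letters in the sense of Kharchenko, and $h_u\in\mathbb{N}\cup\{\infty\}$ is the height of $[u]\in D$; by the Kharchenko–Heckenberger PBW theorem the ordered products $[u_1]^{k_1}\cdots[u_s]^{k_s}$ with $0\le k_i<h_{u_i}$ form a basis of $\mathfrak{B}(V)$. For a nonzero homogeneous $w$ with $\deg w=\sum\lambda_ie_i$,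 $\mu(w)=\{x_i:\lambda_i>0\}$; $\Gamma(V)$ is the graph on $\{1,\dots,n\}$ with edge $\{i,j\}$ ($i\neq j$) iff $p_{ij}p_{ji}\ne1$, and $\mu(w)$ is connected iff the induced subgraph on $\{i:x_i\in\mu(w)\}$ is connected. *)

theory Defs
  imports Main "HOL-Library.Extended_Nat" "HOL-Computational_Algebra.Polynomial"
begin

section \<open>Tensor algebra T(V) of a diagonal braided vector space\<close>

text \<open>Letters x_1,...,x_n are encoded as the naturals 0,...,n-1 (with the
order of naturals, so x_1 < ... < x_n).  Words are nat lists.  Elements of
the tensor (free) algebra T(V) are functions from words to the field
(coefficient of each word).  The braiding matrix is q :: nat => nat => 'a,
with C(x_i (x) x_j) = q i j x_j (x) x_i.\<close>

type_synonym 'a tens = "nat list \<Rightarrow> 'a"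

definition tone :: "'a::field tens" where
  "tone = (\<lambda>w. if w = [] then 1 else 0)"

definition tletter :: "nat \<Rightarrow> 'a::field tens" where
  "tletter i = (\<lambda>w. if w = [i] then 1 else 0)"

definition tmul :: "'a::field tens \<Rightarrow> 'a tens \<Rightarrow> 'a tens" where
  "tmul x y = (\<lambda>w. \<Sum>i\<le>length w. x (take i w) * y (drop i w))"

definition tprod :: "'a::field tens list \<Rightarrow> 'a tens" where
  "tprod xs = foldr tmul xs tone"

definition tpow :: "'a::field tens \<Rightarrow> nat \<Rightarrow> 'a tens" where
  "tpow x k = tprod (replicate k x)"

text \<open>chi(deg u, deg v) for words u, v (bicharacter on Z^n-degrees).\<close>
definition chi :: "(nat \<Rightarrow> nat \<Rightarrow> 'a::field) \<Rightarrow> nat list \<Rightarrow> nat list \<Rightarrow> 'a" where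
  "chi q u v = (\<Prod>i<length u. \<Prod>j<length v. q (u ! i) (v ! j))"

text \<open>Skew bracket [x,y] := y x - c x y, where c = p_{yx}.\<close>
definition tbr :: "'a::field \<Rightarrow> 'a tens \<Rightarrow> 'a tens \<Rightarrow> 'a tens" where
  "tbr c x y = (\<lambda>w. tmul y x w - c * tmul x y w)"

section \<open>The Nichols ideal\<close>

text \<open>Coefficients of the quantum symmetrizer Omega_m, computed through the
factorisation Omega_m = (Omega_{m-1} (x) id) o (sum_k c_{m-1}...c_k).
qsym_rev q rv w = coefficient of the word (rev rv) in Omega_m(w).\<close>
primrec qsym_rev :: "(nat \<Rightarrow> nat \<Rightarrow> 'a::field) \<Rightarrow> nat list \<Rightarrow> nat list \<Rightarrow> 'a" where
  "qsym_rev q [] w = (if w = [] then 1 else 0)"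
| "qsym_rev q (j # rv) w =
     (\<Sum>k<length w. if w ! k = j
        then (\<Prod>l\<in>{Suc k..<length w}. q j (w ! l)) * qsym_rev q rv (take k w @ drop (Suc k) w)
        else 0)"

definition qsym :: "(nat \<Rightarrow> nat \<Rightarrow> 'a::field) \<Rightarrow> nat list \<Rightarrow> nat list \<Rightarrow> 'a" where
  "qsym q v w = qsym_rev q (rev v) w"

text \<open>x lies in the kernel of the projection T(V) -> B(V) iff
Omega(x) = 0, i.e. every coefficient of Omega applied to x vanishes
(Omega preserves the Z^n-degree, so only permutations of v contribute).\<close>
definition nichols_ker :: "(nat \<Rightarrow> nat \<Rightarrow> 'a::field) \<Rightarrow> 'a tens set" where
  "nichols_ker q = {x. \<forall>v. (\<Sum>w\<in>{w. mset w = mset v}. x w * qsym q v w) = 0}"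

text \<open>Linear algebra in B(V) = T(V)/nichols_ker, via representatives.\<close>
definition in_span_mod :: "(nat \<Rightarrow> nat \<Rightarrow> 'a::field) \<Rightarrow> 'a tens set \<Rightarrow> 'a tens \<Rightarrow> bool" where
  "in_span_mod q S x \<longleftrightarrow> (\<exists>F c. finite F \<and> F \<subseteq> S \<and>
      (\<lambda>w. x w - (\<Sum>y\<in>F. c y * y w)) \<in> nichols_ker q)"

definition lin_indep_mod :: "(nat \<Rightarrow> nat \<Rightarrow> 'a::field) \<Rightarrow> 'i set \<Rightarrow> ('i \<Rightarrow> 'a tens) \<Rightarrow> bool" where
  "lin_indep_mod q K f \<longleftrightarrow> (\<forall>F c. finite F \<and> F \<subseteq> K \<and>
      (\<lambda>w. \<Sum>k\<in>F. c k * f k w) \<in> nichols_ker q \<longrightarrow> (\<forall>k\<in>F. c k = 0))"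

definition basis_mod :: "(nat \<Rightarrow> nat \<Rightarrow> 'a::field) \<Rightarrow> 'i set \<Rightarrow> ('i \<Rightarrow> 'a tens) \<Rightarrow> 'a tens set \<Rightarrow> bool" where
  "basis_mod q K f L \<longleftrightarrow> lin_indep_mod q K f \<and>
      (\<forall>k\<in>K. in_span_mod q L (f k)) \<and> (\<forall>x\<in>L. in_span_mod q (f ` K) x)"

section \<open>Words, standard words, super-letters (Kharchenko)\<close>

text \<open>Lexicographic order on words (Kharchenko's convention: a word is
greater than each of its proper extensions, u > u v for v nonempty).\<close>
definition wless :: "nat list \<Rightarrow> nat list \<Rightarrow> bool" where
  "wless u v \<longleftrightarrow> (\<exists>w. w \<noteq> [] \<and> u = v @ w) \<or>
      (\<exists>p a b s t. a < b \<and> u = p @ a # s \<and> v = p @ b # t)"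

definition standard :: "nat list \<Rightarrow> bool" where
  "standard u \<longleftrightarrow> u \<noteq> [] \<and>
     (\<forall>i. 0 < i \<and> i < length u \<longrightarrow> wless (drop i u @ take i u) u)"

text \<open>Split point of the standard bracketing: u = v w, w the longest proper
standard end.\<close>
definition sfi :: "nat list \<Rightarrow> nat" where
  "sfi u = (if \<exists>i. 0 < i \<and> i < length u \<and> standard (drop i u)
            then LEAST i. 0 < i \<and> i < length u \<and> standard (drop i u) else 1)"

lemma sfi_bounds:
  assumes "2 \<le> length u" shows "0 < sfi u \<and> sfi u < length u"
proof (cases "\<exists>i. 0 < i \<and> i < length u \<and> standard (drop i u)")
  case True
  then obtain i where "0 < i \<and> i < length u \<and> standard (drop i u)" by blast
  then have "0 < (LEAST i. 0 < i \<and> i < length u \<and> standard (drop i u)) \<and>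
     (LEAST i. 0 < i \<and> i < length u \<and> standard (drop i u)) < length u"
    by (rule LeastI2_ex[OF exI]) auto
  then show ?thesis using True by (simp add: sfi_def)
next
  case False
  then have "sfi u = 1" unfolding sfi_def by meson
  then show ?thesis using assms by simp
qed

function sl :: "(nat \<Rightarrow> nat \<Rightarrow> 'a::field) \<Rightarrow> nat list \<Rightarrow> 'a tens" where
  "sl q u = (if length u < 2 then (if u = [] then tone else tletter (hd u))
     else tbr (chi q (drop (sfi u) u) (take (sfi u) u))
              (sl q (take (sfi u) u)) (sl q (drop (sfi u) u)))"
  by auto
termination
proof (relation "measure (\<lambda>(q, u). length u)")
  fix q :: "nat \<Rightarrow> nat \<Rightarrow> 'a" and u :: "nat list"
  assume "\<not> length u < 2"
  then have "0 < sfi u \<and> sfi u < length u" by (simp add: sfi_bounds)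
  then show "((q, take (sfi u) u), q, u) \<in> measure (\<lambda>(q, u). length u)"
    and "((q, drop (sfi u) u), q, u) \<in> measure (\<lambda>(q, u). length u)" by auto
qed auto

declare sl.simps[simp del]

definition word_over :: "nat \<Rightarrow> nat list \<Rightarrow> bool" where
  "word_over n u \<longleftrightarrow> set u \<subseteq> {..<n}"

text \<open>Values of super-words of multidegree d (given as a multiset of letters)
in super-letters [v] with v < u.\<close>
definition lower_superwords ::
  "(nat \<Rightarrow> nat \<Rightarrow> 'a::field) \<Rightarrow> nat \<Rightarrow> nat list \<Rightarrow> nat multiset \<Rightarrow> 'a tens set" where
  "lower_superwords q n u d = {tprod (map (sl q) vs) | vs.
      (\<forall>v\<in>set vs. standard v \<and> word_over n v \<and> wless v u) \<and> mset (concat vs) = d}"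

definition hard :: "(nat \<Rightarrow> nat \<Rightarrow> 'a::field) \<Rightarrow> nat \<Rightarrow> nat list \<Rightarrow> bool" where
  "hard q n u \<longleftrightarrow> standard u \<and> word_over n u \<and>
      \<not> in_span_mod q (lower_superwords q n u (mset u)) (sl q u)"

definition primitive_root :: "'a::field \<Rightarrow> nat \<Rightarrow> bool" where
  "primitive_root z t \<longleftrightarrow> 0 < t \<and> z ^ t = 1 \<and> (\<forall>m. 0 < m \<and> m < t \<longrightarrow> z ^ m \<noteq> 1)"

text \<open>Kharchenko's height (characteristic 0): the smallest h such that
p_uu is a primitive h-th root of 1 and [u]^h is a linear combination of
super-words of the same degree in super-letters less than [u]; infinity if
there is no such h.\<close>
definition height_cond :: "(nat \<Rightarrow> nat \<Rightarrow> 'a::field) \<Rightarrow> nat \<Rightarrow> nat list \<Rightarrow> nat \<Rightarrow> bool" where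
  "height_cond q n u h \<longleftrightarrow> primitive_root (chi q u u) h \<and>
     in_span_mod q (lower_superwords q n u (repeat_mset h (mset u))) (tpow (sl q u) h)"

definition height :: "(nat \<Rightarrow> nat \<Rightarrow> 'a::field) \<Rightarrow> nat \<Rightarrow> nat list \<Rightarrow> enat" where
  "height q n u = (if \<exists>h. height_cond q n u h then enat (LEAST h. height_cond q n u h) else \<infinity>)"

section \<open>L(V): span of iterated brackets of the generators\<close>

inductive_set brackets :: "(nat \<Rightarrow> nat \<Rightarrow> 'a::field) \<Rightarrow> nat \<Rightarrow> ('a tens \<times> nat list) set"
  for q n where
  gen: "i < n \<Longrightarrow> (tletter i, [i]) \<in> brackets q n"
| br: "(x, a) \<in> brackets q n \<Longrightarrow> (y, b) \<in> brackets q n \<Longrightarrow>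
       (tbr (chi q b a) x y, a @ b) \<in> brackets q n"

definition Lie_elems :: "(nat \<Rightarrow> nat \<Rightarrow> 'a::field) \<Rightarrow> nat \<Rightarrow> 'a tens set" where
  "Lie_elems q n = fst ` brackets q n"

section \<open>mu and connectivity\<close>

text \<open>mu(w): letters occurring in the degree of a (homogeneous) element.\<close>
definition mu :: "'a::field tens \<Rightarrow> nat set" where
  "mu x = {i. \<exists>w. x w \<noteq> 0 \<and> i \<in> set w}"

definition connected_in :: "(nat \<Rightarrow> nat \<Rightarrow> 'a::field) \<Rightarrow> nat set \<Rightarrow> bool" where
  "connected_in q S \<longleftrightarrow> S \<noteq> {} \<and>
     (\<forall>i\<in>S. \<forall>j\<in>S. (i, j) \<in> {(a, b). a \<in> S \<and> b \<in> S \<and> a \<noteq> b \<and> q a b * q b a \<noteq> 1}\<^sup>*)"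

text \<open>PBW monomial [u_1]^{k_1} ... [u_s]^{k_s}.\<close>
definition pbw_mono :: "(nat \<Rightarrow> nat \<Rightarrow> 'a::field) \<Rightarrow> nat list list \<Rightarrow> nat list \<Rightarrow> 'a tens" where
  "pbw_mono q us ks = tprod (map (\<lambda>(u, k). tpow (sl q u) k) (zip us ks))"

definition alg_closed :: "'a::field itself \<Rightarrow> bool" where
  "alg_closed _ \<longleftrightarrow> (\<forall>p :: 'a poly. 0 < degree p \<longrightarrow> (\<exists>x. poly p x = 0))"

end

theory Submission
  imports Defs
begin

text \<open>
  Two facts together give the theorem: a homogeneous component of \<open>B(V)\<close> of degree \<open>d\<close> is contained
  in \<open>L(V)\<close> if the support of \<open>d\<close> is connected and meets \<open>L(V)\<close> trivially otherwise, and the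
  monomials \<open>[u\<^sub>1]\<^bsup>k\<^sub>1\<^esup> \<dots> [u\<^sub>s]\<^bsup>k\<^sub>s\<^esup>\<close> below the heights form a basis of \<open>B(V)\<close>.

  For the first fact, let \<open>d\<close> be connected of minimal size. Modulo brackets a word may be rotated,
  \<open>y x \<equiv> \<chi>(y, x) x y\<close>, whenever the degrees of \<open>x\<close> and \<open>y\<close> are connected. Every word is
  congruent to a multiple of a word \<open>x\<^sub>i x\<^sub>k v\<close> with \<open>p\<^sub>i\<^sub>k p\<^sub>k\<^sub>i \<noteq> 1\<close>. Rotating \<open>x\<^sub>i\<close> and \<open>x\<^sub>k\<close>
  separately or \<open>x\<^sub>i x\<^sub>k\<close> at once yields the same word with scalars that differ by the factor
  \<open>p\<^sub>i\<^sub>k p\<^sub>k\<^sub>i\<close>, so the word is a sum of brackets. If a letter that occurs only once is a cut vertex,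
  one side of the cut commutes with the other and the claim is inherited from a smaller degree.

  The second fact is Kharchenko's theorem. The super-words in super-letters smaller than \<open>[u]\<close> span
  an algebra \<open>U\<close> that is stable under the skew derivations and normalized by \<open>[u]\<close>. A relation
  \<open>\<Sum> [u]\<^sup>k a\<^sub>k = 0\<close> of minimal degree with \<open>a\<^sub>k \<in> U\<close> has a scalar leading coefficient, and its
  derivatives show that \<open>[u]\<close>, or \<open>[u]\<^sup>t\<close> with \<open>t\<close> the order of \<open>p\<^sub>u\<^sub>u\<close>, lies in \<open>U\<close>.
\<close>

section \<open>Noncommutative series, skew derivations and the Nichols ideal\<close>

section \<open>The free algebra as a ring\<close>

text \<open>No bound on supports is imposed, so these are noncommutative power series, and
  \<open>J\<close> behaves as an ideal only on homogeneous elements. Hence degrees are carried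
  everywhere, and each span contains the part of \<open>J\<close> of its degree, so that identities
  of B(V) become exact ones in the free algebra.

  Removing a letter from a connected degree can disconnect the support only if that letter occurs
  once; this is why the cut vertex needs its own argument. The comparison of scalars needs nonzero
  braiding factors; a letter with nontrivial double braiding against the remaining degree is treated
  before it, through its two brackets with the rest.

  In the PBW part the leading factor of a derived power is the r-number (m)_r with r = p_uu. At a
  root of unity of order t >= 2 it vanishes for m = t. There the Gaussian binomials vanish strictly
  between 0 and t, so [u]^t is again normalizing with derivatives in U. Independence is then proved
  twice: for the powers of [u]^t over U, where the parameter is 1 and characteristic 0 helps, and
  for the powers of [u] below t over U extended by [u]^t.\<close>

typedef 'a nc = "UNIV :: (nat list \<Rightarrow> 'a) set" morphisms coef Nc
  by simp

lemma coef_Nc [simp]: "coef (Nc f) = f"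
  by (simp add: Nc_inverse)

lemma Nc_coef [simp]: "Nc (coef x) = x"
  by (rule coef_inverse)

lemma nc_eqI: "(\<And>w. coef x w = coef y w) \<Longrightarrow> x = y"
  by (metis Nc_coef ext)

lemma tmul_Nil [simp]: "tmul x y [] = x [] * y []"
  by (simp add: tmul_def)

text \<open>Peeling off the first letter replaces the left factor by its shift
  \<open>\<lambda>u. x (a # u)\<close>. Inductions on a word with arbitrary left factor rest on
  this, among them associativity and the Leibniz rule.\<close>

lemma tmul_Cons: "tmul x y (a # w) = x [] * y (a # w) + tmul (\<lambda>u. x (a # u)) y w"
  unfolding tmul_def by (simp only: length_Cons sum.atMost_Suc_shift) simp

lemma tmul_add_left: "tmul (\<lambda>w. x w + y w) z w = tmul x z w + tmul y z w"
  by (simp add: tmul_def sum.distrib algebra_simps)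

lemma tmul_add_right: "tmul x (\<lambda>w. y w + z w) w = tmul x y w + tmul x z w"
  by (simp add: tmul_def sum.distrib algebra_simps)

lemma tmul_scale_left: "tmul (\<lambda>w. c * x w) y w = c * tmul x y w"
  by (simp add: tmul_def sum_distrib_left algebra_simps)

lemma tmul_scale_right: "tmul x (\<lambda>w. c * y w) w = c * tmul x y w"
  by (simp add: tmul_def sum_distrib_left algebra_simps)

lemma tmul_assoc: "tmul (tmul x y) z w = tmul x (tmul y z) w"
proof (induction w arbitrary: x)
  case (Cons a w)
  show ?case
    by (simp add: tmul_Cons tmul_add_left tmul_scale_left Cons.IH algebra_simps)
qed simp

lemma tmul_tone_left: "tmul tone x w = x w"
proof (cases w)
  case (Cons a v)
  have "tmul (\<lambda>u. tone (a # u)) x v = (0::'a)"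
    by (simp add: tmul_def tone_def)
  then show ?thesis by (simp add: Cons tmul_Cons) (simp add: tone_def)
qed (simp add: tone_def)

lemma tmul_tone_right: "tmul x tone w = x w"
  by (induction w arbitrary: x) (simp_all add: tmul_Cons, simp_all add: tone_def)

instantiation nc :: (field) ring_1
begin

definition "0 = Nc (\<lambda>_. 0)"
definition "1 = Nc tone"
definition "x + y = Nc (\<lambda>w. coef x w + coef y w)"
definition "x - y = Nc (\<lambda>w. coef x w - coef y w)"
definition "- x = Nc (\<lambda>w. - coef x w)"
definition "x * y = Nc (tmul (coef x) (coef y))"

lemmas nc_defs = zero_nc_def one_nc_def plus_nc_def minus_nc_def uminus_nc_def times_nc_def

instance
proof
  fix a b c :: "'a nc"
  show "a * b * c = a * (b * c)"
    by (rule nc_eqI) (simp add: nc_defs tmul_assoc)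
  show "1 * a = a" "a * 1 = a"
    by (rule nc_eqI, simp add: nc_defs tmul_tone_left tmul_tone_right)+
  show "(a + b) * c = a * c + b * c" "a * (b + c) = a * b + a * c"
    by (rule nc_eqI, simp add: nc_defs tmul_add_left tmul_add_right)+
  show "(0 :: 'a nc) \<noteq> 1"
    by (metis coef_Nc one_nc_def tone_def zero_nc_def zero_neq_one)
qed (auto intro!: nc_eqI simp: nc_defs)

end

lemma coef_add [simp]: "coef (x + y) w = coef x w + coef y w"
  and coef_diff [simp]: "coef (x - y) w = coef x w - coef y w"
  and coef_uminus [simp]: "coef (- x) w = - coef x w"
  and coef_0 [simp]: "coef 0 w = 0"
  and coef_1: "coef 1 = tone"
  and coef_mult: "coef (x * y) = tmul (coef x) (coef y)"
  by (simp_all add: nc_defs)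

lemma coef_sum [simp]: "coef (sum f A) w = (\<Sum>a\<in>A. coef (f a) w)"
  by (induction A rule: infinite_finite_induct) auto

definition sc :: "'a::field \<Rightarrow> 'a nc \<Rightarrow> 'a nc"  (infixr \<open>\<odot>\<close> 75)
  where "c \<odot> x = Nc (\<lambda>w. c * coef x w)"

lemma coef_sc [simp]: "coef (c \<odot> x) w = c * coef x w"
  by (simp add: sc_def)

global_interpretation nc: vector_space sc
  by unfold_locales (auto intro!: nc_eqI simp: algebra_simps)

lemma sc_mult_left [simp]: "(c \<odot> x) * y = c \<odot> (x * y)"
  by (rule nc_eqI) (simp add: coef_mult sc_def tmul_scale_left)

lemma sc_mult_right [simp]: "x * (c \<odot> y) = c \<odot> (x * y)"
  by (rule nc_eqI) (simp add: coef_mult sc_def tmul_scale_right)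

lemma subspace_sc_cancel:
  assumes "nc.subspace S" "c \<odot> x \<in> S" "c \<noteq> 0"
  shows "x \<in> S"
  using nc.subspace_scale[OF assms(1,2), of "inverse c"] assms(3) by simp

definition X :: "nat list \<Rightarrow> 'a::field nc"
  where "X w = Nc (\<lambda>v. if v = w then 1 else 0)"

lemma coef_X: "coef (X w) v = (if v = w then 1 else 0)"
  by (simp add: X_def)

lemma X_Nil: "X [] = 1"
  by (simp add: X_def one_nc_def tone_def)

lemma X_mult: "X u * X v = X (u @ v)"
proof (rule nc_eqI)
  fix w :: "nat list"
  have "tmul (coef (X u :: 'a nc)) (coef (X v)) w = coef (X (u @ v)) w"
  proof (induction u arbitrary: w)
    case Nil
    show ?case by (simp add: X_Nil coef_1 tmul_tone_left)
  next
    case (Cons a u)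
    show ?case
    proof (cases w)
      case (Cons b w')
      have "(\<lambda>t. coef (X (a # u) :: 'a nc) (b # t)) = (\<lambda>t. of_bool (a = b) * coef (X u) t)"
        by (auto simp: coef_X)
      then show ?thesis
        using Cons.IH[of w'] by (auto simp: Cons tmul_Cons tmul_scale_left coef_X)
    qed (simp add: coef_X)
  qed
  then show "coef (X u * X v :: 'a nc) w = coef (X (u @ v)) w"
    by (simp add: coef_mult)
qed

text \<open>Degrees in \<open>\<nat>\<^sup>n\<close> are encoded as multisets of letters.\<close>

definition H :: "nat multiset \<Rightarrow> 'a::field nc set"
  where "H d = {x. \<forall>w. coef x w \<noteq> 0 \<longrightarrow> mset w = d}"

lemma H_subspace: "nc.subspace (H d)"
  unfolding H_def by (rule nc.subspaceI) (simp_all, metis add.right_neutral)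

lemmas H_add = nc.subspace_add[OF H_subspace]
  and H_diff = nc.subspace_diff[OF H_subspace]
  and H_sc = nc.subspace_scale[OF H_subspace]

lemma X_in_H: "mset w = d \<Longrightarrow> X w \<in> H d"
  by (simp add: H_def coef_X)

lemma one_in_H: "1 \<in> H {#}"
  using X_in_H[of "[]"] by (simp add: X_Nil)

lemma H_mult: "x \<in> H d \<Longrightarrow> y \<in> H e \<Longrightarrow> x * y \<in> H (d + e)"
proof -
  assume x: "x \<in> H d" and y: "y \<in> H e"
  show "x * y \<in> H (d + e)"
    unfolding H_def
  proof (clarify)
    fix w assume "coef (x * y) w \<noteq> 0"
    then obtain i where "coef x (take i w) \<noteq> 0" "coef y (drop i w) \<noteq> 0"
      unfolding coef_mult tmul_def by (metis (no_types, lifting) mult_eq_0_iff sum.neutral)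
    with x y have "mset (take i w) = d" "mset (drop i w) = e"
      by (auto simp: H_def)
    then show "mset w = d + e"
      by (metis append_take_drop_id mset_append)
  qed
qed

lemma skew_H: "x \<in> H d \<Longrightarrow> y \<in> H e \<Longrightarrow> y * x - c \<odot> (x * y) \<in> H (d + e)"
  using H_mult[of x d y e] H_mult[of y e x d] H_diff H_sc by (metis add.commute)

lemma finite_mset_eq: "finite {w. mset w = d}"
  by (rule finite_subset[OF _ finite_lists_length_eq[of "set_mset d" "size d"]]) auto

lemma H_expand: "x \<in> H d \<Longrightarrow> x = (\<Sum>w | mset w = d. coef x w \<odot> X w)"
  by (rule nc_eqI) (auto simp: coef_X if_distrib finite_mset_eq H_def cong: if_cong)

lemma H_span: "H d = nc.span (X ` {w. mset w = d})"
proof (intro equalityI subsetI)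
  fix x :: "'a nc"
  {
    assume "x \<in> nc.span (X ` {w. mset w = d})"
    then show "x \<in> H d"
      by (rule nc.span_induct) (auto simp: H_subspace X_in_H)
  next
    assume "x \<in> H d"
    then have "x = (\<Sum>w | mset w = d. coef x w \<odot> X w)"
      by (rule H_expand)
    also have "\<dots> \<in> nc.span (X ` {w. mset w = d})"
      by (intro nc.span_sum nc.span_scale nc.span_base) auto
    finally show "x \<in> nc.span (X ` {w. mset w = d})" .
  }
qed

lemma H_subset_iff:
  assumes "nc.subspace S"
  shows "H d \<subseteq> S \<longleftrightarrow> (\<forall>w. mset w = d \<longrightarrow> X w \<in> S)"
  by (metis (mono_tags, lifting) H_span X_in_H assms image_subset_iff mem_Collect_eq nc.span_minimal subset_iff)

lemma H_empty: "x \<in> H {#} \<Longrightarrow> x = coef x [] \<odot> 1"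
  by (subst H_expand) (auto simp: X_Nil)

lemma span_mult:
  assumes "x \<in> nc.span A" "y \<in> nc.span B" "nc.subspace S"
    and "\<And>a b. a \<in> A \<Longrightarrow> b \<in> B \<Longrightarrow> a * b \<in> S"
  shows "x * y \<in> S"
proof -
  have "a * y \<in> S" if "a \<in> A" for a
    using assms(2)
  proof (induction rule: nc.span_induct_alt)
    case base
    then show ?case using nc.subspace_0[OF assms(3)] by simp
  next
    case (step c b z)
    then show ?case
      using assms(3,4) that by (auto simp: distrib_left intro!: nc.subspace_add nc.subspace_scale)
  qed
  with assms(1) show ?thesis
  proof (induction rule: nc.span_induct_alt)
    case base
    then show ?case using nc.subspace_0[OF assms(3)] by simp
  next
    case (step c b z)
    then show ?case
      using assms(3) by (auto simp: distrib_right intro!: nc.subspace_add nc.subspace_scale)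
  qed
qed

section \<open>Skew derivations and the Nichols ideal\<close>

definition chim :: "(nat \<Rightarrow> nat \<Rightarrow> 'a::field) \<Rightarrow> nat multiset \<Rightarrow> nat multiset \<Rightarrow> 'a"
  where "chim q d e = (\<Prod>i\<in>#d. \<Prod>j\<in>#e. q i j)"

lemma chim_empty [simp]: "chim q {#} e = 1" "chim q d {#} = 1"
  by (simp_all add: chim_def)

lemma chim_add_left: "chim q (d + d') e = chim q d e * chim q d' e"
  by (simp add: chim_def)

lemma chim_add_right: "chim q d (e + e') = chim q d e * chim q d e'"
  by (induction d) (simp_all add: chim_def)

lemma chim_single [simp]: "chim q {#i#} {#j#} = q i j"
  by (simp add: chim_def)

lemma chi_chim: "chi q u v = chim q (mset u) (mset v)"
proof -
  have *: "(\<Prod>i<length u. f (u ! i)) = (\<Prod>i\<in>#mset u. f i)" for f :: "nat \<Rightarrow> 'a" and u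
    by (simp add: prod_mset_prod_list prod.list_conv_set_nth lessThan_atLeast0 flip: mset_map)
  show ?thesis
    by (simp add: chi_def chim_def *[of "q _"] *[of "\<lambda>i. prod_mset (image_mset (q i) _)"])
qed

locale braiding =
  fixes q :: "nat \<Rightarrow> nat \<Rightarrow> 'a::field"
begin

abbreviation ch :: "nat multiset \<Rightarrow> nat multiset \<Rightarrow> 'a" where "ch \<equiv> chim q"

text \<open>The bracket [x, y] for x of degree \<open>d\<close> and y of degree \<open>e\<close>.
  The degrees are arguments because 0 belongs to every \<open>H d\<close>.\<close>

abbreviation br :: "nat multiset \<Rightarrow> nat multiset \<Rightarrow> 'a nc \<Rightarrow> 'a nc \<Rightarrow> 'a nc"
  where "br d e x y \<equiv> y * x - ch e d \<odot> (x * y)"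

definition J :: "'a nc set"
  where "J = {x. coef x \<in> nichols_ker q}"

text \<open>The recursion step in the definition of \<^term>\<open>qsym_rev\<close>, read as a skew derivation.\<close>

definition der :: "nat \<Rightarrow> 'a nc \<Rightarrow> 'a nc"
  where "der j x = Nc (\<lambda>v. \<Sum>k\<le>length v.
           coef x (take k v @ j # drop k v) * prod_list (map (q j) (drop k v)))"

text \<open>The diagonal endomorphism that makes \<open>der j\<close> a twisted derivation: a word
  is scaled by the factor for moving x_j across it.\<close>

definition twist :: "nat \<Rightarrow> 'a nc \<Rightarrow> 'a nc"
  where "twist j x = Nc (\<lambda>w. prod_list (map (q j) w) * coef x w)"

lemma der_Nil: "coef (der j x) [] = coef x [j]"
  by (simp add: der_def)

lemma der_Cons:
  "coef (der j x) (a # v) =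
     coef (der j (Nc (\<lambda>u. coef x (a # u)))) v + coef x (j # a # v) * prod_list (map (q j) (a # v))"
  unfolding der_def coef_Nc
  by (simp only: length_Cons sum.atMost_Suc_shift) simp

lemma der_add: "der j (x + y) = der j x + der j y"
  by (rule nc_eqI) (simp add: der_def distrib_right sum.distrib)

lemma der_sc: "der j (c \<odot> x) = c \<odot> der j x"
  by (rule nc_eqI) (simp add: der_def sum_distrib_left mult.assoc)

lemma der_diff: "der j (x - y) = der j x - der j y"
  by (rule nc_eqI) (simp add: der_def left_diff_distrib sum_subtractf)

lemma der_0 [simp]: "der j 0 = 0"
  by (rule nc_eqI) (simp add: der_def)

text \<open>The letter \<open>j\<close> is inserted either into the part of the word that belongs to
  \<open>y\<close> or into the part that belongs to \<open>x\<close>. In the second case it passes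
  all of \<open>y\<close>, which \<open>twist j y\<close> records.\<close>

lemma der_mult: "der j (x * y) = x * der j y + der j x * twist j y"
proof (rule nc_eqI)
  fix w
  show "coef (der j (x * y)) w = coef (x * der j y + der j x * twist j y) w"
  proof (induction w arbitrary: x)
    case Nil
    show ?case
      by (simp add: der_Nil coef_mult tmul_Cons twist_def)
  next
    case (Cons a w)
    let ?xa = "Nc (\<lambda>u. coef x (a # u))"
    let ?ya = "Nc (\<lambda>u. coef y (a # u))"
    let ?Q = "\<lambda>w. prod_list (map (q j) w)"
    have s: "Nc (\<lambda>u. coef (x * y) (a # u)) = coef x [] \<odot> ?ya + ?xa * y"
      by (rule nc_eqI) (simp add: coef_mult tmul_Cons)
    have tw: "tmul (\<lambda>u. f u * ?Q (a # u)) (coef (twist j y)) w = ?Q (a # w) * tmul f (coef y) w" for f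
    proof -
      have "?Q (take i w) * ?Q (drop i w) = ?Q w" for i
        by (metis append_take_drop_id map_append prod_list.append)
      then have eq: "A * (q j a * ?Q (take i w)) * (?Q (drop i w) * B) = q j a * ?Q w * (A * B)" for i A B
        by (metis (no_types, lifting) ab_semigroup_mult_class.mult_ac(1) mult.commute)
      show ?thesis
        by (simp add: tmul_def twist_def eq sum_distrib_left)
    qed
    have "coef (der j (x * y)) (a # w) =
        coef x [] * coef (der j ?ya) w + coef (der j (?xa * y)) w + coef (x * y) (j # a # w) * ?Q (a # w)"
      by (simp add: der_Cons s der_add der_sc)
    also have "coef (der j (?xa * y)) w = coef (?xa * der j y) w + coef (der j ?xa * twist j y) w"
      by (simp add: Cons.IH)
    finally have L: "coef (der j (x * y)) (a # w) =
        coef x [] * coef (der j ?ya) w + (coef (?xa * der j y) w + coef (der j ?xa * twist j y) w)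
        + coef (x * y) (j # a # w) * ?Q (a # w)" .
    have R1: "coef (x * der j y) (a # w) = coef x [] * (coef (der j ?ya) w + coef y (j # a # w) * ?Q (a # w))
        + coef (?xa * der j y) w"
      by (simp add: coef_mult tmul_Cons der_Cons)
    have R2: "coef (der j x * twist j y) (a # w) = coef x [j] * (?Q (a # w) * coef y (a # w))
        + (coef (der j ?xa * twist j y) w
           + ?Q (a # w) * tmul (\<lambda>u. coef x (j # a # u)) (coef y) w)"
      unfolding coef_mult tmul_Cons der_Nil der_Cons tmul_add_left tw
      by (simp add: twist_def)
    show ?case
      unfolding coef_add L R1 R2 by (simp add: coef_mult tmul_Cons algebra_simps)
  qed
qed

lemma twist_H: "x \<in> H d \<Longrightarrow> twist j x = ch {#j#} d \<odot> x"
proof (rule nc_eqI)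
  fix w assume "x \<in> H d"
  then have "coef x w = 0 \<or> mset w = d"
    by (auto simp: H_def)
  then show "coef (twist j x) w = coef (ch {#j#} d \<odot> x) w"
    by (auto simp: twist_def chim_def prod_mset_prod_list simp flip: mset_map)
qed

lemma der_mult_H: "y \<in> H e \<Longrightarrow> der j (x * y) = x * der j y + ch {#j#} e \<odot> (der j x * y)"
  by (simp add: der_mult twist_H)

lemma der_H: "x \<in> H d \<Longrightarrow> der j x \<in> H (d - {#j#})"
  unfolding H_def
proof (clarify)
  fix w assume x: "\<forall>w. coef x w \<noteq> 0 \<longrightarrow> mset w = d" and "coef (der j x) w \<noteq> 0"
  then obtain k where "coef x (take k w @ j # drop k w) \<noteq> 0"
    unfolding der_def by (metis (no_types, lifting) coef_Nc mult_eq_0_iff sum.neutral)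
  with x have "mset (take k w @ j # drop k w) = d" by blast
  then have "add_mset j (mset (take k w @ drop k w)) = d"
    by (simp del: append_take_drop_id)
  then show "mset w = d - {#j#}"
    by auto
qed

lemma der_eq_0: "x \<in> H d \<Longrightarrow> j \<notin># d \<Longrightarrow> der j x = 0"
proof (rule nc_eqI)
  fix w assume "x \<in> H d" "j \<notin># d"
  then have "coef x (take k w @ j # drop k w) = 0" for k
    unfolding H_def by (metis (mono_tags, lifting) in_set_conv_decomp mem_Collect_eq set_mset_mset)
  then show "coef (der j x) w = coef 0 w"
    by (simp add: der_def)
qed

lemma der_1 [simp]: "der j 1 = 0"
  using der_eq_0[OF one_in_H] by simp

lemma der_letter: "der j (X [i]) = (if i = j then 1 else 0)"
proof (cases "i = j")
  case True
  then show ?thesis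
    using H_empty[of "der j (X [i])"] der_H[OF X_in_H[of "[i]" "{#i#}"], of j] by (simp add: der_Nil coef_X)
next
  case False
  then show ?thesis using der_eq_0[OF X_in_H[of "[i]" "{#i#}"]] by simp
qed

text \<open>Pairs (w, k) with \<open>w ! k = j\<close> correspond to pairs of a word shorter by one
  letter and an insertion point in it. Under this bijection the recursion of the symmetrizer on the
  last letter of the target word becomes the adjoint operator \<open>der j\<close>.\<close>

lemma qsym_snoc:
  "(\<Sum>w | mset w = add_mset j (mset v). x w * qsym q (v @ [j]) w) =
   (\<Sum>w | mset w = mset v. coef (der j (Nc x)) w * qsym q v w)"
proof -
  let ?c = "\<lambda>w k. x w * ((\<Prod>l\<in>{Suc k..<length w}. q j (w ! l)) * qsym q v (take k w @ drop (Suc k) w))"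
  let ?A = "{w. mset w = add_mset j (mset v)}" and ?B = "{w. mset w = mset v}"
  have Q: "(\<Prod>l\<in>{Suc k..<length w}. q j (w ! l)) = prod_list (map (q j) (drop (Suc k) w))" for k w
  proof (cases "Suc k \<le> length w")
    case True
    show ?thesis
      unfolding prod.list_conv_set_nth
      by (rule prod.reindex_bij_witness[of _ "\<lambda>i. i + Suc k" "\<lambda>l. l - Suc k"]) (use True in auto)
  qed simp
  have "(\<Sum>w\<in>?A. x w * qsym q (v @ [j]) w) =
      (\<Sum>w\<in>?A. \<Sum>k\<in>{k. k < length w \<and> w ! k = j}. ?c w k)"
  proof (intro sum.cong refl)
    fix w
    have "qsym q (v @ [j]) w = (\<Sum>k<length w. if w ! k = j then (\<Prod>l\<in>{Suc k..<length w}. q j (w ! l))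
        * qsym q v (take k w @ drop (Suc k) w) else 0)"
      by (simp add: qsym_def cong: if_cong)
    also have "\<dots> = (\<Sum>k\<in>{k \<in> {..<length w}. w ! k = j}. (\<Prod>l\<in>{Suc k..<length w}. q j (w ! l))
        * qsym q v (take k w @ drop (Suc k) w))"
      by (rule sum.inter_filter[symmetric]) simp
    finally show "x w * qsym q (v @ [j]) w = (\<Sum>k\<in>{k. k < length w \<and> w ! k = j}. ?c w k)"
      by (simp add: sum_distrib_left)
  qed
  also have "\<dots> = (\<Sum>(w, k)\<in>(SIGMA w:?A. {k. k < length w \<and> w ! k = j}). ?c w k)"
    by (rule sum.Sigma) (auto simp: finite_mset_eq)
  also have "\<dots> = (\<Sum>(w, k)\<in>(SIGMA w:?B. {..length w}).
      x (take k w @ j # drop k w) * prod_list (map (q j) (drop k w)) * qsym q v w)"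
  proof (rule sum.reindex_bij_witness[of _ "\<lambda>(w, k). (take k w @ j # drop k w, k)"
        "\<lambda>(w, k). (take k w @ drop (Suc k) w, k)"], goal_cases)
    case (1 a)
    then obtain w k where a: "a = (w, k)" "k < length w" "w ! k = j"
      by auto
    then show ?case using id_take_nth_drop[OF a(2)] by (simp add: min_def)
  next
    case (2 a)
    then obtain w k where a: "a = (w, k)" "mset w = add_mset j (mset v)" "k < length w" "w ! k = j"
      by auto
    have "mset w = add_mset (w ! k) (mset (take k w) + mset (drop (Suc k) w))"
      by (subst id_take_nth_drop[OF a(3)]) simp
    then show ?case using a by auto
  next
    case (3 b)
    then show ?case by (auto simp: min_def Suc_diff_le split: prod.splits)
  next
    case (4 b)
    then obtain w k where b: "b = (w, k)" "mset w = mset v" "k \<le> length w"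
      by auto
    then have "mset (take k w @ drop k w) = mset v" by simp
    then show ?case using b by (auto simp: nth_append min_def simp del: append_take_drop_id)
  next
    case (5 a)
    then obtain w k where a: "a = (w, k)" "k < length w" "w ! k = j"
      by auto
    then show ?case
      using id_take_nth_drop[OF a(2)] by (auto simp: a Q min_def)
  qed
  also have "\<dots> = (\<Sum>w\<in>?B. \<Sum>k\<le>length w.
      x (take k w @ j # drop k w) * prod_list (map (q j) (drop k w)) * qsym q v w)"
    by (rule sum.Sigma[symmetric]) (auto simp: finite_mset_eq)
  finally show ?thesis
    by (simp add: der_def sum_distrib_right)
qed

text \<open>The coefficient of the word \<open>v\<close> in the symmetrizer applied to
  \<open>x\<close>. Peeling letters off the end of \<open>v\<close> turns it into the constant term
  of an iterated derivative.\<close>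

definition qform :: "nat list \<Rightarrow> 'a nc \<Rightarrow> 'a"
  where "qform v x = (\<Sum>w | mset w = mset v. coef x w * qsym q v w)"

lemma qform_Nil: "qform [] x = coef x []"
  by (simp add: qform_def qsym_def)

lemma qform_snoc: "qform (v @ [j]) x = qform v (der j x)"
  using qsym_snoc[where x = "coef x"] by (simp add: qform_def)

lemma in_J_qform: "x \<in> J \<longleftrightarrow> (\<forall>v. qform v x = 0)"
  by (simp add: J_def nichols_ker_def qform_def)

text \<open>Membership in the Nichols ideal is tested by derivatives, which replaces most further
  work with the symmetrizer.\<close>

lemma J_iff: "x \<in> J \<longleftrightarrow> coef x [] = 0 \<and> (\<forall>j. der j x \<in> J)"
  unfolding in_J_qform by (metis qform_Nil qform_snoc rev_exhaust)

lemma J_subspace: "nc.subspace J"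
  by (rule nc.subspaceI)
    (auto simp: in_J_qform qform_def distrib_right sum.distrib mult.assoc simp flip: sum_distrib_left)

lemmas J_add = nc.subspace_add[OF J_subspace]
  and J_diff = nc.subspace_diff[OF J_subspace]
  and J_sc = nc.subspace_scale[OF J_subspace]

lemma der_in_J: "x \<in> J \<Longrightarrow> der j x \<in> J"
  using J_iff by blast

lemma in_JI:
  assumes "x \<in> H d" "d \<noteq> {#}" "\<And>j. j \<in># d \<Longrightarrow> der j x \<in> J"
  shows "x \<in> J"
proof -
  have "der j x \<in> J" for j
    using assms(3) der_eq_0[OF assms(1)] nc.subspace_0[OF J_subspace] by (cases "j \<in># d") auto
  moreover have "coef x [] = 0"
    using assms(1,2) by (force simp: H_def)
  ultimately show ?thesis
    by (subst J_iff) simp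
qed

lemma one_notin_J: "1 \<notin> J"
  by (subst J_iff) (simp add: coef_1 tone_def)

lemma J_0 [simp]: "0 \<in> J"
  by (rule nc.subspace_0[OF J_subspace])

text \<open>By the Leibniz rule the derivatives of a product are sums of products of smaller degree
  that still have a factor in \<open>J\<close>. Homogeneity turns \<open>twist\<close> into a scalar
  and provides the degree for the induction.\<close>

lemma J_mult:
  assumes "x \<in> H d" "y \<in> H e" "x \<in> J \<or> y \<in> J"
  shows "x * y \<in> J"
  using assms
proof (induction "size (d + e)" arbitrary: x y d e rule: less_induct)
  case less
  show ?case
  proof (cases "d + e = {#}")
    case True
    then have "x = coef x [] \<odot> 1" "y = coef y [] \<odot> 1"
      using H_empty less.prems by auto
    moreover have "coef x [] = 0 \<or> coef y [] = 0"
      using less.prems(3) J_iff by blast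
    ultimately have "x = 0 \<or> y = 0"
      by (metis nc.scale_zero_left)
    then show ?thesis by auto
  next
    case False
    show ?thesis
    proof (rule in_JI[OF H_mult[OF less.prems(1,2)] False])
      fix j assume j: "j \<in># d + e"
      have "x * der j y \<in> J"
      proof (cases "j \<in># e")
        case True
        then have "size (d + (e - {#j#})) < size (d + e)"
          by (metis add_strict_left_mono size_Diff1_less size_union)
        then show ?thesis
          using less.hyps less.prems der_H der_in_J by blast
      qed (simp add: der_eq_0[OF less.prems(2)])
      moreover have "der j x * y \<in> J"
      proof (cases "j \<in># d")
        case True
        then have "size (d - {#j#} + e) < size (d + e)"
          by (metis add_strict_right_mono size_Diff1_less size_union)
        then show ?thesis
          using less.hyps less.prems der_H der_in_J by blast
      qed (simp add: der_eq_0[OF less.prems(1)])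
      ultimately show "der j (x * y) \<in> J"
        unfolding der_mult_H[OF less.prems(2)]
        by (simp add: J_add J_sc)
    qed
  qed
qed

lemma skew_J: "x \<in> H d \<Longrightarrow> y \<in> H e \<Longrightarrow> x \<in> J \<or> y \<in> J \<Longrightarrow> y * x - c \<odot> (x * y) \<in> J"
  by (intro J_diff J_sc) (auto intro: J_mult)

end

lemma Nc_tbr: "Nc (tbr c x y) = Nc y * Nc x - c \<odot> (Nc x * Nc y)"
  by (rule nc_eqI) (simp add: tbr_def coef_mult)

lemma skew_comm_span:
  assumes "x \<in> nc.span A" "y \<in> nc.span B" "nc.subspace S"
    and "\<And>a b. a \<in> A \<Longrightarrow> b \<in> B \<Longrightarrow> b * a - c \<odot> (a * b) \<in> S"
  shows "y * x - c \<odot> (x * y) \<in> S"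
proof -
  have "y * a - c \<odot> (a * y) \<in> S" if "a \<in> A" for a
    using assms(2)
  proof (induction rule: nc.span_induct_alt)
    case base
    then show ?case using nc.subspace_0[OF assms(3)] by simp
  next
    case (step k b z)
    have "(k \<odot> b + z) * a - c \<odot> (a * (k \<odot> b + z)) =
        k \<odot> (b * a - c \<odot> (a * b)) + (z * a - c \<odot> (a * z))"
      by (simp add: algebra_simps)
    then show ?case
      using assms(3,4) that step by (simp add: nc.subspace_add nc.subspace_scale)
  qed
  with assms(1) show ?thesis
  proof (induction rule: nc.span_induct_alt)
    case base
    then show ?case using nc.subspace_0[OF assms(3)] by simp
  next
    case (step k a z)
    have "y * (k \<odot> a + z) - c \<odot> ((k \<odot> a + z) * y) =
        k \<odot> (y * a - c \<odot> (a * y)) + (y * z - c \<odot> (z * y))"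
      by (simp add: algebra_simps)
    then show ?case
      using assms(3) step by (simp add: nc.subspace_add nc.subspace_scale)
  qed
qed

text \<open>The r-number (m)_r: the factor produced by differentiating the m-th power of a letter,
  and of a super-letter up to lower terms.\<close>

definition qn :: "'a::field \<Rightarrow> nat \<Rightarrow> 'a"
  where "qn r m = (\<Sum>l<m. r ^ l)"

lemma qn_0 [simp]: "qn r 0 = 0"
  by (simp add: qn_def)

lemma qn_Suc: "qn r (Suc m) = 1 + r * qn r m"
  unfolding qn_def by (simp only: sum.lessThan_Suc_shift) (simp add: sum_distrib_left)

lemma qn_eq_0: "r ^ m = 1 \<Longrightarrow> r \<noteq> 1 \<Longrightarrow> qn r m = 0"
  unfolding qn_def by (simp add: sum_gp_strict)

section \<open>Support graphs and the span of brackets in connected degrees\<close>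

section \<open>Connected degrees\<close>

context braiding
begin

text \<open>Disjointness is part of the notion, so \<open>\<not> sep S T\<close> also covers sets
  that share a vertex.\<close>

definition sep :: "nat set \<Rightarrow> nat set \<Rightarrow> bool"
  where "sep A B \<longleftrightarrow> (\<forall>a\<in>A. \<forall>b\<in>B. a \<noteq> b \<and> q a b * q b a = 1)"

text \<open>Connectedness through cuts, which suits the separation arguments below;
  \<open>conn_iff_connected_in\<close> compares it with paths.\<close>

definition conn :: "nat set \<Rightarrow> bool"
  where "conn S \<longleftrightarrow> S \<noteq> {} \<and> (\<forall>A B. A \<union> B = S \<longrightarrow> A \<noteq> {} \<longrightarrow> B \<noteq> {} \<longrightarrow> \<not> sep A B)"

lemma sep_commute: "sep A B \<longleftrightarrow> sep B A"
  unfolding sep_def by (metis mult.commute)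

lemma sep_Un [simp]: "sep (A \<union> B) C \<longleftrightarrow> sep A C \<and> sep B C" "sep C (A \<union> B) \<longleftrightarrow> sep C A \<and> sep C B"
  by (auto simp: sep_def)

lemma sep_mono: "sep A B \<Longrightarrow> A' \<subseteq> A \<Longrightarrow> B' \<subseteq> B \<Longrightarrow> sep A' B'"
  by (auto simp: sep_def)

lemma conn_singleton: "conn {i}"
  unfolding conn_def sep_def by (metis insert_not_empty subset_singletonD sup_ge1 sup_ge2 singletonI)

lemma conn_cases: "conn S \<Longrightarrow> S \<subseteq> A \<union> B \<Longrightarrow> sep A B \<Longrightarrow> S \<inter> A = {} \<or> S \<inter> B = {}"
proof (rule ccontr)
  assume S: "conn S" "S \<subseteq> A \<union> B" "sep A B" "\<not> (S \<inter> A = {} \<or> S \<inter> B = {})"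
  then have "(S \<inter> A) \<union> (S \<inter> B) = S" "sep (S \<inter> A) (S \<inter> B)"
    using sep_mono[of A B] by auto
  then show False
    using S unfolding conn_def by blast
qed

lemma conn_Un:
  assumes "conn S" "conn T" "\<not> sep S T"
  shows "conn (S \<union> T)"
  unfolding conn_def
proof (intro conjI allI impI notI)
  show "S \<union> T = {} \<Longrightarrow> False" using assms(1) by (auto simp: conn_def)
  fix A B assume AB: "A \<union> B = S \<union> T" "A \<noteq> {}" "B \<noteq> {}" "sep A B"
  have disj: "A \<inter> B = {}" using AB(4) by (auto simp: sep_def)
  have "S \<inter> A = {} \<or> S \<inter> B = {}" "T \<inter> A = {} \<or> T \<inter> B = {}"
    using conn_cases AB assms by blast+
  then show False
    using AB assms sep_mono[of A B S T] sep_mono[of B A S T] sep_commute disj by blast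
qed

text \<open>If \<open>C \<union> B\<close> split, the connected set \<open>C\<close> would lie on
  one side. Adding \<open>A\<close> to that side would split \<open>C \<union> A \<union> B\<close>,
  since there is no edge between \<open>A\<close> and \<open>B\<close>.\<close>

lemma conn_remove_part:
  assumes "conn (C \<union> A \<union> B)" "conn C" "sep A B"
  shows "conn (C \<union> B)"
  unfolding conn_def
proof (intro conjI allI impI notI)
  show "C \<union> B = {} \<Longrightarrow> False" using assms(2) by (auto simp: conn_def)
  fix P Q assume PQ: "P \<union> Q = C \<union> B" "P \<noteq> {}" "Q \<noteq> {}" "sep P Q"
  have *: False if "P \<union> Q = C \<union> B" "Q \<noteq> {}" "sep P Q" "C \<inter> Q = {}" for P Q
  proof -
    have "sep (P \<union> A) Q"
      using that assms(3) sep_mono[of A B A Q] by auto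
    moreover have "(P \<union> A) \<union> Q = C \<union> A \<union> B" using that(1) by blast
    moreover have "P \<union> A \<noteq> {}"
      using that assms(2) by (auto simp: conn_def)
    ultimately show False
      using assms(1) that(2) unfolding conn_def by blast
  qed
  have "C \<inter> P = {} \<or> C \<inter> Q = {}"
    by (rule conn_cases[OF assms(2) _ PQ(4)]) (use PQ(1) in auto)
  then show False
    using *[of P Q] *[of Q P] PQ sep_commute by (metis Un_commute)
qed

lemma conn_iff_connected_in: "conn S \<longleftrightarrow> connected_in q S"
proof -
  let ?E = "{(a, b). a \<in> S \<and> b \<in> S \<and> a \<noteq> b \<and> q a b * q b a \<noteq> 1}"
  show ?thesis
  proof
    assume S: "conn S"
    have "(i, j) \<in> ?E\<^sup>*" if "i \<in> S" "j \<in> S" for i j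
    proof (rule ccontr)
      assume "(i, j) \<notin> ?E\<^sup>*"
      let ?A = "{k \<in> S. (i, k) \<in> ?E\<^sup>*}" and ?B = "{k \<in> S. (i, k) \<notin> ?E\<^sup>*}"
      have "sep ?A ?B"
        unfolding sep_def using rtrancl.rtrancl_into_rtrancl[of i _ ?E] by auto
      moreover have "?A \<union> ?B = S" "i \<in> ?A" "j \<in> ?B"
        using that \<open>(i, j) \<notin> ?E\<^sup>*\<close> by auto
      ultimately show False
        using S unfolding conn_def by blast
    qed
    then show "connected_in q S"
      using S by (auto simp: connected_in_def conn_def)
  next
    assume S: "connected_in q S"
    show "conn S"
      unfolding conn_def
    proof (intro conjI allI impI notI)
      show "S = {} \<Longrightarrow> False" using S by (auto simp: connected_in_def)
      fix A B assume AB: "A \<union> B = S" "A \<noteq> {}" "B \<noteq> {}" "sep A B"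
      then obtain i j where ij: "i \<in> A" "j \<in> B" by blast
      then have "(i, j) \<in> ?E\<^sup>*" using S AB by (auto simp: connected_in_def)
      then have "j \<in> A"
        by (induction rule: rtrancl_induct) (use ij AB in \<open>auto simp: sep_def\<close>)
      then show False using ij AB by (auto simp: sep_def)
    qed
  qed
qed

section \<open>Commutation modulo the Nichols ideal\<close>

text \<open>The derivative by \<open>j\<close> vanishes identically, the one by \<open>i\<close>
  because \<open>q i j * q j i = 1\<close>.\<close>

lemma letters_comm:
  assumes "i \<noteq> j" "q i j * q j i = 1"
  shows "X [j] * X [i] - q j i \<odot> (X [i] * X [j]) \<in> J"
proof (rule in_JI)
  show "X [j] * X [i] - q j i \<odot> (X [i] * X [j]) \<in> H {#i, j#}"
    unfolding X_mult by (intro H_diff H_sc X_in_H) auto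
  fix k
  have d: "der k (X [a] * X [b]) = (if k = b then X [a] else 0) + (if k = a then q a b \<odot> X [b] else 0)" for a b
    using der_mult_H[OF X_in_H[of "[b]" "{#b#}"], of k "X [a]"] by (simp add: der_letter)
  show "der k (X [j] * X [i] - q j i \<odot> (X [i] * X [j])) \<in> J"
    using assms by (simp add: der_diff der_sc d nc.scale_right_distrib mult.commute)
qed simp

lemma words_comm:
  assumes "sep (set u) (set v)"
  shows "br (mset u) (mset v) (X u) (X v) \<in> J"
proof -
  have 1: "br (mset u) {#b#} (X u) (X [b]) \<in> J" if "sep (set u) {b}" for b
    using that
  proof (induction u)
    case (Cons a u)
    have ab: "a \<noteq> b" "q a b * q b a = 1" and u: "sep (set u) {b}"
      using Cons.prems by (auto simp: sep_def)
    have "X [b] * (X [a] * X u) - (q b a * ch {#b#} (mset u)) \<odot> (X [a] * X u * X [b])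
       = (X [b] * X [a] - q b a \<odot> (X [a] * X [b])) * X u
         + q b a \<odot> (X [a] * br (mset u) {#b#} (X u) (X [b]))"
      by (simp add: algebra_simps)
    also have "\<dots> \<in> J"
    proof (intro J_add J_sc)
      have H: "X [b] * X [a] - q b a \<odot> (X [a] * X [b]) \<in> H {#a, b#}"
        unfolding X_mult by (intro H_diff H_sc X_in_H) auto
      show "(X [b] * X [a] - q b a \<odot> (X [a] * X [b])) * X u \<in> J"
        using J_mult[OF H X_in_H[OF refl]] letters_comm[OF ab] by blast
      have "br (mset u) {#b#} (X u) (X [b]) \<in> H (mset (b # u))"
        unfolding X_mult by (intro H_diff H_sc X_in_H) auto
      from J_mult[OF X_in_H[OF refl] this] Cons.IH[OF u]
      show "X [a] * br (mset u) {#b#} (X u) (X [b]) \<in> J"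
        by blast
    qed
    finally show ?case
      using chim_add_right[of q "{#b#}" "{#a#}" "mset u"] by (simp add: X_mult)
  qed (simp add: X_Nil)
  show ?thesis
    using assms
  proof (induction v)
    case (Cons b v)
    have b: "sep (set u) {b}" and v: "sep (set u) (set v)"
      using Cons.prems by (auto simp: sep_def)
    have "X [b] * X v * X u - (ch {#b#} (mset u) * ch (mset v) (mset u)) \<odot> (X u * (X [b] * X v))
       = X [b] * br (mset u) (mset v) (X u) (X v)
         + ch (mset v) (mset u) \<odot> (br (mset u) {#b#} (X u) (X [b]) * X v)"
      by (simp add: algebra_simps)
    also have "\<dots> \<in> J"
    proof (intro J_add J_sc)
      have "br (mset u) (mset v) (X u) (X v) \<in> H (mset (u @ v))"
        unfolding X_mult by (intro H_diff H_sc X_in_H) auto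
      from J_mult[OF X_in_H[OF refl] this] Cons.IH[OF v]
      show "X [b] * br (mset u) (mset v) (X u) (X v) \<in> J"
        by blast
      have "br (mset u) {#b#} (X u) (X [b]) \<in> H (mset (b # u))"
        unfolding X_mult by (intro H_diff H_sc X_in_H) auto
      from J_mult[OF this X_in_H[OF refl]] 1[OF b]
      show "(br (mset u) {#b#} (X u) (X [b])) * X v \<in> J"
        by blast
    qed
    finally show ?case
      using chim_add_left[of q "{#b#}" "mset v" "mset u"] by (simp add: X_mult)
  qed (simp add: X_Nil)
qed

lemma H_comm:
  assumes "x \<in> H d" "y \<in> H e" "sep (set_mset d) (set_mset e)"
  shows "br d e x y \<in> J"
  by (rule skew_comm_span[OF assms(1,2)[unfolded H_span] J_subspace])
    (use words_comm assms(3) in auto)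

lemma ch_sep: "sep (set_mset d) (set_mset e) \<Longrightarrow> ch d e * ch e d = 1"
proof (induction d)
  case (add a d)
  have 1: "ch {#a#} e * ch e {#a#} = 1" if "sep {a} (set_mset e)"
    using that
  proof (induction e)
    case (add b e)
    then have "q a b * q b a = 1" "ch {#a#} e * ch e {#a#} = 1"
      by (auto simp: sep_def)
    moreover have "ch {#a#} (add_mset b e) * ch (add_mset b e) {#a#} = (q a b * q b a) * (ch {#a#} e * ch e {#a#})"
      using chim_add_right[of q "{#a#}" "{#b#}" e] chim_add_left[of q "{#b#}" e "{#a#}"]
      by (simp add: mult_ac)
    ultimately show ?case by simp
  qed simp
  have "sep {a} (set_mset e)" "sep (set_mset d) (set_mset e)"
    using add.prems by (auto simp: sep_def)
  then have "ch {#a#} e * ch e {#a#} = 1" "ch d e * ch e d = 1"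
    using 1 add.IH by auto
  moreover have "ch (add_mset a d) e * ch e (add_mset a d) = (ch {#a#} e * ch e {#a#}) * (ch d e * ch e d)"
    using chim_add_right[of q e "{#a#}" d] chim_add_left[of q "{#a#}" d e]
    by (simp add: mult_ac)
  ultimately show ?case by simp
qed simp

lemma J_mult3:
  "x \<in> H d \<Longrightarrow> y \<in> H e \<Longrightarrow> z \<in> H f \<Longrightarrow> y \<in> J \<Longrightarrow> x * y * z \<in> J"
  using J_mult[of "x * y" "d + e" z f] J_mult[of x d y e] H_mult by blast

text \<open>Letters of \<open>B\<close> are moved to the right past letters of \<open>A\<close>.
  Each exchange costs a scalar modulo \<open>J\<close>, and the order within each class is
  kept.\<close>

lemma split_word:
  assumes "sep A B" "set w \<subseteq> A \<union> B"
  shows "\<exists>c. X w - c \<odot> (X (filter (\<lambda>a. a \<in> A) w) * X (filter (\<lambda>a. a \<in> B) w)) \<in> J"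
  using assms(2)
proof (induction w)
  case Nil
  show ?case by (rule exI[of _ 1]) (simp add: X_Nil)
next
  case (Cons a w)
  let ?u = "filter (\<lambda>a. a \<in> A) w" and ?v = "filter (\<lambda>a. a \<in> B) w"
  obtain c where c: "X w - c \<odot> (X ?u * X ?v) \<in> J"
    using Cons by auto
  have Hc: "X w - c \<odot> (X ?u * X ?v) \<in> H (mset w)"
  proof -
    have "mset ?u + mset ?v = mset w"
      using Cons.prems assms(1) by (induction w) (auto simp: sep_def)
    then show ?thesis
      unfolding X_mult by (intro H_diff H_sc X_in_H) auto
  qed
  have a: "X [a] * (X w - c \<odot> (X ?u * X ?v)) \<in> J"
    using J_mult[OF X_in_H[OF refl] Hc] c by blast
  show ?case
  proof (cases "a \<in> A")
    case True
    then have "a \<notin> B" using assms(1) by (auto simp: sep_def)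
    with True a show ?thesis
      by (intro exI[of _ c]) (simp add: X_mult right_diff_distrib flip: mult.assoc)
  next
    case False
    then have aB: "a \<in> B" using Cons.prems by auto
    then have s: "sep (set ?u) (set [a])"
      using assms(1) by (auto simp: sep_def)
    let ?k = "ch {#a#} (mset ?u)"
    have "X [a] * X ?u - ?k \<odot> (X ?u * X [a]) \<in> J"
      using words_comm[OF s] by simp
    moreover have "X [a] * X ?u - ?k \<odot> (X ?u * X [a]) \<in> H (mset (a # ?u))"
      unfolding X_mult by (intro H_diff H_sc X_in_H) auto
    ultimately have "(X [a] * X ?u - ?k \<odot> (X ?u * X [a])) * X ?v \<in> J"
      using J_mult X_in_H by blast
    then have "X [a] * (X w - c \<odot> (X ?u * X ?v)) + c \<odot> ((X [a] * X ?u - ?k \<odot> (X ?u * X [a])) * X ?v) \<in> J"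
      using a by (intro J_add J_sc)
    have e: "X (a # w) = X [a] * X w" "X (a # ?v) = X [a] * X ?v"
      by (simp_all add: X_mult)
    note \<open>X [a] * (X w - c \<odot> (X ?u * X ?v)) + c \<odot> ((X [a] * X ?u - ?k \<odot> (X ?u * X [a])) * X ?v) \<in> J\<close>
    also have "X [a] * (X w - c \<odot> (X ?u * X ?v)) + c \<odot> ((X [a] * X ?u - ?k \<odot> (X ?u * X [a])) * X ?v)
        = X (a # w) - (c * ?k) \<odot> (X ?u * X (a # ?v))"
      unfolding e by (simp add: algebra_simps)
    finally show ?thesis
      using False aB by (intro exI[of _ "c * ?k"]) simp
  qed
qed

text \<open>The gap \<open>m\<close> is shortened. If its first letter \<open>e\<close> has trivial
  double braiding with \<open>a\<close> and differs from it, \<open>a\<close> moves across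
  \<open>e\<close>; if \<open>e\<close> equals \<open>a\<close>, the second copy takes over;
  otherwise \<open>a\<close>, \<open>e\<close> is already such a pair.\<close>

lemma adjacent_pair:
  assumes "q a b * q b a \<noteq> 1" "w = u @ a # m @ b # v"
  shows "\<exists>c i k u' v'. q i k * q k i \<noteq> 1 \<and> mset (u' @ i # k # v') = mset w
     \<and> X w - c \<odot> X (u' @ i # k # v') \<in> J"
  using assms
proof (induction m arbitrary: u a w)
  case Nil
  then show ?case
    by (intro exI[of _ 1] exI[of _ a] exI[of _ b] exI[of _ u] exI[of _ v]) simp
next
  case (Cons e m)
  consider "q a e * q e a \<noteq> 1" | "a = e" | "q a e * q e a = 1" "a \<noteq> e" by blast
  then show ?case
  proof cases
    case 1
    then show ?thesis
      using Cons.prems by (intro exI[of _ 1] exI[of _ a] exI[of _ e] exI[of _ u] exI[of _ "m @ b # v"]) simp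
  next
    case 2
    then show ?thesis using Cons.IH[of e w "u @ [a]"] Cons.prems by auto
  next
    case 3
    define w' where "w' = (u @ [e]) @ a # m @ b # v"
    obtain c i k u' v' where *: "q i k * q k i \<noteq> 1" "mset (u' @ i # k # v') = mset w'"
      "X w' - c \<odot> X (u' @ i # k # v') \<in> J"
      using Cons.IH[OF Cons.prems(1) w'_def] by blast
    have "X [a] * X [e] - q a e \<odot> (X [e] * X [a]) \<in> J"
      using letters_comm[of e a] 3 by (simp add: mult.commute)
    moreover have "X [a] * X [e] - q a e \<odot> (X [e] * X [a]) \<in> H {#a, e#}"
      unfolding X_mult by (intro H_diff H_sc X_in_H) auto
    ultimately have "X u * (X [a] * X [e] - q a e \<odot> (X [e] * X [a])) * X (m @ b # v) \<in> J"
      using J_mult3 X_in_H by blast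
    also have "X u * (X [a] * X [e] - q a e \<odot> (X [e] * X [a])) * X (m @ b # v) = X w - q a e \<odot> X w'"
      by (simp add: Cons.prems w'_def algebra_simps X_mult)
    finally have "X w - q a e \<odot> X w' + q a e \<odot> (X w' - c \<odot> X (u' @ i # k # v')) \<in> J"
      using * by (intro J_add J_sc)
    then have "X w - (q a e * c) \<odot> X (u' @ i # k # v') \<in> J"
      by (simp add: algebra_simps)
    moreover have "mset w' = mset w" by (simp add: w'_def Cons.prems)
    ultimately show ?thesis using * by metis
  qed
qed

lemma der_power: "der i (X (replicate m i)) = qn (q i i) m \<odot> X (replicate (m - 1) i)"
proof (induction m)
  case (Suc m)
  have "der i (X (replicate m i) * X [i]) = X (replicate m i) + q i i \<odot> (der i (X (replicate m i)) * X [i])"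
    using der_mult_H[OF X_in_H[of "[i]" "{#i#}"]] by (simp add: der_letter)
  also have "\<dots> = qn (q i i) (Suc m) \<odot> X (replicate m i)"
    unfolding Suc.IH qn_Suc
    by (cases m) (simp_all add: X_mult nc.scale_left_distrib flip: replicate_append_same)
  finally show ?case
    by (simp add: X_mult flip: replicate_append_same)
qed (simp add: X_Nil)

lemma power_in_J:
  assumes "qn (q i i) l = 0" "0 < l" "l \<le> m"
  shows "X (replicate m i) \<in> J"
proof -
  have "X (replicate l i) \<in> J"
  proof (rule in_JI[OF X_in_H[OF refl]])
    fix j assume "j \<in># mset (replicate l i)"
    then have "j = i" by (auto split: if_splits)
    then show "der j (X (replicate l i)) \<in> J"
      using assms(1) by (simp add: der_power)
  qed (use assms in auto)
  then have "X (replicate l i) * X (replicate (m - l) i) \<in> J"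
    using J_mult X_in_H by blast
  then show ?thesis
    using assms by (simp add: X_mult flip: replicate_add)
qed

end

section \<open>Brackets\<close>

locale nichols = braiding q for q :: "nat \<Rightarrow> nat \<Rightarrow> 'a::field" +
  fixes n :: nat
  assumes diag: "i < n \<Longrightarrow> q i i \<noteq> 1"
begin

definition Bs :: "nat multiset \<Rightarrow> 'a nc set"
  where "Bs d = {Nc x | x a. (x, a) \<in> brackets q n \<and> mset a = d}"

definition Ls :: "nat multiset \<Rightarrow> 'a nc set"
  where "Ls d = nc.span (Bs d \<union> (J \<inter> H d))"

lemma Ls_subspace: "nc.subspace (Ls d)"
  by (simp add: Ls_def)

lemmas Ls_0 = nc.subspace_0[OF Ls_subspace]
  and Ls_add = nc.subspace_add[OF Ls_subspace]
  and Ls_sc = nc.subspace_scale[OF Ls_subspace]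

lemma Nc_tletter: "Nc (tletter i) = X [i]"
  by (simp add: X_def tletter_def)

lemma brackets_H: "(x, a) \<in> brackets q n \<Longrightarrow> Nc x \<in> H (mset a) \<and> set a \<subseteq> {..<n}"
proof (induction x a rule: brackets.induct)
  case (gen i)
  then show ?case by (simp add: Nc_tletter X_in_H)
next
  case (br x a y b)
  then show ?case
    unfolding Nc_tbr
    using H_mult[of "Nc x" "mset a" "Nc y" "mset b"] H_mult[of "Nc y" "mset b" "Nc x" "mset a"]
    by (auto simp: add.commute intro!: H_diff H_sc)
qed

lemma Bs_H: "x \<in> Bs d \<Longrightarrow> x \<in> H d"
  using brackets_H by (auto simp: Bs_def)

lemma Ls_H: "x \<in> Ls d \<Longrightarrow> x \<in> H d"
  unfolding Ls_def by (erule nc.span_induct) (auto simp: H_subspace Bs_H)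

lemma J_Ls: "x \<in> J \<Longrightarrow> x \<in> H d \<Longrightarrow> x \<in> Ls d"
  unfolding Ls_def by (rule nc.span_base) simp

lemma Bs_Ls: "x \<in> Bs d \<Longrightarrow> x \<in> Ls d"
  unfolding Ls_def by (rule nc.span_base) simp

lemma Bs_br: "x \<in> Bs d \<Longrightarrow> y \<in> Bs e \<Longrightarrow> y * x - ch e d \<odot> (x * y) \<in> Bs (d + e)"
  unfolding Bs_def using brackets.br by (fastforce simp: chi_chim simp flip: Nc_tbr)

lemma Ls_br:
  assumes "x \<in> Ls d" "y \<in> Ls e"
  shows "br d e x y \<in> Ls (d + e)"
proof (rule skew_comm_span[OF assms[unfolded Ls_def] Ls_subspace])
  fix a b assume ab: "a \<in> Bs d \<union> J \<inter> H d" "b \<in> Bs e \<union> J \<inter> H e"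
  show "br d e a b \<in> Ls (d + e)"
  proof (cases "a \<in> J \<or> b \<in> J")
    case True
    have "a \<in> H d" "b \<in> H e" using ab Bs_H by auto
    then show ?thesis
      using True by (intro J_Ls skew_J skew_H)
  next
    case False
    then show ?thesis using ab Bs_br Bs_Ls by blast
  qed
qed

text \<open>The products in both orders are recovered from the brackets in both orders: the linear
  system has, up to sign, the determinant \<open>1 - ch d e * ch e d\<close>.\<close>

lemma Ls_mult:
  assumes "x \<in> Ls d" "y \<in> Ls e" "ch d e * ch e d \<noteq> 1"
  shows "x * y \<in> Ls (d + e)"
proof -
  have "(br e d y x) + ch d e \<odot> br d e x y \<in> Ls (d + e)"
    using Ls_br[OF assms(1,2)] Ls_br[OF assms(2,1)]
    by (auto simp: add.commute intro!: Ls_add Ls_sc)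
  also have "(br e d y x) + ch d e \<odot> br d e x y = (1 - ch d e * ch e d) \<odot> (x * y)"
    by (simp add: algebra_simps)
  finally have "inverse (1 - ch d e * ch e d) \<odot> (1 - ch d e * ch e d) \<odot> (x * y) \<in> Ls (d + e)"
    by (rule Ls_sc)
  then show ?thesis using assms(3) by simp
qed

text \<open>A bracket of disconnected degree either has a factor in \<open>J\<close>, or its factors
  have connected, mutually separated supports and therefore commute up to the scalar in the
  bracket.\<close>

lemma Bs_conn: "x \<in> Bs d \<Longrightarrow> conn (set_mset d) \<or> x \<in> J"
proof -
  have "(x, a) \<in> brackets q n \<Longrightarrow> conn (set a) \<or> Nc x \<in> J" for x a
  proof (induction x a rule: brackets.induct)
    case (gen i)
    then show ?case by (simp add: conn_singleton)
  next
    case (br x a y b)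
    have H: "Nc x \<in> H (mset a)" "Nc y \<in> H (mset b)"
      using br brackets_H by auto
    show ?case
    proof (cases "conn (set a) \<and> conn (set b)")
      case True
      show ?thesis
      proof (cases "sep (set a) (set b)")
        case True
        then show ?thesis
          using H_comm[OF H] by (simp add: Nc_tbr chi_chim)
      qed (use True conn_Un in auto)
    next
      case False
      then have "Nc x \<in> J \<or> Nc y \<in> J" using br.IH by blast
      then show ?thesis
        unfolding Nc_tbr using skew_J[OF H] by blast
    qed
  qed
  then show "x \<in> Bs d \<Longrightarrow> conn (set_mset d) \<or> x \<in> J"
    unfolding Bs_def by fastforce
qed

lemma Bs_cases:
  assumes "x \<in> Bs d" "size d \<noteq> 1"
  obtains e f y z where "d = e + f" "y \<in> Bs e" "z \<in> Bs f" "x = z * y - ch f e \<odot> (y * z)"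
proof -
  obtain x' a where x: "x = Nc x'" "(x', a) \<in> brackets q n" "mset a = d"
    using assms(1) by (auto simp: Bs_def)
  from x(2) show ?thesis
  proof cases
    case (gen i)
    then show ?thesis using assms(2) x by auto
  next
    case (br y b z c)
    then show ?thesis
      using that[of "mset b" "mset c" "Nc y" "Nc z"] x
      by (auto simp: Bs_def Nc_tbr chi_chim)
  qed
qed

abbreviation full :: "nat multiset \<Rightarrow> bool"
  where "full d \<equiv> H d \<subseteq> Ls d"

lemma full_letter: "i < n \<Longrightarrow> full {#i#}"
proof -
  assume "i < n"
  then have "X [i] \<in> Bs {#i#}"
    unfolding Bs_def using brackets.gen[of i n q] by (force simp: Nc_tletter[symmetric])
  moreover have "w = [i]" if "mset w = {#i#}" for w
    using that by simp
  ultimately show ?thesis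
    unfolding H_subset_iff[OF Ls_subspace] using Bs_Ls by blast
qed

text \<open>The bracket of the m-th power of x_i with x_i is \<open>1 - q i i ^ m\<close> times the
  next power. If this factor vanishes, then (m)_r = 0 for r = \<open>q i i\<close>, because
  \<open>q i i \<noteq> 1\<close>, and already the m-th power lies in \<open>J\<close>.\<close>

lemma full_power:
  assumes "i < n" "0 < m"
  shows "full (replicate_mset m i)"
  using assms(2)
proof (induction m)
  case (Suc m)
  show ?case
  proof (cases "m = 0")
    case True
    then show ?thesis using full_letter[OF assms(1)] by simp
  next
    case m: False
    have "X (replicate (Suc m) i) \<in> Ls (replicate_mset (Suc m) i)"
    proof (cases "q i i ^ m = 1")
      case True
      then have "qn (q i i) m = 0"
        using diag[OF assms(1)] by (rule qn_eq_0)
      then have "X (replicate (Suc m) i) \<in> J"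
        using power_in_J m by (metis le_SucI neq0_conv order_refl)
      then show ?thesis
        by (intro J_Ls X_in_H) auto
    next
      case False
      have x: "X (replicate m i) \<in> Ls (replicate_mset m i)" "X [i] \<in> Ls {#i#}"
        using Suc.IH m full_letter[OF assms(1)] X_in_H[of "replicate m i"] X_in_H[of "[i]"] by auto
      have c: "ch {#i#} (replicate_mset m i) = q i i ^ m"
        by (simp add: chim_def)
      have "X [i] * X (replicate m i) - q i i ^ m \<odot> (X (replicate m i) * X [i]) \<in> Ls (replicate_mset m i + {#i#})"
        using Ls_br[OF x] c by simp
      also have "X [i] * X (replicate m i) - q i i ^ m \<odot> (X (replicate m i) * X [i])
          = (1 - q i i ^ m) \<odot> X (replicate (Suc m) i)"
        by (simp add: X_mult algebra_simps flip: replicate_append_same)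
      finally have "inverse (1 - q i i ^ m) \<odot> (1 - q i i ^ m) \<odot> X (replicate (Suc m) i) \<in> Ls (replicate_mset (Suc m) i)"
        by (intro nc.subspace_scale[OF Ls_subspace, of _ _ "inverse _"]) simp
      then show ?thesis using False by simp
    qed
    moreover have "w = replicate (Suc m) i" if "mset w = replicate_mset (Suc m) i" for w
    proof -
      have "length w = Suc m" "set w \<subseteq> {i}"
        using that by (metis size_mset size_replicate_mset, metis set_mset_mset set_mset_replicate_mset_subset order_refl empty_subsetI)
      then show ?thesis by (metis replicate_eqI singletonD subset_iff)
    qed
    ultimately show ?thesis
      unfolding H_subset_iff[OF Ls_subspace] by blast
  qed
qed simp

section \<open>Every component of connected degree is spanned by brackets\<close>

text \<open>Up to a scalar modulo \<open>J\<close>, a word of degree \<open>d\<close> is a product p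
  g s, where p and s have letters in \<open>B\<close> and g has degree
  \<open>add_mset i \<beta>\<close> with letters in \<open>insert i A\<close>. The degree of g is
  smaller, so g is a combination of brackets, and the outer factors are pulled into each
  bracket.\<close>

lemma full_cut:
  assumes IH: "\<And>e. size e < size d \<Longrightarrow> set_mset e \<subseteq> {..<n} \<Longrightarrow> conn (set_mset e) \<Longrightarrow> full e"
    and d: "set_mset d \<subseteq> {..<n}" "conn (set_mset d)" "count d i = 1"
    and AB: "set_mset d - {i} = A \<union> B" "A \<noteq> {}" "B \<noteq> {}" "sep A B"
  shows "full d"
proof -
  have iAB: "i \<notin> A" "i \<notin> B" and id: "i \<in># d" and disj: "A \<inter> B = {}"
    using AB d(3) count_greater_zero_iff[of d i] by (auto simp: sep_def)
  define \<beta> where "\<beta> = filter_mset (\<lambda>a. a \<in> A) d"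
  define \<gamma> where "\<gamma> = filter_mset (\<lambda>a. a \<in> B) d"
  have sets: "set_mset \<beta> = A" "set_mset \<gamma> = B"
    using AB by (auto simp: \<beta>_def \<gamma>_def)
  have dd: "d = add_mset i \<beta> + \<gamma>"
  proof (rule multiset_eqI)
    fix a
    have "a \<notin># d" if "a \<notin> A" "a \<notin> B" "a \<noteq> i" using that AB(1) by blast
    then show "count d a = count (add_mset i \<beta> + \<gamma>) a"
      using iAB d(3) disj by (cases "a \<in> A"; cases "a \<in> B"; cases "a = i") (auto simp: \<beta>_def \<gamma>_def not_in_iff)
  qed
  have sz: "size (add_mset i \<beta>) < size d"
    using AB(3) sets by (auto simp: dd nonempty_has_size[symmetric])
  have cA: "conn (insert i A)" and cB: "conn (insert i B)"
    using conn_remove_part[of "{i}" B A] conn_remove_part[of "{i}" A B] d(2) AB conn_singleton id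
      sep_commute sets dd by (auto simp: Un_commute insert_commute)
  have inner: "p * g * s \<in> Ls d"
    if g: "g \<in> H (add_mset i \<beta>)" and p: "p \<in> H \<gamma>1" and s: "s \<in> H \<gamma>2" and \<gamma>: "\<gamma>1 + \<gamma>2 = \<gamma>" for p g s \<gamma>1 \<gamma>2
  proof -
    have pgs_H: "p * y * s \<in> H (e + \<gamma>)" if "y \<in> H e" for y e
      using H_mult[OF H_mult[OF p that] s] by (simp add: \<gamma>[symmetric] add_ac)
    have commA: "br \<gamma>2 \<alpha> s h \<in> J" "br \<gamma>1 \<alpha> p h \<in> J"
      "br \<alpha> \<gamma>1 h p \<in> J" "ch \<alpha> \<gamma>1 * ch \<gamma>1 \<alpha> = 1" "ch \<alpha> \<gamma>2 * ch \<gamma>2 \<alpha> = 1"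
      if h: "h \<in> H \<alpha>" and \<alpha>: "set_mset \<alpha> \<subseteq> A" for h \<alpha>
    proof -
      have s1: "sep (set_mset \<gamma>1) (set_mset \<alpha>)" and s2: "sep (set_mset \<gamma>2) (set_mset \<alpha>)"
        using sep_mono[of B A "set_mset \<gamma>1" "set_mset \<alpha>"] sep_mono[of B A "set_mset \<gamma>2" "set_mset \<alpha>"]
          AB(4) sep_commute[of A B] \<alpha> arg_cong[OF \<gamma>, of set_mset] sets by auto
      then show "br \<gamma>2 \<alpha> s h \<in> J" "br \<gamma>1 \<alpha> p h \<in> J"
        "br \<alpha> \<gamma>1 h p \<in> J" "ch \<alpha> \<gamma>1 * ch \<gamma>1 \<alpha> = 1" "ch \<alpha> \<gamma>2 * ch \<gamma>2 \<alpha> = 1"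
        using H_comm h p s sep_commute ch_sep by (blast, blast, blast, metis+)
    qed
    have "p * b * s \<in> Ls d" if bB: "b \<in> Bs (add_mset i \<beta>)" for b
    proof -
      have sz1: "size (add_mset i \<beta>) \<noteq> 1" using AB(2) sets by auto
      obtain e f y z where ef: "add_mset i \<beta> = e + f" "y \<in> Bs e" "z \<in> Bs f"
        and b: "b = z * y - ch f e \<odot> (y * z)"
        by (rule Bs_cases[OF bB sz1])
      have H: "y \<in> H e" "z \<in> H f" using ef Bs_H by auto
      have dB: "b \<in> H (add_mset i \<beta>)" using bB by (rule Bs_H)
      show ?thesis
      proof (cases "y \<in> J \<or> z \<in> J")
        case True
        then have "b \<in> J"
          unfolding b using J_mult H J_diff J_sc by blast
        then have "p * b * s \<in> J" using J_mult3 dB p s by blast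
        then show ?thesis using J_Ls pgs_H[OF dB] dd by simp
      next
        case False
        then have ce: "conn (set_mset e)" "conn (set_mset f)"
          using Bs_conn ef by auto
        have one: "count e i + count f i = 1"
        proof -
          have "count \<beta> i = 0" using iAB(1) unfolding sets(1)[symmetric] by (simp add: not_in_iff)
          then show ?thesis using arg_cong[OF ef(1), of "\<lambda>m. count m i"] by simp
        qed
        \<comment> \<open>The factor of the bracket without \<open>i\<close> commutes with \<open>p\<close> and \<open>s\<close>, which makes
            \<open>p b s\<close> a bracket of that factor with the remaining product.\<close>
        have de: "e + (f + \<gamma>) = d" and de': "(e + \<gamma>) + f = d"
          unfolding dd ef(1) by (simp_all add: add_ac)
        have sub: "set_mset e \<subseteq> insert i A" "set_mset f \<subseteq> insert i A"
          using arg_cong[OF ef(1), of set_mset] sets by auto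
        \<comment> \<open>The part with \<open>i\<close> stays connected after adding
          \<open>\<gamma>\<close> because it meets the connected set \<open>insert i B\<close> in
          \<open>i\<close>. The size drops since the other part is nonempty.\<close>
        have big: "full (a + \<gamma>)" if a: "i \<in># a" "conn (set_mset a)" "a + a' = add_mset i \<beta>" "a' \<noteq> {#}" for a a'
        proof (rule IH)
          show "size (a + \<gamma>) < size d"
            using arg_cong[OF a(3), of size] a(4) by (simp add: dd nonempty_has_size)
          show "set_mset (a + \<gamma>) \<subseteq> {..<n}"
            using arg_cong[OF a(3), of set_mset] d(1) dd by auto
          have "conn (set_mset a \<union> insert i B)"
            using conn_Un[OF a(2) cB] a(1) by (auto simp: sep_def)
          then show "conn (set_mset (a + \<gamma>))"
            using a(1) sets by (simp add: insert_absorb)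
        qed
        show ?thesis
        proof (cases "i \<in># f")
          case True
          then have "count f i > 0" by simp
          then have "count e i = 0" using one by linarith
          then have "i \<notin># e" by (simp only: not_in_iff)
          then have eA: "set_mset e \<subseteq> A" using sub by auto
          note c = commA[OF H(1) eA]
          have "p * z * s \<in> Ls (f + \<gamma>)"
            using big[OF True ce(2), of e] ef(1) ce(1) pgs_H[OF H(2)] by (auto simp: add.commute conn_def)
          then have br: "br e (f + \<gamma>) y (p * z * s) \<in> Ls d"
            using Ls_br[OF Bs_Ls[OF ef(2)]] de by metis
          \<comment> \<open>In one term \<open>y\<close> is moved to the right of \<open>s\<close>,
            in the other to the left of \<open>p\<close>. Both corrections lie in \<open>J\<close>,
            and \<open>ch e \<gamma>2 * ch \<gamma>2 e = 1\<close> makes the scalars those of a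
            bracket.\<close>
          have *: "p * b * s = ch e \<gamma>2 \<odot> br e (f + \<gamma>) y (p * z * s)
              + (p * z) * br \<gamma>2 e s y
              - ch f e \<odot> (br e \<gamma>1 y p * (z * s))"
          proof -
            have "ch e \<gamma>2 * ch (f + \<gamma>) e = ch f e * ch \<gamma>1 e * (ch e \<gamma>2 * ch \<gamma>2 e)"
              by (simp add: chim_add_left \<gamma>[symmetric] mult_ac)
            then have k: "ch e \<gamma>2 * ch (f + \<gamma>) e = ch f e * ch \<gamma>1 e"
              using c(5) by simp
            show ?thesis
              using k by (simp add: b algebra_simps)
          qed
          have "(p * z) * br \<gamma>2 e s y \<in> J"
               "(br e \<gamma>1 y p) * (z * s) \<in> J"
          proof -
            have "br \<gamma>2 e s y \<in> H (e + \<gamma>2)"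
              using skew_H[OF s H(1)] by (simp add: add.commute)
            then show "(p * z) * br \<gamma>2 e s y \<in> J"
              using c(1) J_mult H_mult[OF p H(2)] by blast
            have "br e \<gamma>1 y p \<in> H (e + \<gamma>1)"
              by (rule skew_H[OF H(1) p])
            then show "(br e \<gamma>1 y p) * (z * s) \<in> J"
              using c(3) J_mult H_mult[OF H(2) s] by blast
          qed
          then have "(p * z) * br \<gamma>2 e s y - ch f e \<odot> (br e \<gamma>1 y p * (z * s)) \<in> J"
            by (intro nc.subspace_diff nc.subspace_scale J_subspace)
          moreover have "p * b * s \<in> H d" using pgs_H[OF dB] dd by simp
          moreover have "ch e \<gamma>2 \<odot> br e (f + \<gamma>) y (p * z * s) \<in> Ls d"
            using br by (rule Ls_sc)
          ultimately show ?thesis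
            using J_Ls Ls_H * Ls_add H_diff
            by (smt (verit) add_diff_cancel_left' add_diff_eq)
        next
          case False
          then have fA: "set_mset f \<subseteq> A" and ie: "i \<in># e"
          proof -
            have "count f i = 0" using False by (simp only: not_in_iff)
            then have "count e i > 0" using one by linarith
            then show "set_mset f \<subseteq> A" "i \<in># e" using False sub by auto
          qed
          note c = commA[OF H(2) fA]
          have "p * y * s \<in> Ls (e + \<gamma>)"
            using big[OF ie ce(1), of f] ef(1) ce(2) pgs_H[OF H(1)] by (auto simp: conn_def)
          then have br: "br (e + \<gamma>) f (p * y * s) z \<in> Ls d"
            using Ls_br[OF _ Bs_Ls[OF ef(3)]] de' by metis
          have *: "p * b * s = ch \<gamma>1 f \<odot> br (e + \<gamma>) f (p * y * s) z
              + br f \<gamma>1 z p * (y * s)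
              - ch f e \<odot> ((p * y) * br \<gamma>2 f s z)"
          proof -
            have "ch \<gamma>1 f * ch f (e + \<gamma>) = ch f e * ch f \<gamma>2 * (ch f \<gamma>1 * ch \<gamma>1 f)"
              by (simp add: chim_add_right \<gamma>[symmetric] mult_ac)
            then have k: "ch \<gamma>1 f * ch f (e + \<gamma>) = ch f e * ch f \<gamma>2"
              using c(4) by simp
            show ?thesis
              using k by (simp add: b algebra_simps)
          qed
          have "(br f \<gamma>1 z p) * (y * s) \<in> J"
               "(p * y) * br \<gamma>2 f s z \<in> J"
          proof -
            have "br \<gamma>2 f s z \<in> H (f + \<gamma>2)"
              using skew_H[OF s H(2)] by (simp add: add.commute)
            then show "(p * y) * br \<gamma>2 f s z \<in> J"
              using c(1) J_mult H_mult[OF p H(1)] by blast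
            have "br f \<gamma>1 z p \<in> H (f + \<gamma>1)"
              by (rule skew_H[OF H(2) p])
            then show "(br f \<gamma>1 z p) * (y * s) \<in> J"
              using c(3) J_mult H_mult[OF H(1) s] by blast
          qed
          then have "(br f \<gamma>1 z p) * (y * s) - ch f e \<odot> ((p * y) * br \<gamma>2 f s z) \<in> J"
            by (intro nc.subspace_diff nc.subspace_scale J_subspace)
          moreover have "p * b * s \<in> H d" using pgs_H[OF dB] dd by simp
          moreover have "ch \<gamma>1 f \<odot> br (e + \<gamma>) f (p * y * s) z \<in> Ls d"
            using br by (rule Ls_sc)
          ultimately show ?thesis
            using J_Ls Ls_H * Ls_add H_diff
            by (smt (verit) add_diff_cancel_left' add_diff_eq)
        qed
      qed
    qed
    moreover have "p * b * s \<in> Ls d" if "b \<in> J \<inter> H (add_mset i \<beta>)" for b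
      using J_Ls[OF J_mult3[OF p _ s]] pgs_H[of b "add_mset i \<beta>"] that unfolding dd by blast
    ultimately have b: "p * b * s \<in> Ls d" if "b \<in> Bs (add_mset i \<beta>) \<union> J \<inter> H (add_mset i \<beta>)" for b
      using that by blast
    have "g \<in> Ls (add_mset i \<beta>)"
      using IH[OF sz] d(1) cA g sets dd by auto
    then show ?thesis
      unfolding Ls_def[of "add_mset i \<beta>"]
    proof (induction rule: nc.span_induct_alt)
      case base
      then show ?case using Ls_0 by simp
    next
      case (step c x y)
      then show ?case
        using b by (simp add: distrib_left distrib_right Ls_add Ls_sc)
    qed
  qed
  have "X w \<in> Ls d" if w: "mset w = d" for w
  proof -
    have "i \<in> set w" using id w by (metis set_mset_mset)
    then obtain u v where uv: "w = u @ i # v" by (meson split_list)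
    have "i \<notin># mset u \<and> i \<notin># mset v"
      unfolding not_in_iff using d(3) unfolding w[symmetric] uv by simp
    then have "i \<notin> set u" "i \<notin> set v" by auto
    then have "set u \<subseteq> A \<union> B" "set v \<subseteq> A \<union> B"
      using AB(1) unfolding w[symmetric] uv by auto
    then obtain c c' where
      c: "X u - c \<odot> (X (filter (\<lambda>a. a \<in> B) u) * X (filter (\<lambda>a. a \<in> A) u)) \<in> J"
      and c': "X v - c' \<odot> (X (filter (\<lambda>a. a \<in> A) v) * X (filter (\<lambda>a. a \<in> B) v)) \<in> J"
      using split_word[of B A u] split_word[of A B v] AB(4) sep_commute by (metis Un_commute)
    define u1 u2 v1 v2 where defs: "u1 = filter (\<lambda>a. a \<in> B) u" "u2 = filter (\<lambda>a. a \<in> A) u"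
      "v1 = filter (\<lambda>a. a \<in> A) v" "v2 = filter (\<lambda>a. a \<in> B) v"
    have \<gamma>: "mset u1 + mset v2 = \<gamma>" and \<beta>: "mset u2 + mset v1 = \<beta>"
      using w[symmetric] iAB by (simp_all add: defs \<beta>_def \<gamma>_def uv)
    have mu: "mset u = mset u1 + mset u2" and mv: "mset v = mset v1 + mset v2"
    proof -
      have *: "mset t = filter_mset (\<lambda>a. a \<in> A) (mset t) + filter_mset (\<lambda>a. a \<in> B) (mset t)" if "set t \<subseteq> A \<union> B" for t
        using that disj by (induction t) auto
      show "mset u = mset u1 + mset u2" "mset v = mset v1 + mset v2"
        using *[OF \<open>set u \<subseteq> A \<union> B\<close>] *[OF \<open>set v \<subseteq> A \<union> B\<close>] by (simp_all add: defs add.commute)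
    qed
    have "X u1 * X (u2 @ [i] @ v1) * X v2 \<in> Ls d"
      by (rule inner[OF X_in_H X_in_H[OF refl] X_in_H[OF refl]]) (use \<beta> \<gamma> in \<open>auto simp: add_ac\<close>)
    then have main: "X (u1 @ u2) * X [i] * X (v1 @ v2) \<in> Ls d"
      by (simp add: X_mult)
    have Hu: "X u - c \<odot> X (u1 @ u2) \<in> H (mset u)" and Hv: "X v - c' \<odot> X (v1 @ v2) \<in> H (mset v)"
      by (intro H_diff H_sc X_in_H; simp add: mu mv)+
    have "(X u - c \<odot> X (u1 @ u2)) * (X [i] * X v) \<in> J"
      using c J_mult[OF Hu X_in_H[OF refl, of "i # v"]] by (simp add: defs X_mult)
    moreover have "X (u1 @ u2) * X [i] * (X v - c' \<odot> X (v1 @ v2)) \<in> J"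
      using c' J_mult[OF X_in_H[OF refl, of "(u1 @ u2) @ [i]"] Hv] by (simp add: defs X_mult)
    ultimately have "(X u - c \<odot> X (u1 @ u2)) * (X [i] * X v) + c \<odot> (X (u1 @ u2) * X [i] * (X v - c' \<odot> X (v1 @ v2))) \<in> J"
      by (intro nc.subspace_add nc.subspace_scale J_subspace)
    also have "(X u - c \<odot> X (u1 @ u2)) * (X [i] * X v) + c \<odot> (X (u1 @ u2) * X [i] * (X v - c' \<odot> X (v1 @ v2)))
       = X w - (c * c') \<odot> (X (u1 @ u2) * X [i] * X (v1 @ v2))" (is "_ = _ - ?m")
      by (simp add: algebra_simps uv X_mult)
    finally have "X w - ?m \<in> J" .
    moreover have m: "?m \<in> Ls d" using main by (rule Ls_sc)
    ultimately have "(X w - ?m) + ?m \<in> Ls d"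
      using J_Ls[of "X w - ?m" d] Ls_H X_in_H[OF w] H_diff Ls_add
      by blast
    then show ?thesis by simp
  qed
  then show ?thesis
    using H_subset_iff[OF Ls_subspace] by blast
qed

text \<open>Every letter can be removed, so brackets with a single letter rotate words. If some
  letter has nontrivial double braiding with the rest, \<open>Ls_mult\<close> applies to a suitable
  rotation. Otherwise the braiding factors are invertible, and two ways of rotating an adjacent pair
  can be compared.\<close>

lemma full_noncut:
  assumes IH: "\<And>e. size e < size d \<Longrightarrow> set_mset e \<subseteq> {..<n} \<Longrightarrow> conn (set_mset e) \<Longrightarrow> full e"
    and d: "set_mset d \<subseteq> {..<n}" "conn (set_mset d)"
    and nocut: "\<And>i. i \<in># d \<Longrightarrow> conn (set_mset (d - {#i#}))"
    and two: "\<not> (\<exists>i. set_mset d = {i})"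
  shows "full d"
proof -
  have letter: "X [i] \<in> Ls {#i#}" if "i \<in># d" for i
    using full_letter[of i] that d(1) X_in_H[of "[i]"] by auto
  have rest: "full (d - {#i#})" if "i \<in># d" for i
    using that d(1) in_diffD[of _ d "{#i#}"] by (intro IH nocut) (auto simp: size_Diff1_less)
  have rot: "br {#i#} (d - {#i#}) (X [i]) (X v) \<in> Ls d"
    "br (d - {#i#}) {#i#} (X v) (X [i]) \<in> Ls d"
    if "mset v = d - {#i#}" "i \<in># d" for v i
    using Ls_br[of "X [i]" "{#i#}" "X v" "d - {#i#}"] Ls_br[of "X v" "d - {#i#}" "X [i]" "{#i#}"]
      letter rest that X_in_H[OF that(1)] by auto
  have step: "X (a # v) \<in> Ls d" if "X (v @ [a]) \<in> Ls d" "mset (a # v) = d" for a v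
  proof -
    have "br (d - {#a#}) {#a#} (X v) (X [a]) \<in> Ls d"
      using that by (intro rot) auto
    then have "(br (d - {#a#}) {#a#} (X v) (X [a])) + ch {#a#} (d - {#a#}) \<odot> X (v @ [a]) \<in> Ls d"
      using that by (intro nc.subspace_add nc.subspace_scale Ls_subspace)
    then show ?thesis by (simp add: X_mult)
  qed
  have rotate: "X (v @ u) \<in> Ls d" if "X (u @ v) \<in> Ls d" "mset (u @ v) = d" for u v
    using that
  proof (induction v arbitrary: u rule: rev_induct)
    case (snoc a v)
    then show ?case using step[of "u @ v" a] snoc.IH[of "a # u"] by simp
  qed simp
  have all: "X w \<in> Ls d" if w: "mset w = d" for w
  proof (cases "\<exists>i\<in>#d. ch {#i#} (d - {#i#}) * ch (d - {#i#}) {#i#} \<noteq> 1")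
    case True
    then obtain i where i: "i \<in># d" "ch {#i#} (d - {#i#}) * ch (d - {#i#}) {#i#} \<noteq> 1" by blast
    then obtain u v where uv: "w = u @ i # v"
      using w by (metis set_mset_mset split_list)
    have m: "mset (v @ u) = d - {#i#}" using w uv by auto
    then have "X [i] * X (v @ u) \<in> Ls d"
      using Ls_mult[of "X [i]" "{#i#}" "X (v @ u)" "d - {#i#}"] letter[OF i(1)] rest[OF i(1)] i X_in_H[OF m] by auto
    then show ?thesis
      using rotate[of "i # v" u] w by (simp add: X_mult uv union_commute)
  next
    case False
    then have one: "ch {#i#} (d - {#i#}) * ch (d - {#i#}) {#i#} = 1" if "i \<in># d" for i
      using that by blast
    \<comment> \<open>The rest \<open>\<delta>\<close> next to a connected block
      \<open>\<kappa>\<close> may be disconnected. It is then cut into separated parts that are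
      moved one after the other; \<open>\<delta>'\<close> collects the part at rest, so that
      \<open>\<kappa> + \<delta>'\<close> is connected whenever a connected part is moved.\<close>
    have comp: "br (\<kappa> + \<delta>') \<delta> g v \<in> Ls d"
      if "d = \<kappa> + \<delta> + \<delta>'" "conn (set_mset \<kappa>)" "sep (set_mset \<delta>) (set_mset \<delta>')" "v \<in> H \<delta>" "g \<in> H (\<kappa> + \<delta>')"
      for \<kappa> \<delta> \<delta>' v g
      using that
    proof (induction "size \<delta>" arbitrary: \<delta> \<delta>' v g rule: less_induct)
      case less
      consider "\<delta> = {#}" | "\<delta> \<noteq> {#}" "conn (set_mset \<delta>)" | "\<delta> \<noteq> {#}" "\<not> conn (set_mset \<delta>)" by blast
      then show ?case
      proof cases
        case 1
        then have "v = coef v [] \<odot> 1" using H_empty less.prems by blast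
        then have "br (\<kappa> + \<delta>') \<delta> g v = 0"
          using 1 by (metis chim_empty(1) diff_self mult.left_neutral mult.right_neutral nc.scale_one sc_mult_left sc_mult_right)
        then show ?thesis using Ls_0 by simp
      next
        case 2
        have c: "conn (set_mset \<kappa> \<union> set_mset \<delta>')"
          using conn_remove_part[of "set_mset \<kappa>" "set_mset \<delta>" "set_mset \<delta>'"] d(2) less.prems by simp
        have sz: "0 < size \<delta>" "0 < size \<kappa>"
          using 2 less.prems(2) unfolding nonempty_has_size[symmetric] by (auto simp: conn_def)
        have "full (\<kappa> + \<delta>')"
          by (rule IH) (use c sz d(1) less.prems(1) in auto)
        moreover have "full \<delta>"
          by (rule IH) (use 2 sz d(1) less.prems(1) in auto)
        moreover have "(\<kappa> + \<delta>') + \<delta> = d"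
          using less.prems(1) by (simp add: add_ac)
        ultimately show ?thesis
          using Ls_br[of g "\<kappa> + \<delta>'" v \<delta>] less.prems(4,5) by auto
      next
        case 3
        then obtain A B where AB: "A \<union> B = set_mset \<delta>" "A \<noteq> {}" "B \<noteq> {}" "sep A B"
          unfolding conn_def by auto
        define \<epsilon>1 where "\<epsilon>1 = filter_mset (\<lambda>a. a \<in> A) \<delta>"
        define \<epsilon>2 where "\<epsilon>2 = filter_mset (\<lambda>a. a \<in> B) \<delta>"
        have sets: "set_mset \<epsilon>1 = A" "set_mset \<epsilon>2 = B"
          using AB by (auto simp: \<epsilon>1_def \<epsilon>2_def)
        have \<delta>: "\<delta> = \<epsilon>1 + \<epsilon>2"
        proof (rule multiset_eqI)
          fix a
          have "a \<notin># \<delta>" if "a \<notin> A" "a \<notin> B" using that AB(1) by blast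
          moreover have "\<not> (a \<in> A \<and> a \<in> B)" using AB(4) by (auto simp: sep_def)
          ultimately show "count \<delta> a = count (\<epsilon>1 + \<epsilon>2) a"
            by (auto simp: \<epsilon>1_def \<epsilon>2_def not_in_iff)
        qed
        have sz: "size \<epsilon>1 < size \<delta>" "size \<epsilon>2 < size \<delta>"
        proof -
          have "\<epsilon>1 \<noteq> {#}" "\<epsilon>2 \<noteq> {#}" using sets AB by auto
          then have "0 < size \<epsilon>1" "0 < size \<epsilon>2"
            by (simp_all only: nonempty_has_size)
          then show "size \<epsilon>1 < size \<delta>" "size \<epsilon>2 < size \<delta>"
            unfolding \<delta> size_union by linarith+
        qed
        have words: "br (\<kappa> + \<delta>') \<delta> g (X w) \<in> Ls d" if w: "mset w = \<delta>" for w
        proof -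
          have "set w \<subseteq> A \<union> B" unfolding AB(1) w[symmetric] by simp
          then obtain c where c: "X w - c \<odot> (X (filter (\<lambda>a. a \<in> A) w) * X (filter (\<lambda>a. a \<in> B) w)) \<in> J" (is "?D \<in> J")
            using split_word AB(4) by blast
          define x :: "'a nc" where "x = X (filter (\<lambda>a. a \<in> A) w)"
          define y :: "'a nc" where "y = X (filter (\<lambda>a. a \<in> B) w)"
          have x: "x \<in> H \<epsilon>1" and y: "y \<in> H \<epsilon>2"
            unfolding x_def y_def \<epsilon>1_def \<epsilon>2_def w[symmetric] by (intro X_in_H, simp)+
          have D: "?D \<in> H \<delta>"
            using H_mult[OF x y] X_in_H[OF w] \<delta>
            by (auto simp: x_def y_def intro!: H_diff H_sc)
          have "br (\<kappa> + (\<epsilon>2 + \<delta>')) \<epsilon>1 (y * g) x \<in> Ls d" (is "?E1 \<in> _")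
          proof (rule less.hyps[OF sz(1) _ less.prems(2) _ x])
            show "d = \<kappa> + \<epsilon>1 + (\<epsilon>2 + \<delta>')"
              unfolding less.prems(1) \<delta> by (simp add: add_ac)
            show "sep (set_mset \<epsilon>1) (set_mset (\<epsilon>2 + \<delta>'))"
              using AB(4) less.prems(3) unfolding \<delta> by (simp add: sets)
            show "y * g \<in> H (\<kappa> + (\<epsilon>2 + \<delta>'))"
              using H_mult[OF y less.prems(5)] by (simp add: add_ac)
          qed
          moreover have "br (\<kappa> + (\<epsilon>1 + \<delta>')) \<epsilon>2 (g * x) y \<in> Ls d" (is "?E2 \<in> _")
          proof (rule less.hyps[OF sz(2) _ less.prems(2) _ y])
            show "d = \<kappa> + \<epsilon>2 + (\<epsilon>1 + \<delta>')"
              unfolding less.prems(1) \<delta> by (simp add: add_ac)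
            have "sep B A" using AB(4) sep_commute by blast
            then show "sep (set_mset \<epsilon>2) (set_mset (\<epsilon>1 + \<delta>'))"
              using less.prems(3) unfolding \<delta> by (simp add: sets)
            show "g * x \<in> H (\<kappa> + (\<epsilon>1 + \<delta>'))"
              using H_mult[OF less.prems(5) x] by (simp add: add_ac)
          qed
          ultimately have "c \<odot> (?E1 + ch \<epsilon>1 (\<kappa> + (\<epsilon>2 + \<delta>')) \<odot> ?E2) \<in> Ls d"
            by (intro nc.subspace_add nc.subspace_scale Ls_subspace)
          moreover have "br (\<kappa> + \<delta>') \<delta> g ?D \<in> Ls d"
          proof (rule J_Ls)
            show "br (\<kappa> + \<delta>') \<delta> g ?D \<in> J"
              using J_mult[OF D less.prems(5)] J_mult[OF less.prems(5) D] c
              by (auto intro!: J_diff J_sc)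
            show "br (\<kappa> + \<delta>') \<delta> g ?D \<in> H d"
            proof (intro H_diff H_sc)
              show "?D * g \<in> H d" "g * ?D \<in> H d"
                using H_mult[OF D less.prems(5)] H_mult[OF less.prems(5) D]
                unfolding less.prems(1) by (simp_all add: add_ac)
            qed
          qed
          ultimately have "c \<odot> (?E1 + ch \<epsilon>1 (\<kappa> + (\<epsilon>2 + \<delta>')) \<odot> ?E2) + br (\<kappa> + \<delta>') \<delta> g ?D \<in> Ls d"
            by (rule Ls_add)
          also have "c \<odot> (?E1 + ch \<epsilon>1 (\<kappa> + (\<epsilon>2 + \<delta>')) \<odot> ?E2) + br (\<kappa> + \<delta>') \<delta> g ?D
              = X w * g - ch \<delta> (\<kappa> + \<delta>') \<odot> (g * X w)"
          proof -
            \<comment> \<open>Each part is moved past the other one once, and these two scalars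
              cancel. What remains is the scalar for moving \<open>\<delta>\<close> as a
              whole.\<close>
            have "ch \<epsilon>1 (\<kappa> + (\<epsilon>2 + \<delta>')) * ch \<epsilon>2 (\<kappa> + (\<epsilon>1 + \<delta>')) = ch \<delta> (\<kappa> + \<delta>') * (ch \<epsilon>1 \<epsilon>2 * ch \<epsilon>2 \<epsilon>1)"
              by (simp add: chim_add_left chim_add_right \<delta> mult_ac)
            also have "ch \<epsilon>1 \<epsilon>2 * ch \<epsilon>2 \<epsilon>1 = 1"
              using ch_sep AB(4) sets by blast
            finally have k: "ch \<epsilon>1 (\<kappa> + (\<epsilon>2 + \<delta>')) * ch \<epsilon>2 (\<kappa> + (\<epsilon>1 + \<delta>')) = ch \<delta> (\<kappa> + \<delta>')" by simp
            show ?thesis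
              unfolding x_def[symmetric] y_def[symmetric] using k by (simp add: algebra_simps)
          qed
          finally show ?thesis .
        qed
        have "v \<in> nc.span (X ` {w. mset w = \<delta>})" using less.prems(4) by (simp add: H_span)
        then show ?thesis
        proof (induction rule: nc.span_induct_alt)
          case base
          then show ?case using Ls_0 by simp
        next
          case (step c x z)
          then obtain w where w: "x = X w" "mset w = \<delta>" by auto
          have "br (\<kappa> + \<delta>') \<delta> g (c \<odot> x + z)
            = c \<odot> br (\<kappa> + \<delta>') \<delta> g (X w) + br (\<kappa> + \<delta>') \<delta> g z"
            by (simp add: w algebra_simps)
          then show ?case
            using step words[OF w(2)] by (simp add: Ls_add Ls_sc)
        qed
      qed
    qed
    have pair: "X (i # k # v) \<in> Ls d" if b: "q i k * q k i \<noteq> 1" and v: "mset (i # k # v) = d" for i k v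
    proof -
      define \<delta> where "\<delta> = mset v"
      have d': "d = {#i, k#} + \<delta> + {#}" using v by (simp add: \<delta>_def)
      have "conn (set_mset {#i, k#})"
        using conn_Un[OF conn_singleton conn_singleton, of i k] b conn_singleton
        by (cases "i = k") (auto simp: sep_def insert_commute)
      then have 1: "br {#i, k#} \<delta> (X [i, k]) (X v) \<in> Ls d" (is "?E1 \<in> _")
        using comp[OF d'] X_in_H[of v \<delta>] X_in_H[of "[i, k]" "{#i, k#}"] by (simp add: \<delta>_def sep_def)
      have 2: "br {#i#} (d - {#i#}) (X [i]) (X (k # v)) \<in> Ls d" (is "?E2 \<in> _")
        using v by (intro rot) auto
      have 3: "br {#k#} (d - {#k#}) (X [k]) (X (v @ [i])) \<in> Ls d" (is "?E3 \<in> _")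
        using v by (intro rot) auto
      have c1: "ch (d - {#i#}) {#i#} = q k i * ch \<delta> {#i#}"
        using chim_add_left[of q "{#k#}" \<delta> "{#i#}"] by (simp add: d')
      have c2: "ch (d - {#k#}) {#k#} = q i k * ch \<delta> {#k#}"
        using chim_add_left[of q "{#i#}" \<delta> "{#k#}"] by (simp add: d')
      have c3: "ch \<delta> {#i, k#} = ch \<delta> {#i#} * ch \<delta> {#k#}"
        using chim_add_right[of q \<delta> "{#i#}" "{#k#}"] by (simp add: add_mset_commute)
      \<comment> \<open>Moving \<open>[i, k]\<close> past \<open>v\<close> in one step or letter by letter gives scalars
          that differ by the factor \<open>q i k * q k i\<close>.\<close>
      have "?E1 - ?E3 - ch (d - {#k#}) {#k#} \<odot> ?E2 \<in> Ls d"
        by (intro nc.subspace_diff[OF Ls_subspace nc.subspace_diff[OF Ls_subspace 1 3]] nc.subspace_scale[OF Ls_subspace 2])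
      also have "?E1 - ?E3 - ch (d - {#k#}) {#k#} \<odot> ?E2
          = (ch \<delta> {#i#} * ch \<delta> {#k#} * (q i k * q k i - 1)) \<odot> X (i # k # v)" (is "_ = ?s \<odot> _")
        unfolding c1 c2 c3 by (simp add: X_mult algebra_simps)
      finally have "?s \<odot> X (i # k # v) \<in> Ls d" .
      \<comment> \<open>By \<open>one\<close> each of the letters \<open>i\<close> and
        \<open>k\<close> has mutually inverse scalars with the remaining degree, so
        \<open>ch \<delta> {#i#}\<close> and \<open>ch \<delta> {#k#}\<close> are nonzero. The last
        factor is nonzero by the choice of the pair.\<close>
      moreover have "?s \<noteq> 0"
        using one[of i] one[of k] v b unfolding c1 c2 by auto
      ultimately show ?thesis using subspace_sc_cancel[OF Ls_subspace] by blast
    qed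
    obtain i k where ik: "i \<in># d" "k \<in># d" "i \<noteq> k" "q i k * q k i \<noteq> 1"
    proof -
      obtain i where i: "i \<in># d" using d(2) by (auto simp: conn_def)
      have "{i} \<union> (set_mset d - {i}) = set_mset d" using i by blast
      moreover have "set_mset d - {i} \<noteq> {}" using two i by auto
      ultimately have "\<not> sep {i} (set_mset d - {i})"
        using d(2) unfolding conn_def by blast
      then show ?thesis using that i by (auto simp: sep_def)
    qed
    have "\<exists>a b u m v. q a b * q b a \<noteq> 1 \<and> w = u @ a # m @ b # v"
    proof -
      have "i \<in> set w" "k \<in> set w" using ik w by auto
      then obtain u v where uv: "w = u @ i # v" by (meson split_list)
      then have "k \<in> set u \<or> k \<in> set v" using \<open>k \<in> set w\<close> ik(3) by auto
      then show ?thesis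
      proof
        assume "k \<in> set v"
        then obtain m v' where "v = m @ k # v'" by (meson split_list)
        then show ?thesis using uv ik(4) by blast
      next
        assume "k \<in> set u"
        then obtain u' m where "u = u' @ k # m" by (meson split_list)
        then have "w = u' @ k # m @ i # v" using uv by simp
        then show ?thesis using ik(4) by (metis mult.commute)
      qed
    qed
    then obtain c i k u v where *: "q i k * q k i \<noteq> 1" "mset (u @ i # k # v) = mset w"
      "X w - c \<odot> X (u @ i # k # v) \<in> J"
      using adjacent_pair by metis
    have "X (i # k # v @ u) \<in> Ls d"
      using * w by (intro pair) (auto simp: add_ac)
    then have r: "X (u @ i # k # v) \<in> Ls d"
      using rotate[of "i # k # v" u] * w by (simp add: union_commute)
    have "X w - c \<odot> X (u @ i # k # v) \<in> Ls d"
      using * w by (intro J_Ls H_diff H_sc X_in_H) auto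
    then have "(X w - c \<odot> X (u @ i # k # v)) + c \<odot> X (u @ i # k # v) \<in> Ls d"
      using r by (intro nc.subspace_add nc.subspace_scale Ls_subspace)
    then show ?thesis by simp
  qed
  then show ?thesis
    using H_subset_iff[OF Ls_subspace] by blast
qed

theorem full_conn:
  assumes "set_mset d \<subseteq> {..<n}" "conn (set_mset d)"
  shows "full d"
  using assms
proof (induction "size d" arbitrary: d rule: less_induct)
  case less
  show ?case
  proof (cases "\<exists>i. set_mset d = {i}")
    case True
    then obtain i where i: "set_mset d = {i}" by blast
    then have d: "d = replicate_mset (count d i) i"
      by (intro multiset_eqI) (auto simp: count_eq_zero_iff)
    have "0 < count d i" "i < n" using i less.prems by auto
    then show ?thesis using full_power d by metis
  next
    case two: False
    show ?thesis
    proof (cases "\<forall>i\<in>#d. conn (set_mset (d - {#i#}))")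
      case True
      then show ?thesis using full_noncut[of d] less two by blast
    next
      case False
      then obtain i where i: "i \<in># d" "\<not> conn (set_mset (d - {#i#}))" by blast
      \<comment> \<open>Removing one of several copies would leave the support unchanged and hence
        connected.\<close>
      have "count d i = 1"
      proof (rule ccontr)
        assume "count d i \<noteq> 1"
        moreover have "count d i \<noteq> 0" using i by simp
        ultimately have "count (d - {#i#}) i > 0" by (simp del: count_eq_zero_iff count_greater_zero_iff)
        then have "set_mset (d - {#i#}) = set_mset d"
          by (metis count_greater_zero_iff i(1) insert_DiffM insert_absorb set_mset_add_mset_insert)
        then show False using i less.prems by simp
      qed
      then have "i \<notin># d - {#i#}"
        by (simp add: not_in_iff)
      then have s: "set_mset (d - {#i#}) = set_mset d - {i}"
        by (rule at_most_one_mset_mset_diff)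
      moreover have "set_mset d - {i} \<noteq> {}" using two i by auto
      ultimately obtain A B where "A \<union> B = set_mset d - {i}" "A \<noteq> {}" "B \<noteq> {}" "sep A B"
        using i(2) unfolding conn_def by auto
      then show ?thesis
        using full_cut[of d i A B] less \<open>count d i = 1\<close> by metis
    qed
  qed
qed

end

section \<open>Combinatorics of standard words and brackets of super-letters\<close>

section \<open>Standard words\<close>

lemma wless_Nil [simp]: "\<not> wless [] v"
  by (auto simp: wless_def)

lemma wless_Cons_Nil [simp]: "wless (a # s) []"
  by (auto simp: wless_def)

lemma wless_Cons [simp]: "wless (a # s) (b # t) \<longleftrightarrow> a < b \<or> a = b \<and> wless s t"
proof
  assume "wless (a # s) (b # t)"
  then show "a < b \<or> a = b \<and> wless s t"
    unfolding wless_def by (auto simp: Cons_eq_append_conv) blast+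
next
  assume "a < b \<or> a = b \<and> wless s t"
  then show "wless (a # s) (b # t)"
  proof
    assume "a < b"
    then have "\<exists>p a' b' s' t'. a' < b' \<and> a # s = p @ a' # s' \<and> b # t = p @ b' # t'"
      by (metis append_Nil)
    then show ?thesis unfolding wless_def by blast
  next
    assume *: "a = b \<and> wless s t"
    then consider "\<exists>w. w \<noteq> [] \<and> s = t @ w" | "\<exists>p a b s' t'. a < b \<and> s = p @ a # s' \<and> t = p @ b # t'"
      unfolding wless_def by blast
    then show ?thesis
    proof cases
      case 2
      then have "\<exists>p a' b' s' t'. a' < b' \<and> a # s = p @ a' # s' \<and> b # t = p @ b' # t'"
        using * by (metis append_Cons)
      then show ?thesis unfolding wless_def by blast
    qed (use * in \<open>auto simp: wless_def\<close>)
  qed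
qed

lemma wless_irrefl [simp]: "\<not> wless u u"
  by (induction u) auto

lemma wless_trans: "wless u v \<Longrightarrow> wless v w \<Longrightarrow> wless u w"
proof (induction u arbitrary: v w)
  case (Cons a u)
  then show ?case by (cases v; cases w) auto
qed simp

lemma wless_total: "u = v \<or> wless u v \<or> wless v u"
proof (induction u arbitrary: v)
  case Nil
  then show ?case by (cases v) auto
next
  case (Cons a u)
  then show ?case by (cases v) (auto simp: neq_iff)
qed

lemma wless_append_same [simp]: "wless (p @ s) (p @ t) \<longleftrightarrow> wless s t"
  by (induction p) auto

lemma wless_extend: "w \<noteq> [] \<Longrightarrow> wless (v @ w) v"
  by (auto simp: wless_def)

lemma wless_cases:
  assumes "wless u v"
  obtains w where "w \<noteq> []" "u = v @ w" | "\<And>x y. wless (u @ x) (v @ y)"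
  using assms unfolding wless_def by (metis append.assoc append_Cons)

lemma wless_short:
  assumes "wless u v" "length u \<le> length v"
  shows "wless (u @ x) (v @ y)"
  using assms(1) by (cases rule: wless_cases) (use assms(2) in auto)

text \<open>This is the usual equivalence for Lyndon words, with the order reversed. The delicate
  case is an end \<open>s\<close> that is also a beginning, u = s t = p s: the rotations of u would
  give both t s < p s and p < t.\<close>

lemma standard_iff_suffix:
  "standard u \<longleftrightarrow> u \<noteq> [] \<and> (\<forall>p s. u = p @ s \<longrightarrow> p \<noteq> [] \<longrightarrow> s \<noteq> [] \<longrightarrow> wless s u)"
proof -
  have rot: "standard u \<longleftrightarrow> u \<noteq> [] \<and> (\<forall>p s. u = p @ s \<longrightarrow> p \<noteq> [] \<longrightarrow> s \<noteq> [] \<longrightarrow> wless (s @ p) u)"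
  proof -
    have "(\<forall>i. 0 < i \<and> i < length u \<longrightarrow> wless (drop i u @ take i u) u) \<longleftrightarrow>
        (\<forall>p s. u = p @ s \<longrightarrow> p \<noteq> [] \<longrightarrow> s \<noteq> [] \<longrightarrow> wless (s @ p) u)"
    proof (intro iffI allI impI)
      fix p s assume *: "\<forall>i. 0 < i \<and> i < length u \<longrightarrow> wless (drop i u @ take i u) u"
        "u = p @ s" "p \<noteq> []" "s \<noteq> []"
      from *(1)[rule_format, of "length p"] show "wless (s @ p) u"
        using *(2-) by simp
    next
      fix i assume *: "\<forall>p s. u = p @ s \<longrightarrow> p \<noteq> [] \<longrightarrow> s \<noteq> [] \<longrightarrow> wless (s @ p) u" "0 < i \<and> i < length u"
      from *(1)[rule_format, of "take i u" "drop i u"] show "wless (drop i u @ take i u) u"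
        using *(2) by (cases "u = []") auto
    qed
    then show ?thesis by (simp add: standard_def)
  qed
  show ?thesis
  proof
    assume u: "standard u"
    have "wless s u" if "u = p @ s" "p \<noteq> []" "s \<noteq> []" for p s
    proof -
      have 1: "wless (s @ p) u" using u rot that by blast
      show ?thesis
      proof (rule ccontr)
        assume "\<not> wless s u"
        then have "wless u s" using wless_total[of s u] that by auto
        then show False
        proof (cases rule: wless_cases)
          case (1 t)
          have "wless (t @ s) u" using u rot 1 that by blast
          then have "wless (t @ s) (p @ s)" using that by simp
          moreover have "wless p t" using \<open>wless (s @ p) u\<close> 1 by simp
          then have "wless (p @ s) (t @ s)"
            using 1 that by (intro wless_short) (metis add_right_imp_eq length_append add.commute order_refl)+
          ultimately show False using wless_trans wless_irrefl by blast
        next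
          case 2
          from 2[of "[]" p] show False
            using 1 wless_trans wless_irrefl by fastforce
        qed
      qed
    qed
    then show "u \<noteq> [] \<and> (\<forall>p s. u = p @ s \<longrightarrow> p \<noteq> [] \<longrightarrow> s \<noteq> [] \<longrightarrow> wless s u)"
      using rot u by blast
  next
    assume *: "u \<noteq> [] \<and> (\<forall>p s. u = p @ s \<longrightarrow> p \<noteq> [] \<longrightarrow> s \<noteq> [] \<longrightarrow> wless s u)"
    have "wless (s @ p) u" if "u = p @ s" "p \<noteq> []" "s \<noteq> []" for p s
      using wless_short[of s u p "[]"] * that by auto
    then show "standard u" using rot * by blast
  qed
qed

lemma standard_nonempty: "standard u \<Longrightarrow> u \<noteq> []"
  by (simp add: standard_iff_suffix)

lemma standard_suffix: "standard (p @ s) \<Longrightarrow> p \<noteq> [] \<Longrightarrow> s \<noteq> [] \<Longrightarrow> wless s (p @ s)"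
  by (simp add: standard_iff_suffix)

lemma standard_single: "standard [a]"
  by (auto simp: standard_iff_suffix append_eq_Cons_conv Cons_eq_append_conv)

lemma wless_append_standard:
  assumes "wless w v" "standard w" "v \<noteq> []"
  shows "wless w (v @ w)"
  using assms(1)
proof (cases rule: wless_cases)
  case (1 r)
  then show ?thesis
    using standard_suffix[of v r] assms by simp
next
  case 2
  from 2[of "[]" w] show ?thesis by simp
qed

lemma standard_append:
  assumes "standard v" "standard w" "wless w v"
  shows "standard (v @ w)"
  unfolding standard_iff_suffix
proof (intro conjI allI impI)
  have v: "v \<noteq> []" and w: "wless w (v @ w)"
    using assms standard_nonempty wless_append_standard by auto
  then show "v @ w \<noteq> []" by simp
  fix p s assume ps: "v @ w = p @ s" "p \<noteq> []" "s \<noteq> []"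
  then obtain t where "v @ t = p \<and> w = t @ s \<or> v = p @ t \<and> t @ w = s"
    by (auto simp: append_eq_append_conv2)
  then show "wless s (v @ w)"
  proof
    assume t: "v @ t = p \<and> w = t @ s"
    then have "s = w \<or> wless s w"
      using standard_suffix[of t s] assms(2) ps by (cases "t = []") auto
    then show ?thesis using w wless_trans by blast
  next
    assume t: "v = p @ t \<and> t @ w = s"
    show ?thesis
    proof (cases "t = []")
      case True
      then show ?thesis using t w by simp
    next
      case False
      then have "wless t v" using standard_suffix[of p t] assms(1) t ps by simp
      then have "wless (t @ w) (v @ w)" by (rule wless_short) (use t in simp)
      then show ?thesis using t by simp
    qed
  qed
qed

text \<open>Every end of the largest end is again an end of \<open>u\<close> and therefore smaller,
  which is the criterion for being standard.\<close>

lemma max_suffix: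
  assumes "u \<noteq> []"
  obtains p m where "u = p @ m" "standard m" "\<And>p' s. u = p' @ s \<Longrightarrow> s \<noteq> [] \<Longrightarrow> s = m \<or> wless s m"
proof -
  have "\<exists>p m. u = p @ m \<and> m \<noteq> [] \<and> (\<forall>p' s. u = p' @ s \<longrightarrow> s \<noteq> [] \<longrightarrow> s = m \<or> wless s m)"
    using assms
  proof (induction u)
    case (Cons a u)
    show ?case
    proof (cases "u = []")
      case True
      then show ?thesis
        by (intro exI[of _ "[]"] exI[of _ "[a]"]) (auto simp: Cons_eq_append_conv)
    next
      case False
      then obtain p m where pm: "u = p @ m" "m \<noteq> []"
        "\<And>p' s. u = p' @ s \<Longrightarrow> s \<noteq> [] \<Longrightarrow> s = m \<or> wless s m"
        using Cons.IH by blast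
      show ?thesis
      proof (cases "wless m (a # u)")
        case True
        then have "s = a # u \<or> wless s (a # u)" if "a # u = p' @ s" "s \<noteq> []" for p' s
          using that pm(3)[of "tl p'" s] wless_trans[of s m "a # u"] by (cases p') auto
        then show ?thesis by (metis append_Nil list.distinct(1))
      next
        case False
        then have "a # u = m \<or> wless (a # u) m" using wless_total by blast
        then have "s = m \<or> wless s m" if "a # u = p' @ s" "s \<noteq> []" for p' s
          using that pm(3) by (cases p') auto
        then show ?thesis using pm by (metis append_Cons)
      qed
    qed
  qed simp
  then obtain p m where pm: "u = p @ m" "m \<noteq> []" "\<And>p' s. u = p' @ s \<Longrightarrow> s \<noteq> [] \<Longrightarrow> s = m \<or> wless s m"
    by blast
  have "standard m"
    unfolding standard_iff_suffix
  proof (intro conjI allI impI)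
    fix p' s assume "m = p' @ s" "p' \<noteq> []" "s \<noteq> []"
    then show "wless s m" using pm(3)[of "p @ p'" s] pm(1) by auto
  qed (use pm in auto)
  then show ?thesis using that pm by blast
qed

section \<open>The standard factorization of a standard word\<close>

lemma sfi_props:
  assumes "2 \<le> length u"
  shows "0 < sfi u" "sfi u < length u" "standard (drop (sfi u) u)"
    and "\<And>i. 0 < i \<Longrightarrow> i < sfi u \<Longrightarrow> \<not> standard (drop i u)"
proof -
  let ?P = "\<lambda>i. 0 < i \<and> i < length u \<and> standard (drop i u)"
  have "drop (length u - 1) u = [last u]"
    using assms by (metis One_nat_def Suc_1 append_butlast_last_id append_eq_conv_conj length_butlast list.size(3) not_less_eq_eq zero_le)
  then have "?P (length u - 1)"
    using assms standard_single by auto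
  then have ex: "\<exists>i. ?P i" by blast
  then have s: "sfi u = (LEAST i. ?P i)" by (simp add: sfi_def)
  have "?P (sfi u)" unfolding s using ex by (rule LeastI_ex)
  then show "0 < sfi u" "sfi u < length u" "standard (drop (sfi u) u)" by auto
  fix i assume "0 < i" "i < sfi u"
  then show "\<not> standard (drop i u)"
    using not_less_Least[of i ?P] \<open>sfi u < length u\<close> unfolding s by auto
qed

lemma sfi_eq:
  assumes "v \<noteq> []" "standard w"
    and "\<And>p s. v = p @ s \<Longrightarrow> p \<noteq> [] \<Longrightarrow> s \<noteq> [] \<Longrightarrow> \<not> standard (s @ w)"
  shows "sfi (v @ w) = length v"
proof -
  have w: "w \<noteq> []" using assms(2) standard_nonempty by blast
  then have len: "2 \<le> length (v @ w)" using assms(1) by (cases v; cases w) auto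
  note props = sfi_props[OF len]
  have "\<not> sfi (v @ w) < length v"
  proof
    assume *: "sfi (v @ w) < length v"
    then show False
      using assms(3)[of "take (sfi (v @ w)) v" "drop (sfi (v @ w)) v"] props(1,3) assms(1) by auto
  qed
  moreover have "\<not> length v < sfi (v @ w)"
    using props(4)[of "length v"] assms by auto
  ultimately show ?thesis by simp
qed

text \<open>The end \<open>w\<close> is the longest proper standard end by construction. If the
  largest end \<open>m\<close> of \<open>v\<close> were proper, then w < m, and \<open>m @ w\<close>
  would be a longer one.\<close>

lemma standard_split:
  assumes "standard u" "2 \<le> length u"
  obtains v w where "u = v @ w" "sfi u = length v" "standard v" "standard w" "wless w v"
    "\<And>p s. v = p @ s \<Longrightarrow> p \<noteq> [] \<Longrightarrow> s \<noteq> [] \<Longrightarrow> \<not> standard (s @ w)"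
proof -
  define v where "v = take (sfi u) u"
  define w where "w = drop (sfi u) u"
  note props = sfi_props[OF assms(2)]
  have u: "u = v @ w" by (simp add: v_def w_def)
  have len: "length v = sfi u" "v \<noteq> []" "w \<noteq> []" using props by (auto simp: v_def w_def)
  have w: "standard w" using props by (simp add: w_def)
  have nstd: "\<not> standard (s @ w)" if "v = p @ s" "p \<noteq> []" "s \<noteq> []" for p s
  proof -
    have "drop (length p) u = s @ w" "length p < sfi u"
      unfolding u len(1)[unfolded u, symmetric] using that by simp_all
    then show ?thesis using props(4)[of "length p"] that by auto
  qed
  have wu: "wless w u" using standard_suffix[of v w] assms(1) u len by simp
  have uv: "wless u v" using wless_extend len u by simp
  have wv: "wless w v" using wu uv by (rule wless_trans)
  obtain p m where m: "v = p @ m" "standard m" "\<And>p' s. v = p' @ s \<Longrightarrow> s \<noteq> [] \<Longrightarrow> s = m \<or> wless s m"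
    using max_suffix[OF len(2)] by blast
  have "p = []"
  proof (rule ccontr)
    assume p: "p \<noteq> []"
    have mn: "m \<noteq> []" using m standard_nonempty by blast
    have "wless v m" using m(3)[of "[]" v] len p m(1) by auto
    then have "wless w m"
    proof (cases rule: wless_cases)
      case 1
      then show ?thesis using wv wless_trans \<open>wless v m\<close> by blast
    next
      case 2
      have "wless (m @ w) u"
        using standard_suffix[of p "m @ w"] assms(1) u m(1) p mn by simp
      moreover have "wless u (m @ w)" using 2[of w w] u by simp
      ultimately show ?thesis using wless_trans wless_irrefl by blast
    qed
    then have "standard (m @ w)" using standard_append m(2) w by blast
    then show False using nstd[OF m(1) p mn] by blast
  qed
  then have "standard v" using m by simp
  then show ?thesis using that u len w wv nstd by simp
qed

text \<open>If the second factor of \<open>v\<close> is at most \<open>w\<close>, then so is every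
  proper end \<open>s\<close> of \<open>v\<close>. Hence \<open>s @ w\<close> lies below its own end
  \<open>w\<close> and is not standard.\<close>

lemma sfi_append:
  assumes v: "standard v" and w: "standard w"
    and v2: "2 \<le> length v \<Longrightarrow> \<not> wless w (drop (sfi v) v)"
  shows "sfi (v @ w) = length v"
proof (rule sfi_eq)
  fix p s assume s: "v = p @ s" "p \<noteq> []" "s \<noteq> []"
  then have len: "2 \<le> length v" by (cases p; cases s) auto
  obtain v1 v2 where vv: "v = v1 @ v2" "sfi v = length v1" "standard v1" "standard v2"
    "\<And>p s. v1 = p @ s \<Longrightarrow> p \<noteq> [] \<Longrightarrow> s \<noteq> [] \<Longrightarrow> \<not> standard (s @ v2)"
    using standard_split[OF v len] by metis
  have v2w: "v2 = w \<or> wless v2 w"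
    using v2[OF len] vv wless_total by fastforce
  obtain p' m where m: "s = p' @ m" "standard m" "\<And>p' t. s = p' @ t \<Longrightarrow> t \<noteq> [] \<Longrightarrow> t = m \<or> wless t m"
    using max_suffix[OF s(3)] by blast
  have mn: "m \<noteq> []" using m standard_nonempty by blast
  have eq: "v1 @ v2 = (p @ p') @ m" using vv s m by simp
  have "m = v2 \<or> wless m v2"
  proof -
    obtain t where "v1 @ t = p @ p' \<and> v2 = t @ m \<or> v1 = (p @ p') @ t \<and> t @ v2 = m"
      using append_eq_append_conv2[THEN iffD1, OF eq] by blast
    then show ?thesis
    proof
      assume "v1 @ t = p @ p' \<and> v2 = t @ m"
      then show ?thesis using standard_suffix[of t m] vv(4) mn by (cases "t = []") auto
    next
      assume t: "v1 = (p @ p') @ t \<and> t @ v2 = m"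
      then show ?thesis using vv(5)[of "p @ p'" t] m(2) s(2) by (cases "t = []") auto
    qed
  qed
  then have "s = w \<or> wless s w"
    using m(3)[of "[]" s] s(3) v2w wless_trans by blast
  then have "wless (s @ w) w"
    using wless_extend[of w s] standard_nonempty[OF w] wless_trans by blast
  then show "\<not> standard (s @ w)"
    using standard_suffix[of s w] s(3) standard_nonempty[OF w] wless_trans wless_irrefl by blast
qed (use v w standard_nonempty in auto)

lemma sl_append:
  assumes "standard v" "standard w" "sfi (v @ w) = length v"
  shows "sl q (v @ w) = tbr (chi q w v) (sl q v) (sl q w)"
proof -
  have "\<not> length (v @ w) < 2"
    using assms(1,2)[THEN standard_nonempty] by (cases v; cases w) auto
  then show ?thesis
    by (subst sl.simps) (simp add: assms(3))
qed

section \<open>Graded spaces of super-words\<close>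

context braiding
begin

definition S :: "nat list \<Rightarrow> 'a nc"
  where "S u = Nc (sl q u)"

text \<open>Including the ideal lets all computations modulo \<open>J\<close> be carried out in the free algebra.\<close>

definition UJ :: "nat list set \<Rightarrow> nat multiset \<Rightarrow> 'a nc set"
  where "UJ P d = nc.span ({prod_list (map S vs) | vs. set vs \<subseteq> P \<and> mset (concat vs) = d} \<union> (J \<inter> H d))"

lemma UJ_subspace: "nc.subspace (UJ P d)"
  by (simp add: UJ_def)

lemmas UJ_0 = nc.subspace_0[OF UJ_subspace]
  and UJ_add = nc.subspace_add[OF UJ_subspace]
  and UJ_diff = nc.subspace_diff[OF UJ_subspace]
  and UJ_sc = nc.subspace_scale[OF UJ_subspace]

lemma S_single: "S [i] = X [i]"
  by (simp add: S_def sl.simps X_def tletter_def)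

lemma S_append:
  assumes "standard v" "standard w" "sfi (v @ w) = length v"
  shows "S (v @ w) = S w * S v - ch (mset w) (mset v) \<odot> (S v * S w)"
  by (simp add: S_def sl_append[OF assms] Nc_tbr chi_chim)

lemma S_H: "standard u \<Longrightarrow> S u \<in> H (mset u)"
proof (induction "length u" arbitrary: u rule: less_induct)
  case less
  show ?case
  proof (cases "2 \<le> length u")
    case True
    then obtain v w where vw: "u = v @ w" "sfi u = length v" "standard v" "standard w"
      using standard_split less.prems by metis
    then have "S v \<in> H (mset v)" "S w \<in> H (mset w)"
      using less.hyps[of v] less.hyps[of w] standard_nonempty by auto
    then have "S v * S w \<in> H (mset u)" "S w * S v \<in> H (mset u)"
      using H_mult[of "S v" "mset v" "S w" "mset w"] H_mult[of "S w" "mset w" "S v" "mset v"] vw(1)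
      by (auto simp: add.commute)
    then show ?thesis
      unfolding vw(1) S_append[OF vw(3,4) vw(2)[unfolded vw(1)]]
      by (intro H_diff H_sc)
  next
    case False
    then obtain i where "u = [i]"
      using standard_nonempty[OF less.prems] by (cases u; cases "tl u") auto
    then show ?thesis by (simp add: S_single X_in_H)
  qed
qed

lemma prod_S_H: "\<forall>v\<in>set vs. standard v \<Longrightarrow> prod_list (map S vs) \<in> H (mset (concat vs))"
  by (induction vs) (auto simp: one_in_H intro: H_mult S_H)

lemma UJ_H: "\<forall>v\<in>P. standard v \<Longrightarrow> UJ P d \<subseteq> H d"
  unfolding UJ_def by (rule nc.span_minimal) (auto intro: prod_S_H H_subspace)

lemma J_UJ: "x \<in> J \<Longrightarrow> x \<in> H d \<Longrightarrow> x \<in> UJ P d"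
  unfolding UJ_def by (rule nc.span_base) auto

lemma UJ_superword: "set vs \<subseteq> P \<Longrightarrow> mset (concat vs) = d \<Longrightarrow> prod_list (map S vs) \<in> UJ P d"
  unfolding UJ_def by (rule nc.span_base) auto

lemma UJ_1: "1 \<in> UJ P {#}"
  using UJ_superword[of "[]" P] by simp

lemma UJ_letter: "u \<in> P \<Longrightarrow> S u \<in> UJ P (mset u)"
  using UJ_superword[of "[u]" P] by simp

lemma UJ_mono:
  assumes "\<And>v. v \<in> P \<Longrightarrow> mset v \<subseteq># d \<Longrightarrow> v \<in> Q"
  shows "UJ P d \<subseteq> UJ Q d"
proof -
  have *: "mset v \<subseteq># mset (concat vs)" if "v \<in> set vs" for v and vs :: "nat list list"
    using that by (induction vs) (auto intro: subset_mset.trans)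
  have "set vs \<subseteq> Q" if "set vs \<subseteq> P" "mset (concat vs) = d" for vs
    using * assms that by blast
  then show ?thesis
    unfolding UJ_def by (intro nc.span_mono Un_mono) blast+
qed

lemma UJ_mult:
  assumes "x \<in> UJ P d" "y \<in> UJ P e" "\<forall>v\<in>P. standard v"
  shows "x * y \<in> UJ P (d + e)"
proof (rule span_mult[OF assms(1,2)[unfolded UJ_def] UJ_subspace])
  fix a b
  assume ab: "a \<in> {prod_list (map S vs) | vs. set vs \<subseteq> P \<and> mset (concat vs) = d} \<union> J \<inter> H d"
    "b \<in> {prod_list (map S vs) | vs. set vs \<subseteq> P \<and> mset (concat vs) = e} \<union> J \<inter> H e"
  show "a * b \<in> UJ P (d + e)"
  proof (cases "a \<in> J \<or> b \<in> J")
    case True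
    have "a \<in> H d" "b \<in> H e" using ab assms(3) prod_S_H by blast+
    with True show ?thesis using J_mult H_mult J_UJ by blast
  next
    case False
    then obtain vs ws where "a = prod_list (map S vs)" "b = prod_list (map S ws)"
      "set vs \<subseteq> P" "mset (concat vs) = d" "set ws \<subseteq> P" "mset (concat ws) = e"
      using ab by blast
    then show ?thesis using UJ_superword[of "vs @ ws" P "d + e"] by simp
  qed
qed

text \<open>The two maps \<open>b \<mapsto> b x - \<chi> x b\<close> and \<open>\<partial>\<^sub>j\<close> are skew derivations,
  so it suffices to control them on super-letters.\<close>

lemma UJ_comm:
  assumes x: "x \<in> H a" and P: "\<forall>v\<in>P. standard v" and Q: "\<forall>v\<in>Q. standard v"
    and b: "b \<in> UJ P d"
    and z: "\<And>z. z \<in> P \<Longrightarrow> mset z \<subseteq># d \<Longrightarrow> S z \<in> UJ Q (mset z)"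
      "\<And>z. z \<in> P \<Longrightarrow> mset z \<subseteq># d \<Longrightarrow> S z * x - ch (mset z) a \<odot> (x * S z) \<in> UJ Q (mset z + a)"
  shows "br a d x b \<in> UJ Q (d + a)"
proof -
  have words: "prod_list (map S vs) \<in> UJ Q (mset (concat vs)) \<and>
      prod_list (map S vs) * x - ch (mset (concat vs)) a \<odot> (x * prod_list (map S vs)) \<in> UJ Q (mset (concat vs) + a)"
    if "set vs \<subseteq> P" "mset (concat vs) \<subseteq># d" for vs
    using that
  proof (induction vs)
    case Nil
    then show ?case using UJ_1 UJ_0 by simp
  next
    case (Cons v vs)
    let ?B = "prod_list (map S vs)" and ?m = "mset (concat vs)"
    have sub: "?m \<subseteq># d" "mset v \<subseteq># d"
      using Cons.prems(2) by (auto dest: mset_subset_eq_add_left[THEN subset_mset.trans] mset_subset_eq_add_right[THEN subset_mset.trans])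
    then have B: "?B \<in> UJ Q ?m" "br a ?m x ?B \<in> UJ Q (?m + a)"
      using Cons by auto
    have v: "S v \<in> UJ Q (mset v)" "br a (mset v) x (S v) \<in> UJ Q (mset v + a)"
      using z Cons.prems sub by auto
    have "S v * br a ?m x ?B + ch ?m a \<odot> (br a (mset v) x (S v) * ?B)
        \<in> UJ Q (mset v + ?m + a)"
      using UJ_mult[OF v(1) B(2) Q] UJ_mult[OF v(2) B(1) Q] by (intro UJ_add UJ_sc) (simp_all add: add_ac)
    also have "S v * br a ?m x ?B + ch ?m a \<odot> (br a (mset v) x (S v) * ?B)
        = (S v * ?B) * x - ch (mset v + ?m) a \<odot> (x * (S v * ?B))"
      by (simp add: algebra_simps chim_add_left)
    finally show ?case
      using UJ_mult[OF v(1) B(1) Q] by simp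
  qed
  have "b \<in> nc.span ({prod_list (map S vs) | vs. set vs \<subseteq> P \<and> mset (concat vs) = d} \<union> J \<inter> H d)"
    using b by (simp add: UJ_def)
  then show ?thesis
  proof (induction rule: nc.span_induct_alt)
    case base
    then show ?case using UJ_0 by simp
  next
    case (step c y z)
    have "br a d x y \<in> UJ Q (d + a)"
    proof (cases "y \<in> J \<inter> H d")
      case True
      then show ?thesis
        using skew_J[OF x, of y d] skew_H[OF x, of y d] by (intro J_UJ) (auto simp: add.commute)
    next
      case False
      then show ?thesis using step(1) words by auto
    qed
    moreover have "br a d x (c \<odot> y + z)
        = c \<odot> br a d x y + br a d x z"
      by (simp add: algebra_simps)
    ultimately show ?case using step(2) by (simp add: UJ_add UJ_sc)
  qed
qed

lemma der_mult_UJ: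
  assumes "x \<in> UJ Q d" "y \<in> UJ Q e" "der j x \<in> UJ Q (d - {#j#})" "der j y \<in> UJ Q (e - {#j#})"
    and Q: "\<forall>v\<in>Q. standard v"
  shows "der j (x * y) \<in> UJ Q (d + e - {#j#})"
proof -
  have H: "x \<in> H d" "y \<in> H e" using assms(1,2) UJ_H[OF Q] by auto
  have "x * der j y \<in> UJ Q (d + e - {#j#})"
  \<comment> \<open>Subtraction of multisets is truncated, so a letter outside \<open>e\<close> is
    treated apart; its derivative vanishes.\<close>
  proof (cases "j \<in># e")
    case True
    then show ?thesis using UJ_mult[OF assms(1,4) Q] by simp
  qed (use der_eq_0[OF H(2)] UJ_0 in simp)
  moreover have "der j x * y \<in> UJ Q (d + e - {#j#})"
  proof (cases "j \<in># d")
    case True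
    then show ?thesis using UJ_mult[OF assms(3,2) Q] by simp
  qed (use der_eq_0[OF H(1)] UJ_0 in simp)
  ultimately show ?thesis
    unfolding der_mult_H[OF H(2)] by (intro UJ_add UJ_sc)
qed

lemma UJ_der:
  assumes Q: "\<forall>v\<in>Q. standard v" and b: "b \<in> UJ Q d"
    and z: "\<And>z. z \<in> Q \<Longrightarrow> der j (S z) \<in> UJ Q (mset z - {#j#})"
  shows "der j b \<in> UJ Q (d - {#j#})"
proof -
  have words: "der j (prod_list (map S vs)) \<in> UJ Q (mset (concat vs) - {#j#})" if "set vs \<subseteq> Q" for vs
    using that
  proof (induction vs)
    case Nil
    then show ?case using UJ_0 by simp
  next
    case (Cons v vs)
    then show ?case
      using der_mult_UJ[of "S v" Q "mset v" "prod_list (map S vs)" "mset (concat vs)" j]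
        UJ_letter UJ_superword z Q by auto
  qed
  have "b \<in> nc.span ({prod_list (map S vs) | vs. set vs \<subseteq> Q \<and> mset (concat vs) = d} \<union> J \<inter> H d)"
    using b by (simp add: UJ_def)
  then show ?thesis
  proof (induction rule: nc.span_induct_alt)
    case base
    then show ?case using UJ_0 by simp
  next
    case (step c y z)
    have "der j y \<in> UJ Q (d - {#j#})"
    proof (cases "y \<in> J \<inter> H d")
      case True
      then show ?thesis using J_UJ der_in_J der_H by blast
    next
      case False
      then show ?thesis using step(1) words by auto
    qed
    then show ?case using step(2) by (simp add: der_add der_sc UJ_add UJ_sc)
  qed
qed

definition low :: "nat list \<Rightarrow> nat list set"
  where "low u = {z. standard z \<and> wless z u}"

definition low_eq :: "nat list \<Rightarrow> nat list set"
  where "low_eq u = {z. standard z \<and> (wless z u \<or> z = u)}"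

lemma low_standard: "\<forall>v\<in>low u. standard v" "\<forall>v\<in>low_eq u. standard v"
  by (auto simp: low_def low_eq_def)

text \<open>If (v, w) is the standard factorization of \<open>v @ w\<close>, the bracket is the
  super-letter itself. Otherwise v = v1 v2 with w < v2, and the skew Jacobi identity reduces it to
  the brackets of v2 with w, of v1 with w, and of v1 with the super-letters that occur in the first
  of these.\<close>

lemma bracket_low_eq:
  assumes "standard v" "standard w" "wless w v"
  shows "br (mset v) (mset w) (S v) (S w) \<in> UJ (low_eq (v @ w)) (mset (v @ w))"
  using assms
proof (induction "(length v + length w, length v)" arbitrary: v w
    rule: wf_induct_rule[OF wf_lex_prod[OF wf_less_than wf_less_than]])
  case (1 v w)
  have IH: "br (mset v') (mset w') (S v') (S w') \<in> UJ (low_eq (v' @ w')) (mset (v' @ w'))"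
    if "standard v'" "standard w'" "wless w' v'"
      "length v' + length w' < length v + length w \<or>
       length v' + length w' = length v + length w \<and> length v' < length v" for v' w'
    using 1(1)[OF _ that(1-3)] that(4) by auto
  have vw: "standard (v @ w)"
    using standard_append 1(2-4) by blast
  show ?case
  proof (cases "sfi (v @ w) = length v")
    case True
    then show ?thesis
      using UJ_letter[of "v @ w" "low_eq (v @ w)"] vw S_append[OF 1(2,3)] by (simp add: low_eq_def)
  next
    case False
    then have len: "2 \<le> length v" and wv2': "wless w (drop (sfi v) v)"
      using sfi_append[OF 1(2,3)] by blast+
    obtain v1 v2 where v: "v = v1 @ v2" "sfi v = length v1" "standard v1" "standard v2" "wless v2 v1"
      using standard_split[OF 1(2) len] by metis
    have wv2: "wless w v2" using wv2' v by simp
    have wv1: "wless w v1" using wv2 v(5) wless_trans by blast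
    have ne: "v1 \<noteq> []" "v2 \<noteq> []" "w \<noteq> []" using v 1(3) standard_nonempty by auto
    have v2v: "wless v2 v" using standard_suffix[of v1 v2] v(1) 1(2) ne by simp
    have v2vw: "wless v2 (v @ w)"
      using wless_short[OF v2v, of "[]" w] v(1) by simp
    have v2w: "wless (v2 @ w) (v @ w)"
      using standard_suffix[of v1 "v2 @ w"] vw v(1) ne by simp
    define x y z where "x = S v1" and "y = S v2" and "z = S w"
    define a b c where "a = mset v1" and "b = mset v2" and "c = mset w"
    have dv: "mset v = a + b" "mset (v @ w) = a + b + c"
      using v(1) by (simp_all add: a_def b_def c_def)
    have Sv: "S v = y * x - ch b a \<odot> (x * y)"
      using S_append[OF v(3,4) v(2)[unfolded v(1)]] v(1) by (simp add: x_def y_def a_def b_def)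
    note std = low_standard(2)
    have B1: "br b c y z \<in> UJ (low_eq (v2 @ w)) (b + c)" (is "?B1 \<in> _")
      using IH[OF v(4) 1(3) wv2] ne(1) v(1) by (simp add: y_def z_def b_def c_def)
    have B2: "br a c x z \<in> UJ (low_eq (v @ w)) (a + c)" (is "?B2 \<in> _")
    proof -
      have "wless (v1 @ w) (v @ w)"
        using wless_append_standard[OF wv2 1(3) ne(2)] v(1) by simp
      then have "low_eq (v1 @ w) \<subseteq> low_eq (v @ w)"
        using wless_trans by (auto simp: low_eq_def)
      moreover have "?B2 \<in> UJ (low_eq (v1 @ w)) (a + c)"
        using IH[OF v(3) 1(3) wv1] ne(2) v(1) by (simp add: x_def z_def a_def c_def)
      ultimately show ?thesis using UJ_mono[of "low_eq (v1 @ w)" "a + c" "low_eq (v @ w)"] by blast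
    qed
    \<comment> \<open>The total length need not drop here, since \<open>t\<close> may be as long as
      v2 w. The second component of the measure decreases because v1 is shorter than
      \<open>v\<close>.\<close>
    have B3: "br a (b + c) x ?B1 \<in> UJ (low_eq (v @ w)) (b + c + a)"
    proof (rule UJ_comm[OF _ std std B1])
      show "x \<in> H a" using S_H v(3) by (simp add: x_def a_def)
      fix t assume t: "t \<in> low_eq (v2 @ w)" "mset t \<subseteq># b + c"
      then have t': "standard t" "wless t (v2 @ w) \<or> t = v2 @ w" by (auto simp: low_eq_def)
      then have tvw: "wless t (v @ w)" using v2w wless_trans by blast
      then show "S t \<in> UJ (low_eq (v @ w)) (mset t)"
        using t' by (intro UJ_letter) (auto simp: low_eq_def)
      have tv1: "wless t v1"
      proof -
        have "wless (v2 @ w) v2" using wless_extend ne by simp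
        then show ?thesis using t'(2) v(5) wless_trans by blast
      qed
      have "length t \<le> length v2 + length w"
        using size_mset_mono[OF t(2)] by (simp add: b_def c_def)
      then have "br (mset v1) (mset t) (S v1) (S t) \<in> UJ (low_eq (v1 @ t)) (mset (v1 @ t))"
        using ne v(1) by (intro IH v(3) t' tv1) auto
      moreover have "low_eq (v1 @ t) \<subseteq> low_eq (v @ w)"
        using t'(2) wless_trans v(1) by (auto simp: low_eq_def)
      ultimately show "br a (mset t) x (S t) \<in> UJ (low_eq (v @ w)) (mset t + a)"
        using UJ_mono[of "low_eq (v1 @ t)" "mset t + a" "low_eq (v @ w)"] by (auto simp: x_def a_def add.commute)
    qed
    have y: "y \<in> UJ (low_eq (v @ w)) b"
      using UJ_letter[of v2 "low_eq (v @ w)"] v2vw v(4) by (simp add: y_def b_def low_eq_def)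
    have "(br a (b + c) x ?B1) + ch c b \<odot> (y * ?B2) - ch b a \<odot> (?B2 * y) \<in> UJ (low_eq (v @ w)) (a + b + c)"
    proof (intro UJ_diff[OF UJ_add[OF _ UJ_sc] UJ_sc])
      show "br a (b + c) x ?B1 \<in> UJ (low_eq (v @ w)) (a + b + c)"
        using B3 by (simp add: add_ac)
      show "y * ?B2 \<in> UJ (low_eq (v @ w)) (a + b + c)" "?B2 * y \<in> UJ (low_eq (v @ w)) (a + b + c)"
        using UJ_mult[OF y B2 std] UJ_mult[OF B2 y std] by (simp_all add: add_ac)
    qed
    also have "(br a (b + c) x ?B1) + ch c b \<odot> (y * ?B2) - ch b a \<odot> (?B2 * y)
       = z * S v - ch c (a + b) \<odot> (S v * z)"
      unfolding Sv by (simp add: algebra_simps chim_add_left chim_add_right)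
    finally show ?thesis by (simp add: dv z_def c_def del: mset_append)
  qed
qed

text \<open>Two instances are needed: \<open>w\<close> the second factor of the standard
  factorization of \<open>u\<close>, and v = w = u. In both, \<open>v @ z\<close> lies below
  \<open>u\<close>, so \<open>bracket_low_eq\<close> yields super-letters below
  \<open>u\<close>.\<close>

lemma bracket_low:
  assumes "standard v" "b \<in> UJ (low w) d" "w = v \<or> wless w v \<and> standard w"
    and "\<And>z. z \<in> low w \<Longrightarrow> wless (v @ z) u" "w = u \<or> wless w u"
  shows "br (mset v) d (S v) b \<in> UJ (low u) (d + mset v)"
proof (rule UJ_comm[OF S_H[OF assms(1)] low_standard(1) low_standard(1) assms(2)])
  fix z assume "z \<in> low w"
  then have z: "standard z" "wless z w" "wless z u" "wless z v" "wless (v @ z) u"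
    using assms(3-5) wless_trans by (auto simp: low_def)
  then show "S z \<in> UJ (low u) (mset z)"
    by (intro UJ_letter) (simp add: low_def)
  have "low_eq (v @ z) \<subseteq> low u"
    using z wless_trans by (auto simp: low_eq_def low_def)
  then show "br (mset v) (mset z) (S v) (S z) \<in> UJ (low u) (mset z + mset v)"
    using bracket_low_eq[OF assms(1) z(1,4)] UJ_mono[of "low_eq (v @ z)" "mset z + mset v" "low u"]
    by (auto simp: add.commute)
qed

text \<open>For u = v w the word \<open>v\<close> is larger than \<open>u\<close>, so [v] must
  disappear from the derivative of the bracket. It remains only next to the derivative of [w], in
  the form of a bracket, and \<open>bracket_low\<close> applies.\<close>

lemma der_S_low: "standard u \<Longrightarrow> der j (S u) \<in> UJ (low u) (mset u - {#j#})"
proof (induction "length u" arbitrary: u rule: less_induct)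
  case less
  show ?case
  proof (cases "j \<in># mset u")
    case False
    then show ?thesis using der_eq_0[OF S_H[OF less.prems]] UJ_0 by simp
  next
    case j: True
    show ?thesis
    proof (cases "2 \<le> length u")
      case False
      then obtain i where "u = [i]"
        using standard_nonempty[OF less.prems] by (cases u; cases "tl u") auto
      then show ?thesis using j UJ_1 by (auto simp: S_single der_letter)
    next
      case True
      obtain v w where vw: "u = v @ w" "sfi u = length v" "standard v" "standard w" "wless w v"
        using standard_split less.prems True by metis
      have ne: "v \<noteq> []" "w \<noteq> []" using vw standard_nonempty by auto
      have wu: "wless w u" using standard_suffix[of v w] less.prems vw ne by simp
      note std = low_standard(1)
      define a b where "a = mset v" and "b = mset w"
      have u: "mset u = a + b" using vw by (simp add: a_def b_def)
      define A where "A = der j (S v)"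
      define B where "B = der j (S w)"
      have A: "A \<in> UJ (low v) (a - {#j#})" and B: "B \<in> UJ (low w) (b - {#j#})"
        using less.hyps[of v] less.hyps[of w] vw ne by (auto simp: A_def B_def a_def b_def)
      have SH: "S v \<in> H a" "S w \<in> H b" using S_H vw by (auto simp: a_def b_def)
      have Su: "S u = S w * S v - ch b a \<odot> (S v * S w)"
        using S_append[OF vw(3,4) vw(2)[unfolded vw(1)]] vw(1) by (simp add: a_def b_def)
      have Sw: "S w \<in> UJ (low u) b"
        using UJ_letter[of w "low u"] wu vw by (simp add: low_def b_def)
      have A0: "A = 0" if "j \<notin># a" using der_eq_0[OF SH(1) that] by (simp add: A_def)
      have B0: "B = 0" if "j \<notin># b" using der_eq_0[OF SH(2) that] by (simp add: B_def)
      have P1: "S w * A - (ch b a * ch {#j#} b) \<odot> (A * S w) \<in> UJ (low u) (a + b - {#j#})"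
      proof (cases "j \<in># a")
        case True
        have "UJ (low v) (a - {#j#}) \<subseteq> UJ (low u) (a - {#j#})"
        proof (rule UJ_mono)
          fix z assume z: "z \<in> low v" "mset z \<subseteq># a - {#j#}"
          \<comment> \<open>From z < v alone z < u does not follow, as u < v. The bound on the
            length excludes extensions of \<open>v\<close>.\<close>
          have "length z \<le> length v"
            using size_mset_mono[OF z(2)] by (simp add: a_def size_Diff_singleton_if split: if_splits)
          then have "wless (z @ []) (v @ w)"
            using z(1) by (intro wless_short) (simp_all add: low_def)
          then show "z \<in> low u" using z vw(1) by (simp add: low_def)
        qed
        then have A': "A \<in> UJ (low u) (a - {#j#})" using A by blast
        have "b + (a - {#j#}) = a + b - {#j#}" "(a - {#j#}) + b = a + b - {#j#}"
          using True by (simp_all add: add.commute)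
        then show ?thesis
          using UJ_mult[OF Sw A' std] UJ_mult[OF A' Sw std] by (intro UJ_diff UJ_sc) simp_all
      qed (simp add: A0 UJ_0)
      have P2: "ch {#j#} a \<odot> (B * S v) - ch b a \<odot> (S v * B) \<in> UJ (low u) (a + b - {#j#})"
      proof (cases "j \<in># b")
        case True
        then have b: "b = {#j#} + (b - {#j#})" by simp
        have "br (mset v) (b - {#j#}) (S v) B \<in> UJ (low u) (b - {#j#} + mset v)"
        proof (rule bracket_low[OF vw(3) B])
          show "wless (v @ z) u" if "z \<in> low w" for z
            using that vw(1) by (simp add: low_def)
        qed (use vw wu in auto)
        then have "ch {#j#} a \<odot> br a (b - {#j#}) (S v) B \<in> UJ (low u) (b - {#j#} + a)"
          unfolding a_def by (rule UJ_sc)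
        moreover have "b - {#j#} + a = a + b - {#j#}" using True by (simp add: add.commute)
        \<comment> \<open>The twist of the derivation supplies exactly the factor that the removed
          letter \<open>j\<close> takes away from the bracket scalar.\<close>
        moreover have "ch {#j#} a * ch (b - {#j#}) a = ch b a"
          by (subst (2) b) (rule chim_add_left[symmetric])
        ultimately show ?thesis by (simp add: algebra_simps)
      qed (simp add: B0 UJ_0)
      have "der j (S u) = (S w * A - (ch b a * ch {#j#} b) \<odot> (A * S w)) + (ch {#j#} a \<odot> (B * S v) - ch b a \<odot> (S v * B))"
        unfolding Su der_diff der_sc der_mult_H[OF SH(1)] der_mult_H[OF SH(2)]
        by (simp add: A_def B_def algebra_simps)
      then show ?thesis using P1 P2 UJ_add u by metis
    qed
  qed
qed

lemma UJ_low_der: "x \<in> UJ (low u) d \<Longrightarrow> der j x \<in> UJ (low u) (d - {#j#})"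
proof (rule UJ_der[OF low_standard(1)])
  fix z assume z: "z \<in> low u"
  then have "low z \<subseteq> low u" using wless_trans by (auto simp: low_def)
  moreover have "der j (S z) \<in> UJ (low z) (mset z - {#j#})"
    using z der_S_low by (simp add: low_def)
  ultimately show "der j (S z) \<in> UJ (low u) (mset z - {#j#})"
    using UJ_mono[of "low z" "mset z - {#j#}" "low u"] by blast
qed

lemma UJ_low_comm:
  assumes "standard u" "y \<in> UJ (low u) f"
  shows "br (mset u) f (S u) y \<in> UJ (low u) (f + mset u)"
  by (rule bracket_low[OF assms]) (auto simp: low_def intro: wless_extend dest: standard_nonempty)

end

section \<open>Linear independence of the powers of one super-letter\<close>

section \<open>Skew polynomial extensions\<close>

text \<open>The subalgebra generated by \<open>U\<close> and \<open>Y\<close> behaves like an Ore extension of \<open>U\<close>; the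
  instances of interest are \<open>U = UJ (low u)\<close> with \<open>Y = S u\<close> or a power of it.\<close>

locale ore = braiding q for q :: "nat \<Rightarrow> nat \<Rightarrow> 'a::field" +
  fixes U :: "nat multiset \<Rightarrow> 'a nc set" and Y :: "'a nc" and e :: "nat multiset"
  assumes U_subspace: "nc.subspace (U d)"
    and U_H: "x \<in> U d \<Longrightarrow> x \<in> H d"
    and J_U: "x \<in> J \<Longrightarrow> x \<in> H d \<Longrightarrow> x \<in> U d"
    and U_1: "1 \<in> U {#}"
    and U_mult: "x \<in> U d \<Longrightarrow> y \<in> U f \<Longrightarrow> x * y \<in> U (d + f)"
    and U_der: "x \<in> U d \<Longrightarrow> der j x \<in> U (d - {#j#})"
    and Y_H: "Y \<in> H e"
    and e_nonempty: "e \<noteq> {#}"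
    and der_Y: "der j Y \<in> U (e - {#j#})"
    and comm_Y: "y \<in> U f \<Longrightarrow> y * Y - ch f e \<odot> (Y * y) \<in> U (f + e)"
begin

lemmas U_0 = nc.subspace_0[OF U_subspace]
  and U_add = nc.subspace_add[OF U_subspace]
  and U_diff = nc.subspace_diff[OF U_subspace]
  and U_sc = nc.subspace_scale[OF U_subspace]

text \<open>Polynomials in \<open>Y\<close> of degree below \<open>k\<close> with coefficients on
  the right, in total degree \<open>d\<close>. The bound \<open>k\<close> serves to single out
  leading coefficients.\<close>

definition W :: "nat \<Rightarrow> nat multiset \<Rightarrow> 'a nc set"
  where "W k d = nc.span ({Y ^ l * a | l a f. l < k \<and> a \<in> U f \<and> f + repeat_mset l e = d} \<union> (J \<inter> H d))"

lemma W_subspace: "nc.subspace (W k d)"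
  by (simp add: W_def)

lemmas W_0 = nc.subspace_0[OF W_subspace]
  and W_add = nc.subspace_add[OF W_subspace]
  and W_diff = nc.subspace_diff[OF W_subspace]
  and W_sc = nc.subspace_scale[OF W_subspace]

lemma W_gen: "l < k \<Longrightarrow> a \<in> U f \<Longrightarrow> f + repeat_mset l e = d \<Longrightarrow> Y ^ l * a \<in> W k d"
  unfolding W_def by (rule nc.span_base) blast

lemma W_J: "x \<in> J \<Longrightarrow> x \<in> H d \<Longrightarrow> x \<in> W k d"
  unfolding W_def by (rule nc.span_base) blast

lemma W_minimal:
  assumes "nc.subspace T" "\<And>l a f. l < k \<Longrightarrow> a \<in> U f \<Longrightarrow> f + repeat_mset l e = d \<Longrightarrow> Y ^ l * a \<in> T"
    "\<And>x. x \<in> J \<Longrightarrow> x \<in> H d \<Longrightarrow> x \<in> T"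
  shows "W k d \<subseteq> T"
  unfolding W_def by (rule nc.span_minimal[OF _ assms(1)]) (use assms(2,3) in blast)

lemma W_mono: "k \<le> m \<Longrightarrow> W k d \<subseteq> W m d"
  by (rule W_minimal) (auto intro: W_subspace W_gen W_J)

lemma Y_pow_H: "Y ^ k \<in> H (repeat_mset k e)"
  by (induction k) (auto simp: one_in_H intro: H_mult Y_H)

lemma W_H: "W k d \<subseteq> H d"
proof (rule W_minimal)
  fix l a f assume "a \<in> U f" "f + repeat_mset l e = d"
  then show "Y ^ l * a \<in> H d"
    using H_mult[OF Y_pow_H U_H, of a f l] by (simp add: add.commute)
qed (auto simp: H_subspace)

lemma U_W: "x \<in> U d \<Longrightarrow> 0 < k \<Longrightarrow> x \<in> W k d"
  using W_gen[of 0 k x d d] by simp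

lemma W_mult_U:
  assumes "x \<in> W k d" "y \<in> U f"
  shows "x * y \<in> W k (d + f)"
proof -
  have "W k d \<subseteq> {x. x * y \<in> W k (d + f)}"
  proof (rule W_minimal)
    show "nc.subspace {x. x * y \<in> W k (d + f)}"
      by (rule nc.subspaceI) (auto simp: W_0 W_add W_sc distrib_right)
    fix l a f' assume a: "l < k" "a \<in> U f'" "f' + repeat_mset l e = d"
    have "f' + f + repeat_mset l e = d + f" by (simp add: a(3)[symmetric] add_ac)
    then show "Y ^ l * a \<in> {x. x * y \<in> W k (d + f)}"
      using W_gen[OF a(1) U_mult[OF a(2) assms(2)]] by (metis mem_Collect_eq mult.assoc)
  next
    fix x assume "x \<in> J" "x \<in> H d"
    then show "x \<in> {x. x * y \<in> W k (d + f)}"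
      using J_mult[of x d y f] H_mult[of x d y f] U_H assms(2) W_J by blast
  qed
  then show ?thesis using assms(1) by blast
qed

lemma Y_assoc: "Y * (Y ^ l * a) = Y ^ l * (Y * a)"
  by (metis mult.assoc power_commutes)

lemma W_mult_Y:
  assumes "x \<in> W k d"
  shows "x * Y \<in> W (Suc k) (d + e)"
proof -
  have "W k d \<subseteq> {x. x * Y \<in> W (Suc k) (d + e)}"
  proof (rule W_minimal)
    show "nc.subspace {x. x * Y \<in> W (Suc k) (d + e)}"
      by (rule nc.subspaceI) (auto simp: W_0 W_add W_sc distrib_right)
    fix l a f assume a: "l < k" "a \<in> U f" "f + repeat_mset l e = d"
    have "Y ^ l * br e f Y a + ch f e \<odot> (Y ^ Suc l * a) \<in> W (Suc k) (d + e)"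
      using a comm_Y[OF a(2)] by (intro W_add W_sc W_gen) (auto simp: add_ac)
    moreover have "Y ^ l * br e f Y a + ch f e \<odot> (Y ^ Suc l * a) = Y ^ l * a * Y"
      by (simp add: algebra_simps Y_assoc)
    ultimately show "Y ^ l * a \<in> {x. x * Y \<in> W (Suc k) (d + e)}" by simp
  next
    fix x assume "x \<in> J" "x \<in> H d"
    then show "x \<in> {x. x * Y \<in> W (Suc k) (d + e)}"
      using J_mult[of x d Y e] H_mult[of x d Y e] Y_H W_J by blast
  qed
  then show ?thesis using assms by blast
qed

text \<open>Only the top degree in \<open>Y\<close> is tracked. Moving the derivative of
  \<open>Y\<close> past one more factor costs \<open>ch (e - {#j#}) e\<close>; together with the
  twist \<open>ch {#j#} e\<close> this is \<open>ch e e\<close>, which is the recursion of the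
  r-numbers.\<close>

lemma der_Y_pow:
  assumes j: "j \<in># e"
  shows "der j (Y ^ Suc k) - qn (ch e e) (Suc k) \<odot> (Y ^ k * der j Y) \<in> W k (repeat_mset (Suc k) e - {#j#})"
proof (induction k)
  case 0
  then show ?case using W_0 by (simp add: qn_Suc)
next
  case (Suc k)
  define D where "D = der j Y"
  define r where "r = ch e e"
  let ?N = "der j (Y ^ Suc k)" and ?q = "qn r (Suc k)"
  let ?\<omega> = "?N - ?q \<odot> (Y ^ k * D)"
  have e: "e = {#j#} + (e - {#j#})" using j by simp
  have "ch {#j#} e * ch (e - {#j#}) e = r"
    unfolding r_def by (subst (4) e) (rule chim_add_left[symmetric])
  then have r: "ch {#j#} e * ch (e - {#j#}) e = r" .
  have D: "D \<in> U (e - {#j#})" using der_Y by (simp add: D_def)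
  let ?d = "repeat_mset (Suc (Suc k)) e - {#j#}"
  have d: "repeat_mset (Suc k) e - {#j#} + e = ?d" "e - {#j#} + repeat_mset (Suc k) e = ?d"
    "e - {#j#} + e + repeat_mset k e = ?d"
    using j by (simp_all add: add_ac)
  have 1: "?\<omega> * Y \<in> W (Suc k) ?d"
    using W_mult_Y[OF Suc.IH] d(1) by (simp add: D_def r_def)
  have 2: "Y ^ k * br e (e - {#j#}) Y D \<in> W (Suc k) ?d"
    using comm_Y[OF D] d(3) by (intro W_gen) auto
  have "ch {#j#} e \<odot> (?\<omega> * Y) + (ch {#j#} e * ?q) \<odot> (Y ^ k * br e (e - {#j#}) Y D) \<in> W (Suc k) ?d"
    using 1 2 by (intro W_add W_sc)
  also have "ch {#j#} e \<odot> (?\<omega> * Y) + (ch {#j#} e * ?q) \<odot> (Y ^ k * br e (e - {#j#}) Y D)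
     = ch {#j#} e \<odot> (?N * Y) - ((ch {#j#} e * ch (e - {#j#}) e) * ?q) \<odot> (Y ^ Suc k * D)"
    by (simp add: algebra_simps Y_assoc)
  also have "\<dots> = der j (Y ^ Suc (Suc k)) - qn r (Suc (Suc k)) \<odot> (Y ^ Suc k * D)"
    unfolding r power_Suc2[of Y "Suc k"] der_mult_H[OF Y_H] qn_Suc[of r "Suc k"]
    by (simp add: D_def algebra_simps)
  finally show ?case by (simp add: D_def r_def)
qed

lemma der_Y_pow_0: "j \<notin># e \<Longrightarrow> der j (Y ^ k) = 0"
  by (rule der_eq_0[OF Y_pow_H]) (metis count_repeat_mset mult_0_right not_in_iff)

lemma der_Y_pow_W:
  assumes "j \<in># e"
  shows "der j (Y ^ k) \<in> W k (repeat_mset k e - {#j#})"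
proof (cases k)
  case (Suc m)
  have d: "e - {#j#} + repeat_mset m e = repeat_mset (Suc m) e - {#j#}"
    using assms by (simp add: add_ac)
  have "(der j (Y ^ Suc m) - qn (ch e e) (Suc m) \<odot> (Y ^ m * der j Y)) + qn (ch e e) (Suc m) \<odot> (Y ^ m * der j Y)
      \<in> W (Suc m) (repeat_mset (Suc m) e - {#j#})"
  proof (rule W_add[OF _ W_sc])
    show "der j (Y ^ Suc m) - qn (ch e e) (Suc m) \<odot> (Y ^ m * der j Y) \<in> W (Suc m) (repeat_mset (Suc m) e - {#j#})"
      using der_Y_pow[OF assms, of m] W_mono[OF le_SucI[OF order_refl]] by blast
    show "Y ^ m * der j Y \<in> W (Suc m) (repeat_mset (Suc m) e - {#j#})"
      by (rule W_gen[OF lessI der_Y d])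
  qed
  then show ?thesis by (simp add: Suc)
qed (simp add: W_0)

lemma W_der:
  assumes "x \<in> W k d"
  shows "der j x \<in> W k (d - {#j#})"
proof -
  have "W k d \<subseteq> {x. der j x \<in> W k (d - {#j#})}"
  proof (rule W_minimal)
    show "nc.subspace {x. der j x \<in> W k (d - {#j#})}"
      by (rule nc.subspaceI) (auto simp: W_0 W_add W_sc der_add der_sc)
    fix l a f assume a: "l < k" "a \<in> U f" "f + repeat_mset l e = d"
    have "Y ^ l * der j a \<in> W k (d - {#j#})"
    proof (cases "j \<in># f")
      case True
      then have "f - {#j#} + repeat_mset l e = d - {#j#}" using a(3) by auto
      then show ?thesis using a U_der by (intro W_gen) auto
    qed (use der_eq_0[OF U_H[OF a(2)]] W_0 in simp)
    moreover have "der j (Y ^ l) * a \<in> W k (d - {#j#})"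
    proof (cases "j \<in># e \<and> l \<noteq> 0")
      case True
      then have "repeat_mset l e - {#j#} + f = d - {#j#}"
        using a(3) by (cases l) (auto simp: add_ac)
      moreover have "der j (Y ^ l) * a \<in> W l (repeat_mset l e - {#j#} + f)"
        using True der_Y_pow_W a(2) by (intro W_mult_U) auto
      ultimately show ?thesis using W_mono[of l k] a(1) by auto
    next
      case False
      then have "der j (Y ^ l) = 0" using der_Y_pow_0 by (cases "l = 0") auto
      then show ?thesis using W_0 by simp
    qed
    ultimately show "Y ^ l * a \<in> {x. der j x \<in> W k (d - {#j#})}"
      by (simp add: der_mult_H[OF U_H[OF a(2)]] W_add W_sc)
  next
    fix x assume "x \<in> J" "x \<in> H d"
    then show "x \<in> {x. der j x \<in> W k (d - {#j#})}"
      using der_in_J der_H W_J by blast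
  qed
  then show ?thesis using assms by blast
qed

text \<open>The total degree determines the degree \<open>f\<close> of the top coefficient by
  cancellation, so the coefficients of all generators with the top power add up within one
  \<open>U f\<close>.\<close>

lemma W_Suc_cases:
  assumes "x \<in> W (Suc k) d" "f + repeat_mset k e = d"
  obtains a where "a \<in> U f" "x - Y ^ k * a \<in> W k d"
proof -
  have "W (Suc k) d \<subseteq> {x. \<exists>a\<in>U f. x - Y ^ k * a \<in> W k d}"
  proof (rule W_minimal)
    show "nc.subspace {x. \<exists>a\<in>U f. x - Y ^ k * a \<in> W k d}"
    proof (rule nc.subspaceI; safe)
      show "\<exists>a\<in>U f. 0 - Y ^ k * a \<in> W k d"
        by (rule bexI[of _ 0]) (auto simp: U_0 W_0)
      fix x y a b assume *: "a \<in> U f" "x - Y ^ k * a \<in> W k d" "b \<in> U f" "y - Y ^ k * b \<in> W k d"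
      have "(x - Y ^ k * a) + (y - Y ^ k * b) \<in> W k d" using * by (intro W_add)
      then show "\<exists>a\<in>U f. x + y - Y ^ k * a \<in> W k d"
        by (intro bexI[of _ "a + b"]) (auto simp: algebra_simps U_add *)
    next
      fix c x a assume *: "a \<in> U f" "x - Y ^ k * a \<in> W k d"
      have "c \<odot> (x - Y ^ k * a) \<in> W k d" using * by (intro W_sc)
      then show "\<exists>a\<in>U f. c \<odot> x - Y ^ k * a \<in> W k d"
        by (intro bexI[of _ "c \<odot> a"]) (auto simp: algebra_simps U_sc *)
    qed
    fix l a f' assume a: "l < Suc k" "a \<in> U f'" "f' + repeat_mset l e = d"
    show "Y ^ l * a \<in> {x. \<exists>a\<in>U f. x - Y ^ k * a \<in> W k d}"
    proof (cases "l = k")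
      case True
      then have "f' = f" using a(3) assms(2) by auto
      then show ?thesis using True a W_0 by force
    next
      case False
      then have "Y ^ l * a - Y ^ k * 0 \<in> W k d" using W_gen[of l k] a by simp
      then show ?thesis using U_0 by blast
    qed
  next
    fix x assume "x \<in> J" "x \<in> H d"
    then have "x - Y ^ k * 0 \<in> W k d" using W_J by simp
    then show "x \<in> {x. \<exists>a\<in>U f. x - Y ^ k * a \<in> W k d}" using U_0 by blast
  qed
  then show ?thesis using assms(1) that by blast
qed

text \<open>Applying the derivations to a relation of minimal degree, its leading coefficient becomes a
  scalar, and the next coefficient \<open>a'\<close> satisfies \<open>\<partial>\<^sub>j(c (m)\<^sub>r Y + a') = 0\<close> for all \<open>j\<close>.\<close>

lemma leading_coeff_in_J:
  assumes "Y \<notin> U e" "\<And>k. 0 < k \<Longrightarrow> k \<le> m \<Longrightarrow> qn (ch e e) k \<noteq> 0"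
    and "a \<in> U f" "x \<in> W m d" "f + repeat_mset m e = d" "Y ^ m * a + x \<in> J"
  shows "a \<in> J"
  using assms(2-)
proof (induction "size d" arbitrary: d m a f x rule: less_induct)
  case less
  show ?case
  proof (cases m)
    case 0
    then have "W m d \<subseteq> J"
      by (intro W_minimal) (auto simp: J_subspace)
    then have "x \<in> J" using less.prems(3) by blast
    then have "(Y ^ m * a + x) - x \<in> J"
      using less.prems(5) J_diff by blast
    then show ?thesis using 0 by simp
  next
    case (Suc k)
    have aH: "a \<in> H f" using U_H less.prems(2) .
    have relation: "Y ^ m * der j a + (ch {#j#} f \<odot> (der j (Y ^ m) * a) + der j x) \<in> J" for j
      using der_in_J[OF less.prems(5), of j] by (simp add: der_add der_mult_H[OF aH] add.assoc)
    have low: "der j (Y ^ l) * a \<in> W l (f + repeat_mset l e - {#j#})" if a: "a \<in> U f" "l \<noteq> 0" for j l a f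
    proof (cases "j \<in># e")
      case True
      then have "repeat_mset l e - {#j#} + f = f + repeat_mset l e - {#j#}"
        using a(2) by (cases l) (auto simp: add_ac)
      then show ?thesis using W_mult_U[OF der_Y_pow_W[OF True] a(1)] by metis
    qed (simp add: der_Y_pow_0 W_0)
    show ?thesis
    proof (cases "f = {#}")
      case False
      show ?thesis
      proof (rule in_JI[OF aH False])
        fix j assume j: "j \<in># f"
        show "der j a \<in> J"
        proof (rule less.hyps[of "d - {#j#}" m, OF _ less.prems(1) U_der[OF less.prems(2)] _ _ relation])
          show "size (d - {#j#}) < size d"
            using j unfolding less.prems(4)[symmetric] by (intro size_Diff1_less) simp
          show "f - {#j#} + repeat_mset m e = d - {#j#}"
            using j unfolding less.prems(4)[symmetric] by simp
          show "ch {#j#} f \<odot> (der j (Y ^ m) * a) + der j x \<in> W m (d - {#j#})"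
          proof (intro W_add W_sc)
            have "m \<noteq> 0" using Suc by simp
            from low[OF less.prems(2) this, of j] show "der j (Y ^ m) * a \<in> W m (d - {#j#})"
              unfolding less.prems(4) .
          qed (rule W_der[OF less.prems(3)])
        qed
      qed
    next
      case f0: True
      define c where "c = coef a []"
      have a: "a = c \<odot> 1" unfolding c_def using H_empty[of a] aH unfolding f0 by blast
      show ?thesis
      proof (cases "c = 0")
        case True
        then show ?thesis unfolding a by simp
      next
        case c: False
        have d: "d = e + repeat_mset k e" using less.prems(4) f0 Suc by simp
        obtain a' where a': "a' \<in> U e" "x - Y ^ k * a' \<in> W k d"
          by (rule W_Suc_cases[OF less.prems(3)[unfolded Suc] d[symmetric]])
        define x' where "x' = x - Y ^ k * a'"
        define s where "s = qn (ch e e) m"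
        have s: "s \<noteq> 0" using less.prems(1)[of m] Suc by (simp add: s_def)
        let ?Z = "(c * s) \<odot> Y + a'"
        have "?Z \<in> J"
        proof (rule in_JI[OF _ e_nonempty])
          show "?Z \<in> H e"
            using Y_H U_H[OF a'(1)] by (intro H_add H_sc)
          fix j assume j: "j \<in># e"
          have dj: "e - {#j#} + repeat_mset k e = d - {#j#}" unfolding d using j by simp
          let ?y = "c \<odot> (der j (Y ^ m) - s \<odot> (Y ^ k * der j Y)) + ch {#j#} e \<odot> (der j (Y ^ k) * a') + der j x'"
          show "der j ?Z \<in> J"
          \<comment> \<open>As the leading coefficient is scalar, the differentiated relation has
            \<open>Y\<close>-degree at most \<open>k\<close> and smaller total degree. Its
            coefficient at the k-th power is the derivative of \<open>?Z\<close>.\<close>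
          proof (rule less.hyps[OF _ _ _ _ dj])
            show "size (d - {#j#}) < size d"
              using j unfolding d by (intro size_Diff1_less) simp
            show "qn (ch e e) l \<noteq> 0" if "0 < l" "l \<le> k" for l
              using less.prems(1) that Suc by simp
            show "der j ?Z \<in> U (e - {#j#})"
              unfolding der_add der_sc using der_Y U_der[OF a'(1)] by (intro U_add U_sc)
            show "?y \<in> W k (d - {#j#})"
            proof (intro W_add W_sc)
              show "der j (Y ^ m) - s \<odot> (Y ^ k * der j Y) \<in> W k (d - {#j#})"
                using der_Y_pow[OF j, of k] unfolding s_def Suc d by simp
              show "der j (Y ^ k) * a' \<in> W k (d - {#j#})"
                unfolding d using low[OF a'(1), of k j] W_0 by (cases "k = 0") simp_all
              show "der j x' \<in> W k (d - {#j#})"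
                unfolding x'_def by (rule W_der[OF a'(2)])
            qed
            have "Y ^ m * a + x = c \<odot> Y ^ m + (Y ^ k * a' + x')"
              by (simp add: a x'_def)
            then have "der j (Y ^ m * a + x) = c \<odot> der j (Y ^ m) + (Y ^ k * der j a' + ch {#j#} e \<odot> (der j (Y ^ k) * a') + der j x')"
              by (simp add: der_add der_sc der_mult_H[OF U_H[OF a'(1)]])
            also have "\<dots> = Y ^ k * der j ?Z + ?y"
              by (simp add: der_add der_sc algebra_simps)
            finally show "Y ^ k * der j ?Z + ?y \<in> J"
              using der_in_J[OF less.prems(5), of j] by metis
          qed
        qed
        then have "?Z \<in> U e"
          using J_U Y_H U_H[OF a'(1)] H_add H_sc by blast
        then have "?Z - a' \<in> U e" using a'(1) by (rule U_diff)
        then have "(c * s) \<odot> Y \<in> U e" by simp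
        then have "Y \<in> U e" using subspace_sc_cancel[OF U_subspace] c s by (metis mult_eq_0_iff)
        then show ?thesis using assms(1) by blast
      qed
    qed
  qed
qed

lemma powers_indep:
  assumes "Y \<notin> U e" "finite K" "\<And>k l. l \<in> K \<Longrightarrow> 0 < k \<Longrightarrow> k \<le> l \<Longrightarrow> qn (ch e e) k \<noteq> 0"
    and "\<And>k. k \<in> K \<Longrightarrow> a k \<in> U (f k) \<and> f k + repeat_mset k e = d"
    and "(\<Sum>k\<in>K. Y ^ k * a k) \<in> J" "k \<in> K"
  shows "a k \<in> J"
  using assms(2-)
proof (induction "card K" arbitrary: K)
  case (Suc n)
  define m where "m = Max K"
  have m: "m \<in> K" "\<And>l. l \<in> K \<Longrightarrow> l \<le> m"
    using Max_in[of K] Max_ge[of K] Suc.prems(1,5) unfolding m_def by blast+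
  have sum: "(\<Sum>k\<in>K. Y ^ k * a k) = Y ^ m * a m + (\<Sum>k\<in>K - {m}. Y ^ k * a k)"
    using Suc.prems(1) m(1) by (rule sum.remove)
  have "(\<Sum>k\<in>K - {m}. Y ^ k * a k) \<in> W m d"
  proof (rule nc.subspace_sum[OF W_subspace])
    fix l assume "l \<in> K - {m}"
    then show "Y ^ l * a l \<in> W m d"
      using Suc.prems(3)[of l] m(2)[of l] by (intro W_gen[of l m "a l" "f l"]) auto
  qed
  then have am: "a m \<in> J"
    using leading_coeff_in_J[OF assms(1), of m "a m" "f m" _ d] Suc.prems m sum by metis
  then have "Y ^ m * a m \<in> J"
    using J_mult[OF Y_pow_H[of m] U_H] Suc.prems(3)[OF m(1)] by blast
  then have rest: "(\<Sum>k\<in>K - {m}. Y ^ k * a k) \<in> J"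
    using Suc.prems(4) J_diff unfolding sum by fastforce
  show ?case
  proof (cases "k = m")
    case False
    have "n = card (K - {m})" using Suc.hyps(2) Suc.prems(1) m(1) by simp
    then show ?thesis
      using Suc.hyps(1)[of "K - {m}"] Suc.prems rest False by auto
  qed (use am in simp)
qed simp

end

section \<open>Powers at roots of unity\<close>

text \<open>The Gaussian binomial coefficient with parameter \<open>r\<close>, given by a Pascal
  recursion.\<close>

primrec qb :: "'a::field \<Rightarrow> nat \<Rightarrow> nat \<Rightarrow> 'a" where
  "qb r 0 k = (if k = 0 then 1 else 0)"
| "qb r (Suc m) k = r ^ k * qb r m k + (if k = 0 then 0 else qb r m (k - 1))"

lemma qb_0 [simp]: "qb r m 0 = 1"
  by (induction m) auto

lemma qb_Suc_Suc: "qb r (Suc m) (Suc k) = r ^ Suc k * qb r m (Suc k) + qb r m k"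
  by simp

lemma qb_eq_0: "m < k \<Longrightarrow> qb r m k = 0"
  by (induction m arbitrary: k) auto

declare qb.simps(2) [simp del]

lemma qb_absorb: "qn r (Suc k) * qb r (Suc m) (Suc k) = qn r (Suc m) * qb r m k"
proof (induction m arbitrary: k)
  case 0
  then show ?case by (cases k) (simp_all add: qb_Suc_Suc qn_Suc)
next
  case (Suc m)
  have "qn r (Suc k) * qb r (Suc (Suc m)) (Suc k) =
      r ^ Suc k * (qn r (Suc k) * qb r (Suc m) (Suc k)) + qn r (Suc k) * qb r (Suc m) k"
    unfolding qb_Suc_Suc[of r "Suc m" k] by (simp add: algebra_simps)
  also have "\<dots> = r ^ Suc k * (qn r (Suc m) * qb r m k) + qb r (Suc m) k + r * (qn r k * qb r (Suc m) k)"
    unfolding Suc.IH unfolding qn_Suc[of r k] by (simp add: algebra_simps)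
  also have "\<dots> = qn r (Suc (Suc m)) * qb r (Suc m) k"
  proof (cases k)
    case 0
    then show ?thesis by (simp add: qn_Suc[of r "Suc m"])
  next
    case (Suc l)
    have "qn r k * qb r (Suc m) k = qn r (Suc m) * qb r m l"
      unfolding Suc by (rule Suc.IH)
    moreover have "qb r (Suc m) k = r ^ k * qb r m k + qb r m l"
      unfolding Suc by (rule qb_Suc_Suc)
    ultimately have "r ^ Suc k * (qn r (Suc m) * qb r m k) + qb r (Suc m) k + r * (qn r k * qb r (Suc m) k)
        = qb r (Suc m) k + r * qn r (Suc m) * (r ^ k * qb r m k + qb r m l)"
      by (simp add: algebra_simps)
    also have "\<dots> = qn r (Suc (Suc m)) * qb r (Suc m) k"
      unfolding \<open>qb r (Suc m) k = r ^ k * qb r m k + qb r m l\<close>[symmetric] qn_Suc[of r "Suc m"]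
      by (simp add: algebra_simps)
    finally show ?thesis .
  qed
  finally show ?case .
qed

lemma qn_mult: "(r - 1) * qn r k = r ^ k - 1"
  by (simp add: qn_def power_diff_1_eq)

lemma qn_0_power: "qn r k = 0 \<Longrightarrow> r ^ k = 1"
  using qn_mult[of r k] by simp

lemma primitive_root_qn:
  assumes "primitive_root r t" "0 < k" "k < t"
  shows "qn r k \<noteq> 0"
  using assms qn_0_power unfolding primitive_root_def by blast

lemma primitive_root_ne_1:
  assumes "primitive_root r t" "2 \<le> t"
  shows "r \<noteq> 1"
proof
  assume "r = 1"
  then have "r ^ 1 = 1" by simp
  then show False using assms unfolding primitive_root_def by (metis One_nat_def Suc_1 Suc_le_eq zero_less_one)
qed

text \<open>By absorption, (k)_r times this binomial is a multiple of (t)_r = 0, whereas (k)_r is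
  nonzero.\<close>

lemma primitive_root_qb:
  assumes "primitive_root r t" "0 < k" "k < t"
  shows "qb r t k = 0"
proof -
  obtain k' t' where kt: "k = Suc k'" "t = Suc t'" using assms(2,3) by (cases k; cases t) auto
  have "2 \<le> t" using assms by auto
  then have "qn r t = 0"
    using qn_eq_0[of r t] primitive_root_ne_1[OF assms(1)] assms(1) by (auto simp: primitive_root_def)
  then have "qn r k * qb r t k = 0"
    unfolding kt qb_absorb by simp
  then show ?thesis using primitive_root_qn[OF assms] by simp
qed

lemma primitive_root_unique:
  "primitive_root r t \<Longrightarrow> primitive_root r s \<Longrightarrow> s = t"
  unfolding primitive_root_def by (meson linorder_neqE_nat)

lemma chim_repeat_left: "chim q (repeat_mset k d) e = chim q d e ^ k"
  by (induction k) (simp_all add: chim_add_left)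

lemma chim_repeat_right: "chim q d (repeat_mset k e) = chim q d e ^ k"
  by (induction k) (simp_all add: chim_add_right)

context ore
begin

text \<open>The iterated skew commutator of \<open>y\<close> with \<open>Y\<close>. The scalar is
  \<open>ch\<close> of the current degree \<open>f + repeat_mset k e\<close> against
  \<open>e\<close>.\<close>

primrec dl :: "nat \<Rightarrow> nat multiset \<Rightarrow> 'a nc \<Rightarrow> 'a nc" where
  "dl 0 f y = y"
| "dl (Suc k) f y = dl k f y * Y - (ch f e * ch e e ^ k) \<odot> (Y * dl k f y)"

lemma dl_U: "y \<in> U f \<Longrightarrow> dl k f y \<in> U (f + repeat_mset k e)"
proof (induction k)
  case (Suc k)
  have "ch (f + repeat_mset k e) e = ch f e * ch e e ^ k"
    by (simp add: chim_add_left chim_repeat_left)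
  then show ?case
    using comm_Y[OF Suc.IH[OF Suc.prems]] by (simp add: add_ac)
qed simp

lemma dl_mult_Y: "dl k f y * Y = dl (Suc k) f y + (ch f e * ch e e ^ k) \<odot> (Y * dl k f y)"
  by simp

text \<open>A Gaussian binomial formula: each factor \<open>Y\<close> is either passed to the left
  or absorbed in a commutator, and each earlier commutator contributes a factor
  \<open>ch e e\<close> to later exchanges.\<close>

lemma mult_Y_pow:
  "y * Y ^ m = (\<Sum>k\<le>m. (qb (ch e e) m k * ch f e ^ (m - k)) \<odot> (Y ^ (m - k) * dl k f y))"
proof (induction m)
  case (Suc m)
  define r c where "r = ch e e" and "c = ch f e"
  define g where "g k = (qb r m k * c ^ (Suc m - k) * r ^ k) \<odot> (Y ^ (Suc m - k) * dl k f y)" for k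
  define h where "h k = (qb r m k * c ^ (m - k)) \<odot> (Y ^ (m - k) * dl (Suc k) f y)" for k
  have "y * Y ^ Suc m = (\<Sum>k\<le>m. (qb r m k * c ^ (m - k)) \<odot> (Y ^ (m - k) * dl k f y)) * Y"
    unfolding power_Suc2 mult.assoc[symmetric] Suc.IH r_def c_def ..
  also have "\<dots> = (\<Sum>k\<le>m. h k + g k)"
    unfolding sum_distrib_right
  proof (rule sum.cong[OF refl])
    fix k assume "k \<in> {..m}"
    then have k: "Suc m - k = Suc (m - k)" by (simp add: Suc_diff_le)
    have "Y ^ (m - k) * dl k f y * Y = Y ^ (m - k) * dl (Suc k) f y + (c * r ^ k) \<odot> (Y ^ Suc (m - k) * dl k f y)"
      unfolding mult.assoc dl_mult_Y distrib_left by (simp add: r_def c_def Y_assoc mult.assoc)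
    then show "(qb r m k * c ^ (m - k)) \<odot> (Y ^ (m - k) * dl k f y) * Y = h k + g k"
      by (simp add: h_def g_def k nc.scale_right_distrib mult_ac)
  qed
  also have "\<dots> = (\<Sum>k\<le>m. h k) + (\<Sum>k\<le>Suc m. g k)"
    by (simp add: sum.distrib g_def qb_eq_0)
  also have "\<dots> = g 0 + (\<Sum>k\<le>m. h k + g (Suc k))"
    by (simp only: sum.atMost_Suc_shift sum.distrib add_ac)
  also have "\<dots> = (\<Sum>k\<le>Suc m. (qb r (Suc m) k * c ^ (Suc m - k)) \<odot> (Y ^ (Suc m - k) * dl k f y))"
    unfolding sum.atMost_Suc_shift[of _ m]
  proof (intro arg_cong2[of _ _ _ _ "(+)"] sum.cong[OF refl])
    show "g 0 = (qb r (Suc m) 0 * c ^ (Suc m - 0)) \<odot> (Y ^ (Suc m - 0) * dl 0 f y)"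
      by (simp add: g_def)
    fix k
    show "h k + g (Suc k) = (qb r (Suc m) (Suc k) * c ^ (Suc m - Suc k)) \<odot> (Y ^ (Suc m - Suc k) * dl (Suc k) f y)"
      unfolding h_def g_def qb_Suc_Suc diff_Suc_Suc nc.scale_left_distrib[symmetric]
      by (simp add: algebra_simps del: dl.simps)
  qed
  finally show ?case unfolding r_def c_def .
qed simp

text \<open>Differentiating one factor leaves powers of \<open>Y\<close> to its right. Collecting
  them on the left produces iterated commutators of the derivative of \<open>Y\<close>, again with
  Gaussian binomials.\<close>

lemma der_Y_pow_expand:
  assumes "j \<in># e"
  shows "der j (Y ^ m) = (\<Sum>k<m. (qb (ch e e) m (Suc k) * ch {#j#} e ^ k) \<odot> (Y ^ (m - Suc k) * dl k (e - {#j#}) (der j Y)))"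
proof (induction m)
  case (Suc m)
  define r s c D where "r = ch e e" and "s = ch {#j#} e" and "c = ch (e - {#j#}) e" and "D = der j Y"
  define f where "f = e - {#j#}"
  have "e = {#j#} + f" using assms by (simp add: f_def)
  then have r: "r = s * c"
    using chim_add_left[of q "{#j#}" f e] by (simp add: r_def s_def c_def f_def)
  define g where "g k = (r ^ Suc k * qb r m (Suc k) * s ^ k) \<odot> (Y ^ (m - k) * dl k f D)" for k
  define h where "h k = (qb r m k * s ^ k) \<odot> (Y ^ (m - k) * dl k f D)" for k
  have "der j (Y ^ Suc m) = Y ^ m * D + s \<odot> (der j (Y ^ m) * Y)"
    unfolding power_Suc2 der_mult_H[OF Y_H] s_def D_def ..
  also have "s \<odot> (der j (Y ^ m) * Y) = (\<Sum>k<m. h (Suc k) + g k)"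
    unfolding Suc.IH sum_distrib_right nc.scale_sum_right
  proof (rule sum.cong[OF refl])
    fix k assume "k \<in> {..<m}"
    then have k: "m - k = Suc (m - Suc k)" by simp
    have "Y ^ (m - Suc k) * dl k f D * Y = Y ^ (m - Suc k) * dl (Suc k) f D + (c * r ^ k) \<odot> (Y ^ (m - k) * dl k f D)"
      unfolding mult.assoc dl_mult_Y distrib_left k by (simp add: r_def c_def f_def Y_assoc mult.assoc)
    then have "s \<odot> ((qb r m (Suc k) * s ^ k) \<odot> (Y ^ (m - Suc k) * dl k f D) * Y) = h (Suc k) + g k"
      by (simp add: h_def g_def nc.scale_right_distrib mult_ac r del: dl.simps)
    then show "s \<odot> ((qb (ch e e) m (Suc k) * ch {#j#} e ^ k) \<odot> (Y ^ (m - Suc k) * dl k (e - {#j#}) (der j Y)) * Y) = h (Suc k) + g k"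
      unfolding r_def s_def f_def D_def .
  qed
  also have "Y ^ m * D + (\<Sum>k<m. h (Suc k) + g k) = (\<Sum>k<Suc m. h k) + (\<Sum>k<m. g k)"
    unfolding sum.lessThan_Suc_shift[of h] by (simp add: sum.distrib h_def)
  also have "(\<Sum>k<m. g k) = (\<Sum>k<Suc m. g k)"
    by (simp add: g_def qb_eq_0)
  also have "(\<Sum>k<Suc m. h k) + (\<Sum>k<Suc m. g k) = (\<Sum>k<Suc m. (qb r (Suc m) (Suc k) * s ^ k) \<odot> (Y ^ (Suc m - Suc k) * dl k f D))"
    unfolding sum.distrib[symmetric] qb_Suc_Suc h_def g_def diff_Suc_Suc
    by (intro sum.cong refl) (simp only: nc.scale_left_distrib[symmetric] distrib_right add_ac)
  finally show ?case unfolding r_def s_def f_def D_def .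
qed simp

text \<open>The intermediate binomials vanish, so only the complete exchange and the t-fold
  commutator survive.\<close>

lemma comm_Y_root:
  assumes "\<And>k. 0 < k \<Longrightarrow> k < t \<Longrightarrow> qb (ch e e) t k = 0" "0 < t" "y \<in> U f"
  shows "br (repeat_mset t e) f (Y ^ t) y \<in> U (f + repeat_mset t e)"
proof -
  have "y * Y ^ t = (\<Sum>k\<in>{0, t}. (qb (ch e e) t k * ch f e ^ (t - k)) \<odot> (Y ^ (t - k) * dl k f y))"
    unfolding mult_Y_pow[of y t f]
    by (rule sum.mono_neutral_right) (use assms(1) in \<open>auto simp: nat_neq_iff\<close>)
  then have "br (repeat_mset t e) f (Y ^ t) y = qb (ch e e) t t \<odot> dl t f y"
    using assms(2) by (simp add: chim_repeat_right)
  then show ?thesis using dl_U[OF assms(3)] U_sc by simp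
qed

lemma der_Y_root:
  assumes "\<And>k. 0 < k \<Longrightarrow> k < t \<Longrightarrow> qb (ch e e) t k = 0" "0 < t"
  shows "der j (Y ^ t) \<in> U (repeat_mset t e - {#j#})"
proof (cases "j \<in># e")
  case True
  obtain m where t: "t = Suc m" using assms(2) by (cases t) auto
  let ?f = "\<lambda>k. (qb (ch e e) t (Suc k) * ch {#j#} e ^ k) \<odot> (Y ^ (t - Suc k) * dl k (e - {#j#}) (der j Y))"
  have "der j (Y ^ t) = sum ?f {m}"
    unfolding der_Y_pow_expand[OF True]
    by (rule sum.mono_neutral_right) (use assms(1) in \<open>auto simp: t\<close>)
  also have "\<dots> \<in> U (e - {#j#} + repeat_mset m e)"
    using dl_U[OF der_Y[of j], of m] U_sc by (simp add: t)
  also have "e - {#j#} + repeat_mset m e = repeat_mset t e - {#j#}"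
    using True by (simp add: t)
  finally show ?thesis .
qed (simp add: der_Y_pow_0 U_0)

text \<open>Exponents are divided by \<open>t\<close> with remainder. The relation is read first in
  powers of \<open>Y\<close> below \<open>t\<close> over \<open>V\<close>, and then each coefficient
  \<open>b s\<close> is read in powers of \<open>x\<close> over \<open>U\<close>.\<close>

lemma powers_indep_root:
  assumes Y: "Y \<notin> U e" and t: "primitive_root (ch e e) t" "2 \<le> t" and X: "Y ^ t \<notin> U (repeat_mset t e)"
    and char0: "\<And>k. 0 < k \<Longrightarrow> qn (1 :: 'a) k \<noteq> 0"
    and K: "finite K" "\<And>k. k \<in> K \<Longrightarrow> a k \<in> U (f k) \<and> f k + repeat_mset k e = d"
    and sum: "(\<Sum>k\<in>K. Y ^ k * a k) \<in> J" and k: "k \<in> K"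
  shows "a k \<in> J"
proof -
  define r where "r = ch e e"
  define x where "x = Y ^ t"
  define e' where "e' = repeat_mset t e"
  have rt: "r ^ t = 1" using t(1) by (simp add: primitive_root_def r_def)
  have qb: "\<And>k. 0 < k \<Longrightarrow> k < t \<Longrightarrow> qb (ch e e) t k = 0"
    using primitive_root_qb[OF t(1)] .
  have t0: "0 < t" using t(2) by simp
  interpret x: ore q U x e'
  proof
    show "x \<in> H e'" unfolding x_def e'_def by (rule Y_pow_H)
    have "size e' \<noteq> 0" using e_nonempty t0 by (simp add: e'_def)
    then show "e' \<noteq> {#}" by auto
    show "der j x \<in> U (e' - {#j#})" for j
      unfolding x_def e'_def by (rule der_Y_root[OF qb t0])
    show "br e' f x y \<in> U (f + e')" if "y \<in> U f" for y f
      unfolding x_def e'_def by (rule comm_Y_root[OF qb t0 that])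
  qed (fact U_subspace U_H J_U U_1 U_mult U_der)+
  define V where "V d = {y. \<exists>k. y \<in> x.W k d}" for d
  have VI: "y \<in> x.W k d \<Longrightarrow> y \<in> V d" for y k d by (auto simp: V_def)
  have common: "\<exists>k. y \<in> x.W k d \<and> z \<in> x.W k d'" if "y \<in> V d" "z \<in> V d'" for y z d d'
  proof -
    obtain k l where "y \<in> x.W k d" "z \<in> x.W l d'" using \<open>y \<in> V d\<close> \<open>z \<in> V d'\<close> by (auto simp: V_def)
    then have "y \<in> x.W (max k l) d" "z \<in> x.W (max k l) d'"
      using x.W_mono[of k "max k l"] x.W_mono[of l "max k l"] by auto
    then show ?thesis by blast
  qed
  have V_sub: "nc.subspace (V d)" for d
  proof (rule nc.subspaceI)
    show "0 \<in> V d" using x.W_0 VI by blast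
    show "y + z \<in> V d" if "y \<in> V d" "z \<in> V d" for y z
      using common[OF that] x.W_add VI by blast
    show "c \<odot> y \<in> V d" if "y \<in> V d" for c y
      using that x.W_sc unfolding V_def by blast
  qed
  have V_mult: "y * z \<in> V (d + d')" if yz: "y \<in> V d" "z \<in> V d'" for y z d d'
  proof -
    obtain k l where k: "y \<in> x.W k d" and l: "z \<in> x.W l d'" using yz by (auto simp: V_def)
    have pow: "y * x ^ m \<in> x.W (k + m) (d + repeat_mset m e')" for m
    proof (induction m)
      case (Suc m)
      show ?case using x.W_mult_Y[OF Suc.IH] by (simp add: power_Suc2 mult.assoc add_ac del: power_Suc)
    qed (use k in simp)
    have "x.W l d' \<subseteq> {z. y * z \<in> V (d + d')}"
    proof (rule x.W_minimal)
      show "nc.subspace {z. y * z \<in> V (d + d')}"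
        by (rule nc.subspaceI)
          (auto simp: distrib_left intro: nc.subspace_0[OF V_sub] nc.subspace_add[OF V_sub] nc.subspace_scale[OF V_sub])
      fix m b g assume "b \<in> U g" "g + repeat_mset m e' = d'"
      then have "y * x ^ m * b \<in> x.W (k + m) (d + d')"
        using x.W_mult_U[OF pow] by (metis add.assoc add.commute)
      then show "x ^ m * b \<in> {z. y * z \<in> V (d + d')}" using VI by (simp add: mult.assoc)
    next
      fix z assume "z \<in> J" "z \<in> H d'"
      moreover have "y \<in> H d" using x.W_H k by blast
      ultimately have "y * z \<in> x.W 0 (d + d')"
        using J_mult H_mult by (intro x.W_J) blast+
      then show "z \<in> {z. y * z \<in> V (d + d')}" using VI by simp
    qed
    then show ?thesis using l by blast
  qed
  \<comment> \<open>Adjoining \<open>x\<close> keeps the coefficients normalized by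
    \<open>Y\<close>, because \<open>x\<close> commutes with \<open>Y\<close> and its scalar against
    \<open>e\<close> is a power of r^t = 1.\<close>
  interpret v: ore q V Y e
  proof
    show "y \<in> H d" if "y \<in> V d" for y d using that x.W_H by (auto simp: V_def)
    show "y \<in> V d" if "y \<in> J" "y \<in> H d" for y d using that x.W_J VI by blast
    have UV: "y \<in> V d" if "y \<in> U d" for y d using x.U_W[OF that, of 1] VI by auto
    show "1 \<in> V {#}" using UV U_1 .
    show "der j y \<in> V (d - {#j#})" if "y \<in> V d" for j y d
      using that x.W_der unfolding V_def by blast
    show "der j Y \<in> V (e - {#j#})" for j using UV der_Y .
    show "br e g Y y \<in> V (g + e)" if "y \<in> V g" for y g
    proof -
      obtain k where k: "y \<in> x.W k g" using \<open>y \<in> V g\<close> by (auto simp: V_def)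
      have "x.W k g \<subseteq> {y. y * Y - ch g e \<odot> (Y * y) \<in> x.W k (g + e)}"
      proof (rule x.W_minimal)
        show "nc.subspace {y. y * Y - ch g e \<odot> (Y * y) \<in> x.W k (g + e)}"
        proof (rule nc.subspaceI; safe)
          show "br e g Y 0 \<in> x.W k (g + e)" using x.W_0 by simp
          fix y z assume "br e g Y y \<in> x.W k (g + e)" "br e g Y z \<in> x.W k (g + e)"
          then have "(br e g Y y) + br e g Y z \<in> x.W k (g + e)"
            by (rule x.W_add)
          then show "br e g Y (y + z) \<in> x.W k (g + e)"
            by (simp add: algebra_simps)
        next
          fix c y assume "br e g Y y \<in> x.W k (g + e)"
          then have "c \<odot> br e g Y y \<in> x.W k (g + e)"
            by (rule x.W_sc)
          then show "br e g Y (c \<odot> y) \<in> x.W k (g + e)"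
            by (simp add: algebra_simps)
        qed
        fix l b g' assume b: "l < k" "b \<in> U g'" "g' + repeat_mset l e' = g"
        have xY: "x ^ l * Y = Y * x ^ l"
          unfolding x_def by (metis power_commutes power_mult)
        have "ch e e ^ (l * t) = 1"
          using rt by (simp add: r_def mult.commute[of l] power_mult)
        then have c: "ch g e = ch g' e"
          by (simp add: b(3)[symmetric] e'_def chim_add_left chim_repeat_left r_def)
        have "x ^ l * b * Y - ch g e \<odot> (Y * (x ^ l * b)) = x ^ l * br e g' Y b"
          by (simp add: c right_diff_distrib mult.assoc[symmetric] xY)
        also have "\<dots> \<in> x.W k (g + e)"
          by (rule x.W_gen[OF b(1) comm_Y[OF b(2)]]) (simp add: b(3)[symmetric] add_ac)
        finally show "x ^ l * b \<in> {y. y * Y - ch g e \<odot> (Y * y) \<in> x.W k (g + e)}" by simp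
      next
        fix z assume z: "z \<in> J" "z \<in> H g"
        then have "br e g Y z \<in> x.W k (g + e)"
          using skew_J[OF Y_H z(2)] skew_H[OF Y_H z(2)] by (intro x.W_J) (auto simp: add.commute)
        then show "z \<in> {y. br e g Y y \<in> x.W k (g + e)}" by simp
      qed
      then show ?thesis using k VI by blast
    qed
  qed (fact V_sub V_mult Y_H e_nonempty)+
  \<comment> \<open>In degree \<open>e\<close> no positive power of \<open>x\<close> can occur, as
    \<open>x\<close> has degree \<open>t\<close> times \<open>e\<close> with t >= 2.\<close>
  have YV: "Y \<notin> V e"
  proof
    assume "Y \<in> V e"
    then obtain k where "Y \<in> x.W k e" by (auto simp: V_def)
    moreover have "x.W k e \<subseteq> U e"
    proof (rule x.W_minimal)
      fix l b g assume b: "b \<in> U g" "g + repeat_mset l e' = e"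
      have "l = 0"
      proof (rule ccontr)
        assume "l \<noteq> 0"
        then have "2 \<le> l * t" using t(2) by (metis le_trans mult_le_mono1 nat_mult_1 less_one not_less)
        then have "2 * size e \<le> l * t * size e" by (rule mult_le_mono1)
        moreover have "size g + l * t * size e = size e"
          using arg_cong[OF b(2), of size] by (simp add: e'_def)
        ultimately have "size e = 0" by linarith
        then show False using e_nonempty by simp
      qed
      then show "x ^ l * b \<in> U e" using b by simp
    qed (use U_subspace J_U in auto)
    ultimately show False using Y by blast
  qed
  \<comment> \<open>\<open>x\<close> is free over \<open>U\<close> because \<open>ch e' e' = 1\<close>, and \<open>1, Y, \<dots>, Y\<^bsup>t - 1\<^esup>\<close> are free over \<open>V = U[x]\<close>.\<close>
  let ?K = "\<lambda>s. {k. k \<in> K \<and> k mod t = s}"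
  define b where "b s = (\<Sum>k\<in>?K s. x ^ (k div t) * a k)" for s
  have step: "Y ^ k * a k = Y ^ (k mod t) * (x ^ (k div t) * a k)" for k
  proof -
    have "Y ^ k = Y ^ (k mod t + t * (k div t))" by simp
    then show ?thesis unfolding x_def power_add power_mult by (simp add: mult.assoc)
  qed
  \<comment> \<open>The common degree of the terms of \<open>b s\<close>, read off from any exponent
    in the residue class; the empty multiset is a placeholder for an empty class.\<close>
  define g where "g s = (if \<exists>k. k \<in> ?K s then f (SOME k. k \<in> ?K s) + repeat_mset ((SOME k. k \<in> ?K s) div t) e' else {#})" for s
  have g: "f k + repeat_mset (k div t) e' = g (k mod t)" "g (k mod t) + repeat_mset (k mod t) e = d" if "k \<in> K" for k
  proof -
    have deg: "f k + repeat_mset (k div t) e' + repeat_mset (k mod t) e = d" if "k \<in> K" for k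
    proof -
      have "repeat_mset (k div t) e' + repeat_mset (k mod t) e = repeat_mset (k div t * t + k mod t) e"
        by (simp only: e'_def repeat_mset_distrib repeat_mset_right)
      then show ?thesis using K(2)[OF that] by (simp add: add.assoc)
    qed
    have ex: "\<exists>l. l \<in> ?K (k mod t)" using \<open>k \<in> K\<close> by auto
    define l where "l = (SOME l. l \<in> ?K (k mod t))"
    have l: "l \<in> ?K (k mod t)" unfolding l_def by (rule someI_ex[OF ex])
    then have gl: "g (k mod t) = f l + repeat_mset (l div t) e'" using ex by (auto simp: g_def l_def)
    have "l \<in> K" "l mod t = k mod t" using l by auto
    then show "g (k mod t) + repeat_mset (k mod t) e = d"
      using deg[of l] gl by simp
    with deg[OF \<open>k \<in> K\<close>] show "f k + repeat_mset (k div t) e' = g (k mod t)"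
      by (metis add_right_cancel)
  qed
  let ?s = "k mod t"
  have bJ: "b ?s \<in> J"
  proof (rule v.powers_indep[OF YV, of "(\<lambda>k. k mod t) ` K" b g d])
    show "qn (ch e e) m \<noteq> 0" if "l \<in> (\<lambda>k. k mod t) ` K" "0 < m" "m \<le> l" for l m
    proof (rule primitive_root_qn[OF t(1) that(2)])
      show "m < t" using that(1,3) mod_less_divisor[OF t0] by (auto intro: le_less_trans)
    qed
    show "b s \<in> V (g s) \<and> g s + repeat_mset s e = d" if "s \<in> (\<lambda>k. k mod t) ` K" for s
    proof
      show "b s \<in> V (g s)"
        unfolding b_def
      proof (rule nc.subspace_sum[OF V_sub])
        fix k assume "k \<in> ?K s"
        then have "f k + repeat_mset (k div t) e' = g s" "a k \<in> U (f k)" using g K(2) by auto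
        then show "x ^ (k div t) * a k \<in> V (g s)"
          using x.W_gen[OF lessI] VI by blast
      qed
      show "g s + repeat_mset s e = d" using that g by auto
    qed
    have "(\<Sum>k\<in>K. Y ^ k * a k) = (\<Sum>s\<in>(\<lambda>k. k mod t) ` K. \<Sum>k\<in>?K s. Y ^ k * a k)"
      by (rule sum.image_gen[OF K(1)])
    also have "\<dots> = (\<Sum>s\<in>(\<lambda>k. k mod t) ` K. Y ^ s * b s)"
      unfolding b_def sum_distrib_left by (intro sum.cong refl) (use step in auto)
    finally show "(\<Sum>s\<in>(\<lambda>k. k mod t) ` K. Y ^ s * b s) \<in> J" using sum by simp
  qed (use K(1) k in auto)
  have inj: "inj_on (\<lambda>k. k div t) (?K ?s)"
    by (rule inj_onI) (metis (mono_tags, lifting) mem_Collect_eq div_mult_mod_eq)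
  have "(\<lambda>l. a (l * t + ?s)) (k div t) \<in> J"
  proof (rule x.powers_indep[of "(\<lambda>k. k div t) ` ?K ?s" "\<lambda>l. a (l * t + ?s)" "\<lambda>l. f (l * t + ?s)" "g ?s" "k div t"])
    show "x \<notin> U e'" using X by (simp add: x_def e'_def)
    show "qn (ch e' e') m \<noteq> 0" if "0 < m" for m
      using char0[OF that] rt by (simp add: e'_def chim_repeat_left chim_repeat_right r_def)
    show "a (l * t + ?s) \<in> U (f (l * t + ?s)) \<and> f (l * t + ?s) + repeat_mset l e' = g ?s"
      if "l \<in> (\<lambda>k. k div t) ` ?K ?s" for l
    proof -
      from that obtain k' where k': "k' \<in> K" "k' mod t = ?s" "l = k' div t" by auto
      then have "l * t + ?s = k'" by (metis div_mult_mod_eq)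
      then show ?thesis using g(1)[OF k'(1)] K(2)[OF k'(1)] k' by simp
    qed
    have "(\<Sum>l\<in>(\<lambda>k. k div t) ` ?K ?s. x ^ l * a (l * t + ?s)) = b ?s"
      unfolding b_def sum.reindex[OF inj] o_def
      by (intro sum.cong refl) (metis (mono_tags, lifting) mem_Collect_eq div_mult_mod_eq)
    then show "(\<Sum>l\<in>(\<lambda>k. k div t) ` ?K ?s. x ^ l * a (l * t + ?s)) \<in> J" using bJ by simp
  qed (use K(1) k in auto)
  then show ?thesis by simp
qed

text \<open>Three cases for r = \<open>ch e e\<close>: it has an order t >= 2 and the t-th power of
  \<open>Y\<close> lies in \<open>U\<close>, so all exponents are below t; it has such an order and
  the power is not in \<open>U\<close>; or no (m)_r with m > 0 vanishes.\<close>

theorem powers_below_height_indep: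
  assumes Y: "Y \<notin> U e" and char0: "\<And>k. 0 < k \<Longrightarrow> qn (1 :: 'a) k \<noteq> 0"
    and height: "\<And>k t. k \<in> K \<Longrightarrow> primitive_root (ch e e) t \<Longrightarrow> Y ^ t \<in> U (repeat_mset t e) \<Longrightarrow> k < t"
    and K: "finite K" "\<And>k. k \<in> K \<Longrightarrow> a k \<in> U (f k) \<and> f k + repeat_mset k e = d"
    and sum: "(\<Sum>k\<in>K. Y ^ k * a k) \<in> J" and k: "k \<in> K"
  shows "a k \<in> J"
proof (cases "\<exists>t\<ge>2. primitive_root (ch e e) t")
  case True
  then obtain t where t: "2 \<le> t" "primitive_root (ch e e) t" by blast
  show ?thesis
  proof (cases "Y ^ t \<in> U (repeat_mset t e)")
    case True
    show ?thesis
    proof (rule powers_indep[OF Y K(1) _ K(2) sum k])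
      show "qn (ch e e) m \<noteq> 0" if "l \<in> K" "0 < m" "m \<le> l" for l m
        using height[OF that(1) t(2) True] that by (intro primitive_root_qn[OF t(2)]) auto
    qed
  next
    case False
    show ?thesis by (rule powers_indep_root[OF Y t(2,1) False char0 K sum k])
  qed
next
  case False
  show ?thesis
  proof (rule powers_indep[OF Y K(1) _ K(2) sum k])
    fix m :: nat assume m: "0 < m"
    show "qn (ch e e) m \<noteq> 0"
    proof
      assume q0: "qn (ch e e) m = 0"
      \<comment> \<open>The least such exponent is the order of r. Not being at least 2 it is 1, so
        r = 1, where (m)_r is nonzero by \<open>char0\<close>.\<close>
      let ?P = "\<lambda>t. 0 < t \<and> ch e e ^ t = 1"
      have ex: "?P m" using qn_0_power[OF q0] m by simp
      have "?P (LEAST t. ?P t)" using ex by (rule LeastI)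
      moreover have "\<not> ?P s" if "s < (LEAST t. ?P t)" for s using that by (rule not_less_Least)
      ultimately have "primitive_root (ch e e) (LEAST t. ?P t)" unfolding primitive_root_def by blast
      then have "\<not> 2 \<le> (LEAST t. ?P t)" using False by blast
      then have "(LEAST t. ?P t) = 1" using \<open>?P (LEAST t. ?P t)\<close> by linarith
      then have "ch e e = 1" using \<open>?P (LEAST t. ?P t)\<close> by (metis power_one_right)
      then show False using q0 char0[OF m] by simp
    qed
  qed
qed

text \<open>For k >= h the k-th power of \<open>Y\<close> is an element of \<open>U\<close> followed
  by k - h factors \<open>Y\<close>. Moving these to the left gives \<open>Y\<close>-degree at most
  k - h, which is less than k.\<close>

lemma W_reduce:
  assumes "Y ^ h \<in> U (repeat_mset h e)" "0 < h"
  shows "W k d \<subseteq> W h d"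
proof (induction k)
  case 0
  then show ?case by (rule W_mono) simp
next
  case (Suc k)
  show ?case
  proof (cases "Suc k \<le> h")
    case False
    then have k: "k = h + (k - h)" by simp
    have pow: "x * Y ^ m \<in> W (Suc m) (g + repeat_mset m e)" if "x \<in> U g" for x g m
    proof (induction m)
      case (Suc m)
      show ?case using W_mult_Y[OF Suc.IH] by (simp add: power_Suc2 mult.assoc add_ac del: power_Suc)
    qed (use that U_W in simp)
    have "W (Suc k) d \<subseteq> W k d"
    proof (rule W_minimal)
      fix l a f assume a: "l < Suc k" "a \<in> U f" "f + repeat_mset l e = d"
      show "Y ^ l * a \<in> W k d"
      proof (cases "l = k")
        case True
        have "Y ^ h * Y ^ (k - h) * a \<in> W (Suc (k - h)) (repeat_mset h e + repeat_mset (k - h) e + f)"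
          by (intro W_mult_U pow assms a)
        also have "Y ^ h * Y ^ (k - h) = Y ^ l"
          using k True by (simp flip: power_add)
        also have "repeat_mset h e + repeat_mset (k - h) e + f = d"
          using a(3) True k by (metis add.commute repeat_mset_distrib)
        finally have "Y ^ l * a \<in> W (Suc (k - h)) d" .
        moreover have "Suc (k - h) \<le> k" using False assms(2) by simp
        ultimately show ?thesis using W_mono by blast
      qed (use a W_gen in auto)
    qed (use W_subspace W_J in auto)
    then show ?thesis using Suc.IH by blast
  qed (rule W_mono)
qed

end

section \<open>The PBW basis\<close>

lemma in_span_mod_iff:
  "in_span_mod q T x \<longleftrightarrow> (\<exists>y\<in>nc.span (Nc ` T). Nc x - y \<in> braiding.J q)"
proof
  assume "in_span_mod q T x"
  then obtain F c where F: "finite F" "F \<subseteq> T" "(\<lambda>w. x w - (\<Sum>y\<in>F. c y * y w)) \<in> nichols_ker q"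
    unfolding in_span_mod_def by blast
  have "(\<Sum>y\<in>F. c y \<odot> Nc y) \<in> nc.span (Nc ` T)"
    using F(2) by (intro nc.span_sum nc.span_scale nc.span_base) auto
  moreover have "coef (Nc x - (\<Sum>y\<in>F. c y \<odot> Nc y)) = (\<lambda>w. x w - (\<Sum>y\<in>F. c y * y w))"
    by auto
  ultimately show "\<exists>y\<in>nc.span (Nc ` T). Nc x - y \<in> braiding.J q"
    using F(3) by (intro bexI[of _ "\<Sum>y\<in>F. c y \<odot> Nc y"]) (simp_all add: braiding.J_def)
next
  assume "\<exists>y\<in>nc.span (Nc ` T). Nc x - y \<in> braiding.J q"
  then obtain t r where t: "finite t" "t \<subseteq> Nc ` T" "Nc x - (\<Sum>a\<in>t. r a \<odot> a) \<in> braiding.J q"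
    unfolding nc.span_explicit by blast
  have inj: "inj_on coef t"
    by (rule inj_onI) (metis Nc_coef)
  have "coef (Nc x - (\<Sum>a\<in>t. r a \<odot> a)) = (\<lambda>w. x w - (\<Sum>y\<in>coef ` t. r (Nc y) * y w))"
    by (auto simp: sum.reindex[OF inj])
  moreover have "coef ` t \<subseteq> T" using t(2) by auto
  ultimately show "in_span_mod q T x"
    unfolding in_span_mod_def using t(1,3)
    by (intro exI[of _ "coef ` t"] exI[of _ "\<lambda>y. r (Nc y)"]) (simp add: braiding.J_def)
qed

lemma Nc_tprod: "Nc (tprod xs) = prod_list (map Nc xs)"
proof (induction xs)
  case (Cons x xs)
  show ?case
    unfolding list.map prod_list.Cons Cons.IH[symmetric] by (simp add: tprod_def times_nc_def)
qed (simp add: tprod_def one_nc_def)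

lemma Nc_tpow: "Nc (tpow x k) = Nc x ^ k"
  by (induction k) (simp_all add: tpow_def Nc_tprod)

context braiding
begin

lemma UJ_subst:
  assumes "\<And>z. z \<in> P \<Longrightarrow> mset z \<subseteq># d \<Longrightarrow> S z \<in> UJ Q (mset z)" "\<forall>v\<in>Q. standard v"
  shows "UJ P d \<subseteq> UJ Q d"
proof -
  have words: "prod_list (map S vs) \<in> UJ Q (mset (concat vs))" if "set vs \<subseteq> P" "mset (concat vs) \<subseteq># d" for vs
    using that
  proof (induction vs)
    case (Cons v vs)
    then have "mset v \<subseteq># d" "mset (concat vs) \<subseteq># d"
      by (auto dest: mset_subset_eq_add_left[THEN subset_mset.trans] mset_subset_eq_add_right[THEN subset_mset.trans])
    then show ?case
      using Cons assms UJ_mult[of "S v" Q "mset v" "prod_list (map S vs)" "mset (concat vs)"] by simp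
  qed (simp add: UJ_1)
  show ?thesis
    unfolding UJ_def[of P]
    by (rule nc.span_minimal[OF _ UJ_subspace]) (use words J_UJ in auto)
qed

text \<open>The set \<open>low u\<close> does not bound the letters, but the degree \<open>d\<close>
  does. This identifies the graded space with the span used for hardness and height.\<close>

lemma UJ_low_iff:
  assumes x: "x \<in> H d" and d: "set_mset d \<subseteq> {..<n}"
  shows "x \<in> UJ (low u) d \<longleftrightarrow> in_span_mod q (lower_superwords q n u d) (coef x)"
proof -
  let ?A = "{prod_list (map S vs) | vs. set vs \<subseteq> low u \<and> mset (concat vs) = d}"
  have word: "word_over n v" if "v \<in> set vs" "mset (concat vs) = d" for v vs
  proof -
    have "set v \<subseteq> set (concat vs)" using that(1) by auto
    also have "set (concat vs) = set_mset d" using that(2) by (metis set_mset_mset)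
    finally show ?thesis using d by (auto simp: word_over_def)
  qed
  have A: "Nc ` lower_superwords q n u d = ?A"
  proof (intro equalityI subsetI)
    fix y assume "y \<in> Nc ` lower_superwords q n u d"
    then obtain vs where vs: "y = Nc (tprod (map (sl q) vs))" "\<forall>v\<in>set vs. standard v \<and> word_over n v \<and> wless v u"
      "mset (concat vs) = d"
      unfolding lower_superwords_def by blast
    have "y = prod_list (map S vs)" unfolding vs Nc_tprod map_map o_def S_def ..
    then show "y \<in> ?A" using vs(2,3) by (auto simp: low_def)
  next
    fix y assume "y \<in> ?A"
    then obtain vs where vs: "y = prod_list (map S vs)" "set vs \<subseteq> low u" "mset (concat vs) = d" by blast
    have "y = Nc (tprod (map (sl q) vs))" unfolding vs Nc_tprod map_map o_def S_def ..
    then show "y \<in> Nc ` lower_superwords q n u d"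
      using vs(2,3) word unfolding lower_superwords_def by (auto simp: low_def subset_iff intro!: imageI exI[of _ vs])
  qed
  have AH: "nc.span ?A \<subseteq> H d"
    by (rule nc.span_minimal) (use prod_S_H in \<open>auto simp: H_subspace low_def subset_iff\<close>)
  have JH: "nc.span (J \<inter> H d) = J \<inter> H d"
    by (rule nc.span_eq_iff[THEN iffD2]) (intro nc.subspace_inter J_subspace H_subspace)
  show ?thesis
    unfolding in_span_mod_iff A Nc_coef UJ_def nc.span_Un JH
  proof (safe)
    fix a b assume "a \<in> nc.span ?A" "b \<in> J" "b \<in> H d"
    then show "\<exists>y\<in>nc.span ?A. a + b - y \<in> J" by (intro bexI[of _ a]) auto
  next
    fix y assume y: "y \<in> nc.span ?A" "x - y \<in> J"
    have "x - y \<in> H d" using x y AH H_diff by blast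
    moreover have "x = y + (x - y)" by simp
    ultimately show "\<exists>x' y'. x = x' + y' \<and> x' \<in> nc.span ?A \<and> y' \<in> J \<inter> H d" using y by blast
  qed
qed

end

context nichols
begin

abbreviation hard_word :: "nat list \<Rightarrow> bool" where "hard_word \<equiv> hard q n"

lemma hard_props:
  assumes "hard_word u"
  shows "standard u" "set_mset (mset u) \<subseteq> {..<n}" "S u \<notin> UJ (low u) (mset u)"
proof -
  show std: "standard u" and w: "set_mset (mset u) \<subseteq> {..<n}"
    using assms by (auto simp: hard_def word_over_def)
  show "S u \<notin> UJ (low u) (mset u)"
    using assms UJ_low_iff[OF S_H[OF std] w] by (simp add: hard_def S_def)
qed

lemma not_hard: "standard u \<Longrightarrow> set u \<subseteq> {..<n} \<Longrightarrow> \<not> hard_word u \<Longrightarrow> S u \<in> UJ (low u) (mset u)"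
  using UJ_low_iff[OF S_H, of u n u] by (simp add: hard_def S_def word_over_def)

lemma height_cond_iff:
  assumes "standard u" "set u \<subseteq> {..<n}"
  shows "height_cond q n u h \<longleftrightarrow>
    primitive_root (ch (mset u) (mset u)) h \<and> S u ^ h \<in> UJ (low u) (repeat_mset h (mset u))"
proof -
  have "S u ^ h \<in> H (repeat_mset h (mset u))"
    by (induction h) (auto simp: one_in_H intro: H_mult S_H assms)
  moreover have "set_mset (repeat_mset h (mset u)) \<subseteq> {..<n}"
    using assms(2) by (induction h) auto
  moreover have "coef (S u ^ h) = tpow (sl q u) h"
    by (simp add: S_def flip: Nc_tpow)
  ultimately show ?thesis
    using UJ_low_iff by (auto simp: height_cond_def chi_chim)
qed

lemma height_cases:
  assumes "standard u" "set u \<subseteq> {..<n}"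
  shows "height q n u = \<infinity> \<and> (\<forall>h. \<not> height_cond q n u h) \<or> (\<exists>h. height q n u = enat h \<and> height_cond q n u h)"
  unfolding height_def using LeastI_ex[of "height_cond q n u"] by auto

text \<open>The order of a root of unity is unique, so the least witness in \<open>height\<close> is
  the only one.\<close>

lemma below_height:
  assumes "standard u" "set u \<subseteq> {..<n}" "enat k < height q n u" "height_cond q n u t"
  shows "k < t"
proof -
  obtain h where h: "height q n u = enat h" "height_cond q n u h"
    using height_cases[OF assms(1,2)] assms(4) by blast
  then have "h = t"
    using assms(4) height_cond_iff[OF assms(1,2)] primitive_root_unique by blast
  then show ?thesis using h assms(3) by simp
qed

text \<open>Nonhard super-letters are eliminated by induction on the finite set of smaller words of
  bounded length.\<close>

lemma S_hard:
  assumes "standard u" "set u \<subseteq> {..<n}" "length u \<le> N"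
  shows "S u \<in> UJ {z. hard_word z \<and> (wless z u \<or> z = u)} (mset u)"
  using assms
proof (induction "card {y. set y \<subseteq> {..<n} \<and> length y \<le> N \<and> wless y u}" arbitrary: u rule: less_induct)
  case less
  let ?B = "\<lambda>u. {y. set y \<subseteq> {..<n} \<and> length y \<le> N \<and> wless y u}"
  let ?Q = "\<lambda>u. {z. hard_word z \<and> (wless z u \<or> z = u)}"
  have std: "\<forall>v\<in>?Q u. standard v" using hard_props by blast
  show ?case
  proof (cases "hard_word u")
    case True
    then show ?thesis by (intro UJ_letter) simp
  next
    case False
    have "UJ (low u) (mset u) \<subseteq> UJ (?Q u) (mset u)"
    proof (rule UJ_subst[OF _ std])
      fix z assume z: "z \<in> low u" "mset z \<subseteq># mset u"
      have zu: "standard z" "wless z u" using z by (auto simp: low_def)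
      have zw: "set z \<subseteq> {..<n}" "length z \<le> N"
        using set_mset_mono[OF z(2)] size_mset_mono[OF z(2)] less.prems by auto
      have "z \<in> ?B u" "z \<notin> ?B z" using zu zw by auto
      moreover have "?B z \<subseteq> ?B u" using wless_trans zu by blast
      ultimately have "?B z \<subset> ?B u" by blast
      moreover have "finite (?B u)"
        by (rule finite_subset[OF _ finite_lists_length_le[of "{..<n}" N]]) auto
      ultimately have "card (?B z) < card (?B u)" by (rule psubset_card_mono[rotated])
      then have "S z \<in> UJ (?Q z) (mset z)"
        using less.hyps zu zw by blast
      moreover have "?Q z \<subseteq> ?Q u" using zu wless_trans by blast
      ultimately show "S z \<in> UJ (?Q u) (mset z)"
        using UJ_mono[of "?Q z" "mset z" "?Q u"] by blast
    qed
    then show ?thesis using not_hard[OF less.prems(1,2) False] by blast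
  qed
qed

lemma UJ_low_hard:
  assumes "set_mset d \<subseteq> {..<n}"
  shows "UJ (low u) d \<subseteq> UJ {z. hard_word z \<and> wless z u} d"
proof (rule UJ_subst)
  fix z assume z: "z \<in> low u" "mset z \<subseteq># d"
  then have "standard z" "wless z u" "set z \<subseteq> {..<n}"
    using set_mset_mono[OF z(2)] assms by (auto simp: low_def)
  then have "S z \<in> UJ {y. hard_word y \<and> (wless y z \<or> y = z)} (mset z)"
    using S_hard[of z "length z"] by simp
  moreover have "{y. hard_word y \<and> (wless y z \<or> y = z)} \<subseteq> {y. hard_word y \<and> wless y u}"
    using \<open>wless z u\<close> wless_trans by blast
  ultimately show "S z \<in> UJ {z. hard_word z \<and> wless z u} (mset z)"
    using UJ_mono[of "{y. hard_word y \<and> (wless y z \<or> y = z)}" "mset z"] by blast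
qed (use hard_props in blast)

lemma H_hard:
  assumes "set_mset d \<subseteq> {..<n}"
  shows "H d \<subseteq> UJ {z. hard_word z} d"
proof -
  have "X w \<in> UJ {z. hard_word z} (mset w)" if "set w \<subseteq> {..<n}" for w
    using that
  proof (induction w)
    case Nil
    then show ?case by (simp add: X_Nil UJ_1)
  next
    case (Cons i w)
    have "S [i] \<in> UJ {y. hard_word y \<and> (wless y [i] \<or> y = [i])} {#i#}"
      using S_hard[of "[i]" 1] standard_single Cons.prems by simp
    then have "X [i] \<in> UJ {z. hard_word z} {#i#}"
      using UJ_mono[of "{y. hard_word y \<and> (wless y [i] \<or> y = [i])}" "{#i#}" "{z. hard_word z}"]
      by (auto simp: S_single)
    then show ?case
      using UJ_mult[of "X [i]" _ "{#i#}" "X w" "mset w"] Cons hard_props by (simp add: X_mult)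
  qed
  then show ?thesis
    unfolding H_subset_iff[OF UJ_subspace] using assms by auto
qed

lemma ore_low:
  assumes "standard u"
  shows "ore q (UJ (low u)) (S u) (mset u)"
proof
  note std = low_standard(1)[of u]
  show "x \<in> H d" if "x \<in> UJ (low u) d" for x d using UJ_H[OF std] that by blast
  show "x * y \<in> UJ (low u) (d + f)" if "x \<in> UJ (low u) d" "y \<in> UJ (low u) f" for x y d f
    using UJ_mult[OF that std] .
  show "mset u \<noteq> {#}" using standard_nonempty[OF assms] by simp
qed (fact UJ_subspace J_UJ UJ_1 UJ_low_der S_H[OF assms] der_S_low[OF assms] UJ_low_comm[OF assms])+

section \<open>Ordered monomials: spanning and independence\<close>

fun Mon :: "nat list list \<Rightarrow> nat list \<Rightarrow> 'a nc" where
  "Mon (u # us) (k # ks) = S u ^ k * Mon us ks"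
| "Mon _ _ = 1"

fun dg :: "nat list list \<Rightarrow> nat list \<Rightarrow> nat multiset" where
  "dg (u # us) (k # ks) = dg us ks + repeat_mset k (mset u)"
| "dg _ _ = {#}"

abbreviation restr :: "nat list list \<Rightarrow> nat list \<Rightarrow> bool"
  where "restr \<equiv> list_all2 (\<lambda>u k. enat k < height q n u)"

text \<open>At every stage the tail lists all hard words below the head, so that coefficients in
  \<open>UJ (low u)\<close> can be expanded in monomials of the tail.\<close>

fun good :: "nat list list \<Rightarrow> bool" where
  "good [] \<longleftrightarrow> True"
| "good (u # us) \<longleftrightarrow> hard_word u \<and> set us = {z. hard_word z \<and> wless z u} \<and> good us"

lemma good_sorted:
  assumes "sorted_wrt (\<lambda>a b. wless b a) us" "\<forall>u\<in>set us. hard_word u"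
    "\<forall>u\<in>set us. \<forall>z. hard_word z \<longrightarrow> wless z u \<longrightarrow> z \<in> set us"
  shows "good us"
  using assms
proof (induction us)
  case (Cons u us)
  have lt: "wless z u" if "z \<in> set us" for z
    using Cons.prems(1) that by simp
  have mem: "z \<in> set us" if "hard_word z" "wless z v" "v \<in> set (u # us)" for z v
  proof -
    have "z = u \<or> z \<in> set us" using Cons.prems(3) that by auto
    moreover have "z \<noteq> u" using that(2,3) lt wless_trans wless_irrefl by (metis set_ConsD)
    ultimately show ?thesis by blast
  qed
  have "good us"
  proof (rule Cons.IH)
    show "\<forall>v\<in>set us. \<forall>z. hard_word z \<longrightarrow> wless z v \<longrightarrow> z \<in> set us"
      using mem by (meson list.set_intros(2))
  qed (use Cons.prems(1,2) in simp_all)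
  moreover have "set us = {z. hard_word z \<and> wless z u}"
    using mem[of _ u] lt Cons.prems(2) by auto
  ultimately show ?case using Cons.prems(2) by simp
qed simp

lemma Mon_pbw: "Nc (pbw_mono q us ks) = Mon us ks"
  by (induction us ks rule: Mon.induct) (simp_all add: pbw_mono_def Nc_tprod Nc_tpow S_def)

lemma good_hard: "good us \<Longrightarrow> u \<in> set us \<Longrightarrow> hard_word u"
  by (cases us) auto

lemma S_pow_H: "standard u \<Longrightarrow> S u ^ k \<in> H (repeat_mset k (mset u))"
  by (induction k) (auto simp: one_in_H intro: H_mult S_H)

lemma Mon_UJ: "set us \<subseteq> P \<Longrightarrow> \<forall>v\<in>P. standard v \<Longrightarrow> Mon us ks \<in> UJ P (dg us ks)"
proof (induction us ks rule: Mon.induct)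
  case (1 u us k ks)
  have "S u ^ k \<in> UJ P (repeat_mset k (mset u))"
  proof (induction k)
    case (Suc k)
    then show ?case
      using 1(2,3) UJ_mult[OF UJ_letter Suc, of u] by simp
  qed (simp add: UJ_1)
  then show ?case
    using 1 UJ_mult[of "S u ^ k" P "repeat_mset k (mset u)" "Mon us ks" "dg us ks"] by (simp add: add.commute)
qed (simp_all add: UJ_1)

lemma Mon_H: "good us \<Longrightarrow> Mon us ks \<in> H (dg us ks)"
  using Mon_UJ[of us "set us" ks] UJ_H[of "set us"] good_hard hard_props(1) by blast

text \<open>A super-word in any order is a polynomial in [u], \<open>u\<close> being the largest
  word, with coefficients in \<open>UJ (low u)\<close>. Powers from the height on are removed by
  \<open>W_reduce\<close>; after elimination of nonhard super-letters the coefficients belong to the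
  tail and are expanded inductively.\<close>

lemma Mon_span:
  assumes "good us" "set_mset d \<subseteq> {..<n}"
  shows "UJ (set us) d \<subseteq> nc.span ({Mon us ks | ks. restr us ks \<and> dg us ks = d} \<union> (J \<inter> H d))"
  using assms
proof (induction us arbitrary: d)
  case Nil
  have "prod_list (map S vs) \<in> {Mon [] ks | ks. restr [] ks \<and> dg [] ks = d}"
    if "set vs \<subseteq> set []" "mset (concat vs) = d" for vs
    using that by auto
  then show ?case
    unfolding UJ_def by (intro nc.span_mono Un_mono) blast+
next
  case (Cons u us)
  have u: "hard_word u" "standard u" "set u \<subseteq> {..<n}" and us: "set us = {z. hard_word z \<and> wless z u}" "good us"
    using Cons.prems hard_props by auto
  interpret o: ore q "UJ (low u)" "S u" "mset u" by (rule ore_low[OF u(2)])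
  let ?T = "nc.span ({Mon (u # us) ks | ks. restr (u # us) ks \<and> dg (u # us) ks = d} \<union> (J \<inter> H d))"
  have T: "nc.subspace ?T" by simp
  have TJ: "x \<in> ?T" if "x \<in> J" "x \<in> H d" for x using that by (intro nc.span_base) auto
  have gen: "S u ^ l * a \<in> ?T"
    if l: "enat l < height q n u" and a: "a \<in> UJ (low u) f" and f: "f + repeat_mset l (mset u) = d" for l a f
  proof -
    have fn: "set_mset f \<subseteq> {..<n}" using Cons.prems(2) f by auto
    have "a \<in> UJ (set us) f" using UJ_low_hard[OF fn] a us(1) by auto
    then have "a \<in> nc.span ({Mon us ks | ks. restr us ks \<and> dg us ks = f} \<union> (J \<inter> H f))"
      using Cons.IH[OF us(2) fn] by blast
    then show ?thesis
    proof (induction rule: nc.span_induct_alt)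
      case base
      then show ?case using nc.subspace_0[OF T] by simp
    next
      case (step c x y)
      have "S u ^ l * x \<in> ?T"
      proof (cases "x \<in> J \<inter> H f")
        case True
        then have "S u ^ l * x \<in> H d" "S u ^ l * x \<in> J"
          using H_mult[OF S_pow_H[OF u(2)], of x f l] J_mult[OF S_pow_H[OF u(2)], of x f l] f
          by (auto simp: add.commute)
        then show ?thesis using TJ by blast
      next
        case False
        then obtain ks where "x = Mon us ks" "restr us ks" "dg us ks = f" using step(1) by blast
        then show ?thesis
          using l f by (intro nc.span_base UnI1 CollectI exI[of _ "l # ks"]) auto
      qed
      then show ?case
        using step(2) by (simp add: distrib_left nc.subspace_add[OF T] nc.subspace_scale[OF T])
    qed
  qed
  have W: "o.W k d \<subseteq> ?T" for k
  proof -
    consider "height q n u = \<infinity>" | h where "height q n u = enat h" "height_cond q n u h"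
      using height_cases[OF u(2,3)] by metis
    then show ?thesis
    proof cases
      case 1
      then show ?thesis using gen TJ by (intro o.W_minimal T) auto
    next
      case (2 h)
      then have "S u ^ h \<in> UJ (low u) (repeat_mset h (mset u))" "0 < h"
        using height_cond_iff[OF u(2,3)] by (auto simp: primitive_root_def)
      then have "o.W k d \<subseteq> o.W h d" by (rule o.W_reduce)
      also have "\<dots> \<subseteq> ?T" using gen TJ 2(1) by (intro o.W_minimal T) auto
      finally show ?thesis .
    qed
  qed
  have words: "prod_list (map S vs) \<in> o.W (Suc (length vs)) (mset (concat vs))" if "set vs \<subseteq> set (u # us)" for vs
    using that
  proof (induction vs rule: rev_induct)
    case Nil
    then show ?case using o.U_W[OF UJ_1] by simp
  next
    case (snoc z vs)
    then have IH: "prod_list (map S vs) \<in> o.W (Suc (length vs)) (mset (concat vs))" by simp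
    show ?case
    proof (cases "z = u")
      case True
      then show ?thesis using o.W_mult_Y[OF IH] by simp
    next
      case False
      then have "z \<in> low u" using snoc.prems us(1) hard_props by (auto simp: low_def)
      then have "prod_list (map S vs) * S z \<in> o.W (Suc (length vs)) (mset (concat vs) + mset z)"
        by (intro o.W_mult_U IH UJ_letter)
      then show ?thesis using o.W_mono[of "Suc (length vs)" "Suc (Suc (length vs))"] by auto
    qed
  qed
  show ?case
    unfolding UJ_def[of "set (u # us)"]
  proof (rule nc.span_minimal[OF _ T], safe)
    fix vs assume "set vs \<subseteq> set (u # us)" "d = mset (concat vs)"
    then show "prod_list (map S vs) \<in> nc.span ({Mon (u # us) ks | ks. restr (u # us) ks \<and> dg (u # us) ks = mset (concat vs)} \<union> (J \<inter> H (mset (concat vs))))"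
      using words W by blast
  qed (rule TJ)
qed

text \<open>Monomials are grouped by the exponent of the largest super-letter. The groups are the
  coefficients of a relation between powers below the height, hence lie in \<open>J\<close>, and
  each of them is a relation for the tail.\<close>

lemma Mon_indep:
  assumes char0: "\<And>k. 0 < k \<Longrightarrow> qn (1 :: 'a) k \<noteq> 0"
    and "good us" "finite F" "\<And>ks. ks \<in> F \<Longrightarrow> restr us ks \<and> dg us ks = d"
    and "(\<Sum>ks\<in>F. c ks \<odot> Mon us ks) \<in> J" "ks \<in> F"
  shows "c ks = 0"
  using assms(2-)
proof (induction us arbitrary: F c d ks)
  case Nil
  then have "F = {[]}" "ks = []" by auto
  then have "c [] \<odot> 1 \<in> J" using Nil.prems(4) by simp
  then show ?case
    using subspace_sc_cancel[OF J_subspace] one_notin_J \<open>ks = []\<close> by blast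
next
  case (Cons u us)
  have u: "hard_word u" "standard u" "set u \<subseteq> {..<n}" and us: "set us = {z. hard_word z \<and> wless z u}" "good us"
    using Cons.prems hard_props by auto
  interpret o: ore q "UJ (low u)" "S u" "mset u" by (rule ore_low[OF u(2)])
  have F: "\<exists>k ks'. ks = k # ks' \<and> enat k < height q n u \<and> restr us ks' \<and> dg us ks' + repeat_mset k (mset u) = d"
    if "ks \<in> F" for ks
    using Cons.prems(3)[OF that] by (auto simp: list_all2_Cons1)
  define G where "G k = {ks'. k # ks' \<in> F}" for k
  have finG: "finite (G k)" for k
    unfolding G_def using finite_vimageI[OF Cons.prems(2), of "(#) k"] by (simp add: vimage_def)
  define a where "a k = (\<Sum>ks'\<in>G k. c (k # ks') \<odot> Mon us ks')" for k
  \<comment> \<open>All members of \<open>G k\<close> have the same degree by cancellation, so any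
    choice serves.\<close>
  define f where "f k = dg us (SOME ks'. ks' \<in> G k)" for k
  have G: "restr us ks' \<and> dg us ks' = f k" if "ks' \<in> G k" for k ks'
  proof -
    have *: "restr us ks' \<and> dg us ks' + repeat_mset k (mset u) = d" if "ks' \<in> G k" for ks'
      using F[of "k # ks'"] that by (auto simp: G_def)
    have "(SOME ks'. ks' \<in> G k) \<in> G k" using that by (rule someI)
    then have "f k + repeat_mset k (mset u) = d" using * by (simp add: f_def)
    then show ?thesis using *[OF that] by (metis add_right_cancel)
  qed
  have fd: "f k + repeat_mset k (mset u) = d" "enat k < height q n u" if kF: "k \<in> hd ` F" for k
  proof -
    from kF obtain ks where ks: "ks \<in> F" "k = hd ks" by blast
    then obtain ks' where *: "ks = k # ks'" "enat k < height q n u" "dg us ks' + repeat_mset k (mset u) = d"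
      using F[OF ks(1)] by auto
    then have "dg us ks' = f k" using G[of ks' k] ks(1) by (simp add: G_def)
    then show "f k + repeat_mset k (mset u) = d" "enat k < height q n u"
      using * by simp_all
  qed
  have sum: "(\<Sum>k\<in>hd ` F. S u ^ k * a k) = (\<Sum>ks\<in>F. c ks \<odot> Mon (u # us) ks)"
  proof -
    have "(\<Sum>ks\<in>F. c ks \<odot> Mon (u # us) ks) = (\<Sum>k\<in>hd ` F. \<Sum>ks\<in>{ks \<in> F. hd ks = k}. c ks \<odot> Mon (u # us) ks)"
      by (rule sum.image_gen[OF Cons.prems(2)])
    also have "\<dots> = (\<Sum>k\<in>hd ` F. S u ^ k * a k)"
    proof (rule sum.cong[OF refl])
      fix k
      have "{ks \<in> F. hd ks = k} = (#) k ` G k"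
        using F by (force simp: G_def)
      then show "(\<Sum>ks\<in>{ks \<in> F. hd ks = k}. c ks \<odot> Mon (u # us) ks) = S u ^ k * a k"
        by (simp add: sum.reindex a_def sum_distrib_left)
    qed
    finally show ?thesis ..
  qed
  have aJ: "a k \<in> J" if "k \<in> hd ` F" for k
  proof (rule o.powers_below_height_indep[of "hd ` F" _ f d, OF hard_props(3)[OF u(1)] char0 _ _ _ _ that])
    show "k < t" if "k \<in> hd ` F" "primitive_root (ch (mset u) (mset u)) t"
      "S u ^ t \<in> UJ (low u) (repeat_mset t (mset u))" for k t
      using below_height[OF u(2,3) fd(2)[OF that(1)]] that height_cond_iff[OF u(2,3)] by blast
    show "a k \<in> UJ (low u) (f k) \<and> f k + repeat_mset k (mset u) = d" if "k \<in> hd ` F" for k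
    proof
      have "set us \<subseteq> low u" using us(1) hard_props(1) by (auto simp: low_def)
      then have "Mon us ks' \<in> UJ (low u) (f k)" if "ks' \<in> G k" for ks'
        using Mon_UJ[of us "low u" ks'] low_standard G[OF that] by auto
      then show "a k \<in> UJ (low u) (f k)"
        unfolding a_def by (intro nc.subspace_sum[OF UJ_subspace] UJ_sc)
    qed (rule fd(1)[OF that])
    show "(\<Sum>k\<in>hd ` F. S u ^ k * a k) \<in> J" using Cons.prems(4) by (simp add: sum)
  qed (use Cons.prems(2) in auto)
  obtain k ks' where ks: "ks = k # ks'" using F Cons.prems(5) by blast
  then have "ks' \<in> G k" "k \<in> hd ` F" using Cons.prems(5) by (auto simp: G_def rev_image_eqI)
  then show ?case
    using Cons.IH[where F = "G k" and d = "f k" and c = "\<lambda>ks'. c (k # ks')" and ks = ks', OF us(2) finG G]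
      aJ[of k] ks by (simp add: a_def)
qed

end

text \<open>Each functional \<open>qform v\<close> sees only the component of degree
  \<open>mset v\<close>, so \<open>J\<close> is compatible with the gradation.\<close>

lemma (in braiding) J_component:
  assumes "finite F" "\<And>k. k \<in> F \<Longrightarrow> x k \<in> H (g k)" "(\<Sum>k\<in>F. x k) \<in> J"
  shows "(\<Sum>k | k \<in> F \<and> g k = d. x k) \<in> J"
  unfolding in_J_qform
proof
  fix v
  have add: "qform v (sum x A) = (\<Sum>k\<in>A. qform v (x k))" for A
    unfolding qform_def coef_sum sum_distrib_right by (rule sum.swap)
  have zero: "qform v (x k) = 0" if "k \<in> F" "g k \<noteq> mset v" for k
    using assms(2)[OF that(1)] that(2) unfolding qform_def H_def by (intro sum.neutral) force
  show "qform v (\<Sum>k | k \<in> F \<and> g k = d. x k) = 0"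
  proof (cases "d = mset v")
    case True
    have "qform v (\<Sum>k | k \<in> F \<and> g k = d. x k) = (\<Sum>k\<in>F. qform v (x k))"
      unfolding add by (rule sum.mono_neutral_left) (use assms(1) zero True in auto)
    also have "\<dots> = 0" using assms(3) in_J_qform add by metis
    finally show ?thesis .
  next
    case False
    then show ?thesis unfolding add by (intro sum.neutral) (use zero in auto)
  qed
qed

theorem theorem3p3:
  fixes q :: "nat \<Rightarrow> nat \<Rightarrow> 'a::field_char_0"
    and n :: nat
    and us :: "nat list list"
  assumes "alg_closed TYPE('a)"
    and "2 \<le> n"
    and "\<forall>i<n. q i i \<noteq> 1"
    and "set us = {u. hard q n u}"
    and "sorted_wrt (\<lambda>a b. wless b a) us"
  shows "basis_mod q
           {ks. length ks = length us
              \<and> (\<forall>i<length us. enat (ks ! i) < height q n (us ! i))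
              \<and> 0 < sum_list ks
              \<and> connected_in q (mu (pbw_mono q us ks))}
           (pbw_mono q us) (Lie_elems q n)"
proof -
  interpret nichols q n by unfold_locales (use assms(3) in blast)
  have char0: "qn (1 :: 'a) k \<noteq> 0" if "0 < k" for k
    using that by (simp add: qn_def)
  have good: "good us"
    by (rule good_sorted) (use assms(4,5) in auto)
  define K where "K = {ks. length ks = length us \<and> (\<forall>i<length us. enat (ks ! i) < height q n (us ! i))
      \<and> 0 < sum_list ks \<and> connected_in q (mu (pbw_mono q us ks))}"
  have indep: "c ks = 0" if "finite F" "\<And>ks. ks \<in> F \<Longrightarrow> restr us ks \<and> dg us ks = d"
    "(\<Sum>ks\<in>F. c ks \<odot> Mon us ks) \<in> J" "ks \<in> F" for F c d ks
    using Mon_indep[OF char0 good that] .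
  have not_J: "Mon us ks \<notin> J" if "restr us ks" for ks
  proof
    assume "Mon us ks \<in> J"
    then have "(1 :: 'a) = 0"
      using indep[of "{ks}" "dg us ks" "\<lambda>_. 1" ks] that by simp
    then show False by simp
  qed
  \<comment> \<open>The monomial is homogeneous and, lying outside \<open>J\<close>, has nonempty
    support; any word in the support shows the letters of the degree.\<close>
  have mu: "mu (pbw_mono q us ks) = set_mset (dg us ks)" if "restr us ks" for ks
  proof -
    have coef: "pbw_mono q us ks = coef (Mon us ks)" by (simp flip: Mon_pbw)
    have H: "coef (Mon us ks) w \<noteq> 0 \<Longrightarrow> mset w = dg us ks" for w
      using Mon_H[OF good, of ks] by (simp add: H_def)
    have "Mon us ks \<noteq> 0" using not_J[OF that] J_0 by metis
    then obtain w where w: "coef (Mon us ks) w \<noteq> 0" using nc_eqI[of "Mon us ks" 0] by auto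
    show ?thesis
      unfolding mu_def coef set_eq_iff mem_Collect_eq by (metis H set_mset_mset w)
  qed
  have sum0: "dg us ks = {#}" if "sum_list ks = 0" for us ks
    using that by (induction us ks rule: dg.induct) auto
  have K_iff: "ks \<in> K \<longleftrightarrow> restr us ks \<and> conn (set_mset (dg us ks))" for ks
  proof -
    have "(length ks = length us \<and> (\<forall>i<length us. enat (ks ! i) < height q n (us ! i))) = restr us ks"
      by (auto simp: list_all2_conv_all_nth)
    moreover have "0 < sum_list ks" if "conn (set_mset (dg us ks))"
      using sum0[of ks us] that unfolding conn_def by (metis gr0I set_mset_empty)
    ultimately show ?thesis
      using mu conn_iff_connected_in by (auto simp: K_def)
  qed
  have letters: "set_mset (dg us ks) \<subseteq> {..<n}" for ks
  proof -
    have "\<forall>u\<in>set us. set u \<subseteq> {..<n}" using assms(4) hard_props(2) by auto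
    then show ?thesis
    proof (induction us ks rule: dg.induct)
      case (1 u us k ks)
      have "set_mset (repeat_mset k (mset u)) \<subseteq> {..<n}" using 1(2) by (induction k) auto
      then show ?case using 1 by auto
    qed auto
  qed
  have Bs_Lie: "Bs d \<subseteq> Nc ` Lie_elems q n" for d
    by (force simp: Bs_def Lie_elems_def)
  show ?thesis
    unfolding basis_mod_def K_def[symmetric]
  proof (intro conjI ballI)
    show "lin_indep_mod q K (pbw_mono q us)"
      unfolding lin_indep_mod_def
    proof (intro allI impI ballI; elim conjE)
      fix F c ks
      assume F: "finite F" "F \<subseteq> K" "(\<lambda>w. \<Sum>k\<in>F. c k * pbw_mono q us k w) \<in> nichols_ker q" and ks: "ks \<in> F"
      have "coef (\<Sum>k\<in>F. c k \<odot> Mon us k) = (\<lambda>w. \<Sum>k\<in>F. c k * pbw_mono q us k w)"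
        by (auto simp flip: Mon_pbw)
      then have "(\<Sum>k\<in>F. c k \<odot> Mon us k) \<in> J" using F(3) by (simp add: J_def)
      \<comment> \<open>A relation may mix degrees; its component in the degree of \<open>ks\<close>
        is again in \<open>J\<close>.\<close>
      then have "(\<Sum>k | k \<in> F \<and> dg us k = dg us ks. c k \<odot> Mon us k) \<in> J"
        using F(1) Mon_H[OF good] H_sc by (intro J_component) auto
      then show "c ks = 0"
        by (rule indep[rotated 2, of _ _ _ "dg us ks"]) (use F ks K_iff in auto)
    qed
  next
    fix ks assume "ks \<in> K"
    then have c: "conn (set_mset (dg us ks))" by (simp add: K_iff)
    have "Mon us ks \<in> Ls (dg us ks)"
      using full_conn[OF letters c] Mon_H[OF good] by blast
    then obtain x y where xy: "Mon us ks = x + y" "x \<in> nc.span (Bs (dg us ks))" "y \<in> nc.span (J \<inter> H (dg us ks))"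
      unfolding Ls_def nc.span_Un by blast
    have "x \<in> nc.span (Nc ` Lie_elems q n)" using xy(2) nc.span_mono[OF Bs_Lie] by blast
    moreover have "y \<in> J" using xy(3) nc.span_minimal[OF _ J_subspace] by blast
    ultimately show "in_span_mod q (Lie_elems q n) (pbw_mono q us ks)"
      unfolding in_span_mod_iff Mon_pbw xy(1) by (intro bexI[of _ x]) auto
  next
    fix x assume "x \<in> Lie_elems q n"
    then obtain a where a: "(x, a) \<in> brackets q n" by (auto simp: Lie_elems_def)
    then have x: "Nc x \<in> Bs (mset a)" "Nc x \<in> H (mset a)" "set_mset (mset a) \<subseteq> {..<n}"
      using brackets_H by (auto simp: Bs_def)
    show "in_span_mod q (pbw_mono q us ` K) x"
      unfolding in_span_mod_iff
    proof (cases "Nc x \<in> J")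
      case True
      then show "\<exists>y\<in>nc.span (Nc ` pbw_mono q us ` K). Nc x - y \<in> J"
        by (intro bexI[of _ 0]) (auto simp: nc.span_zero)
    next
      case False
      then have conn: "conn (set_mset (mset a))" using Bs_conn x(1) by blast
      have "Nc x \<in> UJ (set us) (mset a)" using H_hard[OF x(3)] x(2) assms(4) by auto
      then have "Nc x \<in> nc.span ({Mon us ks | ks. restr us ks \<and> dg us ks = mset a} \<union> (J \<inter> H (mset a)))"
        using Mon_span[OF good x(3)] by blast
      then obtain y z where yz: "Nc x = y + z" "y \<in> nc.span {Mon us ks | ks. restr us ks \<and> dg us ks = mset a}"
        "z \<in> nc.span (J \<inter> H (mset a))"
        unfolding nc.span_Un by blast
      have "{Mon us ks | ks. restr us ks \<and> dg us ks = mset a} \<subseteq> Nc ` pbw_mono q us ` K"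
        using K_iff conn Mon_pbw by (fastforce simp: image_iff)
      then have "y \<in> nc.span (Nc ` pbw_mono q us ` K)" using yz(2) nc.span_mono by blast
      moreover have "z \<in> J" using yz(3) nc.span_minimal[OF _ J_subspace] by blast
      ultimately show "\<exists>y\<in>nc.span (Nc ` pbw_mono q us ` K). Nc x - y \<in> J"
        unfolding yz(1) by (intro bexI[of _ y]) auto
    qed
  qed
qed

end
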